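(* Let $\Lambda$ be a commutative local uniserial ring of length $n\ge 7$ with radical factor field $k$, and let $I\in\mathcal{S}(\Lambda)$ be the object defined in the context. Let $R$ be a finite-dimensional $k$-algebra. Then there exists an object $M$ in $\mathcal{S}(\Lambda)$ such that the quotient ring $\operatorname{End}(M)/\operatorname{End}(M)_I$ is isomorphic to $R$.
   Context: Uniserial means that the ideals of $\Lambda$ form a chain; $k=\Lambda/\operatorname{rad}\Lambda$; $t$ denotes a fixed generator of the radical of $\Lambda$. The submodule category $\mathcal{S}(\Lambda)$: objects are pairs $M=(M_0,M_1)$, also written $(M_1\subseteq M_0)$, where $M_0$ is a finitely generated $\Lambda$-module and $M_1$ is a $\Lambda$-submodule of $M_0$; a morphism $f\colon M\to N$ is a $\Lambda$-linear map $f\colon M_0\to N_0$ with $f(M_1)\subseteq N_1$. $\operatorname{End}(M)$ is the endomorphism ring in $\mathcal{S}(\Lambda)$. The object $I$: let $J_0$ be the $\Lambda$-module with generators $x,y,z$ and defining relations $t^7x=0$, $t^4y=0$, $t^2z=0$ (so $J_0\cong\Lambda/\langle t^7\rangle\oplus\Lambda/\langle t^4\rangle\oplus\Lambda/\langle t^2\rangle$). Let $J_1$ be the submodule of $J_0$ generated by $t^3x-ty$ and $ty-z$. Let $I_0$ be the submodule of $J_0$ generated by $tx,y,z$ and let $I_1=tJ_1$. Then $I=(I_1\subseteq I_0)$. $\operatorname{End}(M)_I$ denotes the ideal of $\operatorname{End}(M)$ consisting of all endomorphisms of $M$ which factor (in $\mathcal{S}(\Lambda)$) through a finite direct sum of copies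 of $I$. *)

theory Defs
  imports "HOL-Algebra.QuotRing" "HOL-Algebra.Module"
begin

section \<open>Local uniserial rings\<close>

definition local_ring :: "('a, 'm) ring_scheme \<Rightarrow> bool" where
  "local_ring R \<longleftrightarrow> cring R \<and> (\<exists>!P. maximalideal P R)"

definition uniserial_ring :: "('a, 'm) ring_scheme \<Rightarrow> bool" where
  "uniserial_ring R \<longleftrightarrow> cring R \<and> (\<forall>P Q. ideal P R \<longrightarrow> ideal Q R \<longrightarrow> P \<subseteq> Q \<or> Q \<subseteq> P)"

text \<open>Length of a commutative ring as a module over itself, via a composition series of ideals.\<close>

definition ring_has_length :: "('a, 'm) ring_scheme \<Rightarrow> nat \<Rightarrow> bool" where
  "ring_has_length R n \<longleftrightarrow>
     (\<exists>C :: nat \<Rightarrow> 'a set. C 0 = {\<zero>\<^bsub>R\<^esub>} \<and> C n = carrier R \<and> (\<forall>i\<le>n. ideal (C i) R) \<and>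
        (\<forall>i<n. C i \<subset> C (Suc i) \<and> \<not> (\<exists>P. ideal P R \<and> C i \<subset> P \<and> P \<subset> C (Suc i))))"

definition ring_rad :: "('a, 'm) ring_scheme \<Rightarrow> 'a set" where
  "ring_rad R = carrier R \<inter> \<Inter>{P. maximalideal P R}"

section \<open>Modules\<close>

text \<open>
  As in \<^locale>\<open>module\<close>, the fields \<^const>\<open>mult\<close> and \<^const>\<open>one\<close> of a module
  record carry no meaning; below they are filled with \<^const>\<open>undefined\<close>.
\<close>

definition module_span ::
  "('a, 'm) ring_scheme \<Rightarrow> ('a, 'b, 'n) module_scheme \<Rightarrow> 'b set \<Rightarrow> 'b set" where
  "module_span R M S = \<Inter>{N. submodule N R M \<and> S \<subseteq> N}"

definition finitely_generated :: "('a, 'm) ring_scheme \<Rightarrow> ('a, 'b, 'n) module_scheme \<Rightarrow> bool" where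
  "finitely_generated R M \<longleftrightarrow>
     (\<exists>S. finite S \<and> S \<subseteq> carrier M \<and> module_span R M S = carrier M)"

definition quot_module :: "('a, 'b, 'n) module_scheme \<Rightarrow> 'b set \<Rightarrow> ('a, 'b set) module" where
  "quot_module M N =
     \<lparr>carrier = a_rcosets\<^bsub>M\<^esub> N, mult = undefined, one = undefined,
      zero = N, add = set_add M,
      smult = (\<lambda>a X. \<Union>x\<in>X. N +>\<^bsub>M\<^esub> (a \<odot>\<^bsub>M\<^esub> x))\<rparr>"

text \<open>The direct sum of \<open>m\<close> copies of \<open>M\<close>.\<close>

definition module_power :: "('a, 'b, 'n) module_scheme \<Rightarrow> nat \<Rightarrow> ('a, nat \<Rightarrow> 'b) module" where
  "module_power M m =
     \<lparr>carrier = {..<m} \<rightarrow>\<^sub>E carrier M, mult = undefined, one = undefined,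
      zero = (\<lambda>i\<in>{..<m}. \<zero>\<^bsub>M\<^esub>),
      add = (\<lambda>u v. \<lambda>i\<in>{..<m}. u i \<oplus>\<^bsub>M\<^esub> v i),
      smult = (\<lambda>a u. \<lambda>i\<in>{..<m}. a \<odot>\<^bsub>M\<^esub> u i)\<rparr>"

definition regular_module :: "('a, 'm) ring_scheme \<Rightarrow> ('a, 'a) module" where
  "regular_module R =
     \<lparr>carrier = carrier R, mult = undefined, one = undefined,
      zero = \<zero>\<^bsub>R\<^esub>, add = (\<oplus>\<^bsub>R\<^esub>), smult = (\<otimes>\<^bsub>R\<^esub>)\<rparr>"

definition free_module :: "('a, 'm) ring_scheme \<Rightarrow> nat \<Rightarrow> ('a, nat \<Rightarrow> 'a) module" where
  "free_module R m = module_power (regular_module R) m"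

definition free_basis :: "('a, 'm) ring_scheme \<Rightarrow> nat \<Rightarrow> nat \<Rightarrow> nat \<Rightarrow> 'a" where
  "free_basis R m j = (\<lambda>i\<in>{..<m}. if i = j then \<one>\<^bsub>R\<^esub> else \<zero>\<^bsub>R\<^esub>)"

section \<open>Finite-dimensional algebras\<close>

text \<open>
  Associative unital algebras; unlike in \<^locale>\<open>algebra\<close>, the multiplication of \<open>A\<close>
  need not be commutative.
\<close>

definition assoc_algebra :: "('k, 'm) ring_scheme \<Rightarrow> ('k, 'b, 'n) module_scheme \<Rightarrow> bool" where
  "assoc_algebra K A \<longleftrightarrow> module K A \<and> ring A \<and>
     (\<forall>a\<in>carrier K. \<forall>x\<in>carrier A. \<forall>y\<in>carrier A.
        (a \<odot>\<^bsub>A\<^esub> x) \<otimes>\<^bsub>A\<^esub> y = a \<odot>\<^bsub>A\<^esub> (x \<otimes>\<^bsub>A\<^esub> y) \<and>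
        x \<otimes>\<^bsub>A\<^esub> (a \<odot>\<^bsub>A\<^esub> y) = a \<odot>\<^bsub>A\<^esub> (x \<otimes>\<^bsub>A\<^esub> y))"

definition fin_dim_algebra :: "('k, 'm) ring_scheme \<Rightarrow> ('k, 'b, 'n) module_scheme \<Rightarrow> bool" where
  "fin_dim_algebra K A \<longleftrightarrow> field K \<and> assoc_algebra K A \<and> finitely_generated K A"

section \<open>The submodule category\<close>

text \<open>An object \<open>(M\<^sub>0, M\<^sub>1)\<close> consists of a module and the carrier of a submodule.\<close>

type_synonym ('a, 'b) sub_pair = "('a, 'b) module \<times> 'b set"

definition S_obj :: "('a, 'm) ring_scheme \<Rightarrow> ('a, 'b) sub_pair \<Rightarrow> bool" where
  "S_obj R M \<longleftrightarrow> module R (fst M) \<and> finitely_generated R (fst M) \<and> submodule (snd M) R (fst M)"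

text \<open>
  Morphisms are extensional (\<^const>\<open>undefined\<close> off the carrier), so that equality of
  morphisms is equality of functions.
\<close>

definition S_hom ::
  "('a, 'm) ring_scheme \<Rightarrow> ('a, 'b) sub_pair \<Rightarrow> ('a, 'c) sub_pair \<Rightarrow> ('b \<Rightarrow> 'c) set" where
  "S_hom R M N =
     {f \<in> carrier (fst M) \<rightarrow>\<^sub>E carrier (fst N).
        (\<forall>x\<in>carrier (fst M). \<forall>y\<in>carrier (fst M).
           f (x \<oplus>\<^bsub>fst M\<^esub> y) = f x \<oplus>\<^bsub>fst N\<^esub> f y) \<and>
        (\<forall>a\<in>carrier R. \<forall>x\<in>carrier (fst M). f (a \<odot>\<^bsub>fst M\<^esub> x) = a \<odot>\<^bsub>fst N\<^esub> f x) \<and>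
        f ` snd M \<subseteq> snd N}"

definition S_End :: "('a, 'm) ring_scheme \<Rightarrow> ('a, 'b) sub_pair \<Rightarrow> ('b \<Rightarrow> 'b) ring" where
  "S_End R M =
     \<lparr>carrier = S_hom R M M,
      mult = compose (carrier (fst M)),
      one = (\<lambda>x\<in>carrier (fst M). x),
      zero = (\<lambda>x\<in>carrier (fst M). \<zero>\<^bsub>fst M\<^esub>),
      add = (\<lambda>f g. \<lambda>x\<in>carrier (fst M). f x \<oplus>\<^bsub>fst M\<^esub> g x)\<rparr>"

definition S_power :: "('a, 'b) sub_pair \<Rightarrow> nat \<Rightarrow> ('a, nat \<Rightarrow> 'b) sub_pair" where
  "S_power N m = (module_power (fst N) m, {..<m} \<rightarrow>\<^sub>E snd N)"

text \<open>The endomorphisms of \<open>M\<close> factoring through a finite direct sum of copies of \<open>N\<close>.\<close>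

definition S_End_through ::
  "('a, 'm) ring_scheme \<Rightarrow> ('a, 'b) sub_pair \<Rightarrow> ('a, 'c) sub_pair \<Rightarrow> ('b \<Rightarrow> 'b) set" where
  "S_End_through R M N =
     {f \<in> S_hom R M M. \<exists>m. \<exists>g\<in>S_hom R M (S_power N m). \<exists>h\<in>S_hom R (S_power N m) M.
        f = compose (carrier (fst M)) h g}"

section \<open>The object \<open>I\<close>\<close>

context
  fixes R :: "('a, 'm) ring_scheme" and t :: 'a
begin

definition J_rel :: "(nat \<Rightarrow> 'a) set" where
  "J_rel = module_span R (free_module R 3)
     {(t [^]\<^bsub>R\<^esub> (7::nat)) \<odot>\<^bsub>free_module R 3\<^esub> free_basis R 3 0,
      (t [^]\<^bsub>R\<^esub> (4::nat)) \<odot>\<^bsub>free_module R 3\<^esub> free_basis R 3 1,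
      (t [^]\<^bsub>R\<^esub> (2::nat)) \<odot>\<^bsub>free_module R 3\<^esub> free_basis R 3 2}"

definition J0 :: "('a, (nat \<Rightarrow> 'a) set) module" where
  "J0 = quot_module (free_module R 3) J_rel"

definition J_x :: "(nat \<Rightarrow> 'a) set" where
  "J_x = J_rel +>\<^bsub>free_module R 3\<^esub> free_basis R 3 0"

definition J_y :: "(nat \<Rightarrow> 'a) set" where
  "J_y = J_rel +>\<^bsub>free_module R 3\<^esub> free_basis R 3 1"

definition J_z :: "(nat \<Rightarrow> 'a) set" where
  "J_z = J_rel +>\<^bsub>free_module R 3\<^esub> free_basis R 3 2"

definition J1 :: "(nat \<Rightarrow> 'a) set set" where
  "J1 = module_span R J0
     {((t [^]\<^bsub>R\<^esub> (3::nat)) \<odot>\<^bsub>J0\<^esub> J_x) \<ominus>\<^bsub>J0\<^esub> (t \<odot>\<^bsub>J0\<^esub> J_y),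
      (t \<odot>\<^bsub>J0\<^esub> J_y) \<ominus>\<^bsub>J0\<^esub> J_z}"

definition I_obj :: "('a, (nat \<Rightarrow> 'a) set) sub_pair" where
  "I_obj =
     (J0\<lparr>carrier := module_span R J0 {t \<odot>\<^bsub>J0\<^esub> J_x, J_y, J_z}\<rparr>,
      (\<lambda>u. t \<odot>\<^bsub>J0\<^esub> u) ` J1)"

end

end

theory Submission
  imports Defs
begin

text \<open>
  Let \<open>k\<close> be the residue field. The object \<open>I\<close> lies in \<open>J = (J1 \<subseteq> J0)\<close>, where
  \<open>J0 / I0\<close> is one-dimensional over \<open>k\<close>, spanned by \<open>x\<close>, and \<open>J1 / I1 = J1 / t J1\<close> is
  two-dimensional, spanned by \<open>t^3 x - t y\<close> and \<open>t y - z\<close>. Therefore subspaces \<open>U \<subseteq> V\<close> and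
  \<open>W \<subseteq> V \<oplus> V\<close> of \<open>V = k^m\<close> determine an object \<open>M\<close> between \<open>I^m\<close> and \<open>J^m\<close>: the module
  \<open>M0\<close> is generated by \<open>I0^m\<close> and the elements \<open>x u\<close> with \<open>u\<close> in \<open>U\<close>, and \<open>M1\<close> consists of
  the elements \<open>(t^3 x - t y) p + (t y - z) q\<close> with \<open>(p, q)\<close> in \<open>W\<close> modulo \<open>t\<close>. The theorem
  follows from three facts about this construction.

  The first fact is that a morphism between two such objects acts on the coefficients of \<open>t x\<close>,
  of \<open>y\<close> and of \<open>z\<close> by one and the same \<open>k\<close>-linear map \<open>\<phi>\<close>, which maps \<open>U\<close> and \<open>W\<close> into
  their counterparts (\<open>acts_Z\<close>, \<open>acts_U\<close>, \<open>acts_W\<close>). The orders 7, 4 and 2 of \<open>x\<close>, \<open>y\<close> and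
  \<open>z\<close> leave no interaction between the three coefficients modulo \<open>t\<close>, and \<open>M1\<close> contains
  \<open>(t^4 x - t^2 y) v\<close> and \<open>(t^2 y - t z) v\<close> for every \<open>v\<close>; their images lie in \<open>J1^m\<close> only if
  the actions on the three coefficients agree modulo \<open>t\<close>.

  The second fact is that the endomorphisms with \<open>\<phi> = 0\<close> are those that factor through a power of
  \<open>I\<close>. If \<open>\<phi> = 0\<close>, then \<open>M0\<close> is mapped into \<open>I0^m\<close> and \<open>M1\<close> into \<open>I1^m\<close> (\<open>nil_carrier\<close>,
  \<open>nil_sub\<close>), so the endomorphism factors through the inclusion of \<open>I^m\<close> (\<open>vanish_through\<close>).
  Conversely, \<open>I^s\<close> is the object with \<open>U = 0\<close> and \<open>W = 0\<close>, so the map \<open>\<phi>\<close> of a morphism from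
  \<open>M\<close> to \<open>I^s\<close> kills both components of \<open>W\<close>; for the \<open>W\<close> used below these components span \<open>V\<close>
  (\<open>maps_to_I_vanish\<close>, \<open>through_vanish\<close>).

  The third fact is that every finite-dimensional algebra \<open>R\<close> is the algebra of all linear
  endomorphisms of a suitable \<open>V\<close> that preserve a suitable pair \<open>U\<close>, \<open>W\<close> (\<open>rigidity\<close>). Let
  \<open>V = R^N\<close> with \<open>N = dim R + 2\<close>. If \<open>W\<close> is the graph of the shift
  \<open>(v_0, ..., v_(N-2), 0) \<mapsto> (0, v_0, ..., v_(N-2))\<close>, then an endomorphism that preserves \<open>W\<close> is
  a diagonal matrix with one \<open>k\<close>-linear map \<open>\<psi>\<close> of \<open>R\<close> repeated. If \<open>U\<close> consists of
  the vectors \<open>(x g_0, ..., x g_(N-1))\<close>, where the \<open>g_j\<close> span \<open>R\<close> and include \<open>1\<close>, then \<open>\<psi>\<close>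
  commutes with all right multiplications, so it is the left multiplication by \<open>\<psi> 1\<close>. Left
  multiplications preserve \<open>U\<close> and \<open>W\<close>, and since \<open>V\<close> has a basis they lift to matrices over
  the ring (\<open>lift_mult\<close>). Thus \<open>f \<mapsto> \<psi> 1\<close> is a surjective ring homomorphism onto \<open>R\<close> with
  the required kernel.

  Everything is computed in coordinates. A vector is a function from \<open>nat\<close> to the ring of which
  only the entries below the rank \<open>m\<close> matter, and subspaces of \<open>V\<close> appear as sets of such vectors
  that are closed under congruence modulo \<open>t\<close>.
\<close>

section \<open>Congruences modulo powers of the generator of the radical\<close>

text \<open>The consequences of uniseriality and of length at least 7 on which the computations rest:
  annihilators of small powers of \<open>t\<close> are as small as possible, and every non-unit is a multiple
  of \<open>t\<close>.\<close>
locale uniserial7 = cring L for L (structure) +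
  fixes t
  assumes t_closed [simp, intro]: "t \<in> carrier L"
    and annihilator: "\<lbrakk>(i::nat) \<le> 7; u \<in> carrier L; t [^] i \<otimes> u = \<zero>\<rbrakk>
      \<Longrightarrow> \<exists>v\<in>carrier L. u = t [^] (7 - i) \<otimes> v"
    and unitI: "\<lbrakk>u \<in> carrier L; \<nexists>v. v \<in> carrier L \<and> u = t \<otimes> v\<rbrakk> \<Longrightarrow> u \<in> Units L"
begin

abbreviation Z :: "nat \<Rightarrow> 'a" where "Z \<equiv> \<lambda>i. \<zero>"
abbreviation T :: "nat \<Rightarrow> 'a \<Rightarrow> 'a" where "T i a \<equiv> t [^] i \<otimes> a"

text \<open>For \<open>h p q r = x p + y q + z r\<close> this is the element \<open>(t^3 x - t y) p + (t y - z) q\<close>.\<close>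
abbreviation J1_at where
  "J1_at h p q \<equiv> h (\<lambda>i. T 3 (p i)) (\<lambda>i. T 1 (q i \<ominus> p i)) (\<lambda>i. \<ominus> q i)"

definition tcong :: "nat \<Rightarrow> 'a \<Rightarrow> 'a \<Rightarrow> bool" where
  "tcong k a b \<longleftrightarrow> a \<in> carrier L \<and> b \<in> carrier L \<and> (\<exists>e\<in>carrier L. a = b \<oplus> T k e)"

lemma T_T: "a \<in> carrier L \<Longrightarrow> T i (T j a) = T (i + j) a"
  by (simp add: m_assoc[symmetric] nat_pow_mult)

lemma T_split: "j \<le> k \<Longrightarrow> a \<in> carrier L \<Longrightarrow> T k a = T j (T (k - j) a)"
  by (simp add: T_T)

lemma tcong_closed: assumes "tcong k a b" shows "a \<in> carrier L" "b \<in> carrier L"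
  using assms by (auto simp: tcong_def)

lemma tcong_refl [simp, intro]: "a \<in> carrier L \<Longrightarrow> tcong k a a"
  by (auto simp: tcong_def intro!: bexI[of _ \<zero>])

lemma tcong_sym: assumes "tcong k a b" shows "tcong k b a"
proof -
  obtain e where e: "e \<in> carrier L" "a = b \<oplus> T k e" and c: "a \<in> carrier L" "b \<in> carrier L"
    using assms by (auto simp: tcong_def)
  have "b = a \<oplus> T k (\<ominus> e)" using e(1) c(2) unfolding e(2)
    by (simp add: r_minus a_assoc r_neg)
  thus ?thesis using c e(1) unfolding tcong_def by (blast intro: a_inv_closed)
qed

lemma tcong_trans [trans]: assumes "tcong k a b" "tcong k b c" shows "tcong k a c"
proof -
  obtain e f where e: "e \<in> carrier L" "a = b \<oplus> T k e" "f \<in> carrier L" "b = c \<oplus> T k f"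
    and c: "a \<in> carrier L" "b \<in> carrier L" "c \<in> carrier L"
    using assms by (auto simp: tcong_def)
  have "a = c \<oplus> T k (f \<oplus> e)" using e(1,3) c unfolding e(2) e(4)
    by (simp add: r_distr a_assoc)
  thus ?thesis using c e(1,3) unfolding tcong_def by (blast intro: a_closed)
qed

lemma tcong_add: assumes "tcong k a b" "tcong k c d" shows "tcong k (a \<oplus> c) (b \<oplus> d)"
proof -
  obtain e f where e: "e \<in> carrier L" "a = b \<oplus> T k e" "f \<in> carrier L" "c = d \<oplus> T k f"
    and c: "a \<in> carrier L" "b \<in> carrier L" "c \<in> carrier L" "d \<in> carrier L"
    using assms by (auto simp: tcong_def)
  have "a \<oplus> c = (b \<oplus> d) \<oplus> T k (e \<oplus> f)" using e(1,3) c unfolding e(2) e(4)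
    by (simp add: r_distr a_ac)
  thus ?thesis using c e(1,3) unfolding tcong_def by (blast intro: a_closed)
qed

lemma tcong_mult: assumes "tcong k a b" "c \<in> carrier L" shows "tcong k (c \<otimes> a) (c \<otimes> b)"
proof -
  obtain e where e: "e \<in> carrier L" "a = b \<oplus> T k e" and c: "a \<in> carrier L" "b \<in> carrier L"
    using assms by (auto simp: tcong_def)
  have "c \<otimes> a = c \<otimes> b \<oplus> T k (c \<otimes> e)" using e(1) c assms(2) unfolding e(2)
    by (simp add: r_distr m_lcomm)
  thus ?thesis using c e(1) assms(2) unfolding tcong_def by (blast intro: m_closed)
qed

lemma tcong_minus: assumes "tcong k a b" shows "tcong k (\<ominus> a) (\<ominus> b)"
proof -
  have "tcong k ((\<ominus> \<one>) \<otimes> a) ((\<ominus> \<one>) \<otimes> b)" by (rule tcong_mult[OF assms]) simp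
  thus ?thesis using tcong_closed[OF assms] by (simp add: l_minus)
qed

lemma tcong_diff: "tcong k a b \<Longrightarrow> tcong k c d \<Longrightarrow> tcong k (a \<ominus> c) (b \<ominus> d)"
  unfolding a_minus_def by (intro tcong_add tcong_minus)

lemma tcong_mono: assumes "tcong k a b" "j \<le> k" shows "tcong j a b"
proof -
  obtain e where e: "e \<in> carrier L" "a = b \<oplus> T k e" and c: "a \<in> carrier L" "b \<in> carrier L"
    using assms by (auto simp: tcong_def)
  have "T k e = T j (T (k - j) e)" by (rule T_split[OF assms(2) e(1)])
  thus ?thesis using c e unfolding tcong_def
    by (intro conjI bexI[of _ "T (k - j) e"]) auto
qed

lemma tcong_T_zero: assumes "j \<le> k" "a \<in> carrier L" shows "tcong j (T k a) \<zero>"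
proof -
  have "tcong k (T k a) \<zero>" using assms(2) unfolding tcong_def by (auto intro!: bexI[of _ a])
  thus ?thesis by (rule tcong_mono[OF _ assms(1)])
qed

lemma tcong_zeroE:
  assumes "tcong k a \<zero>" obtains e where "e \<in> carrier L" "a = T k e"
  using assms unfolding tcong_def by auto

text \<open>Cancellation holds as in a principal ideal domain as long as the modulus has exponent at most 7:
  the defect \<open>u\<close> of the quotient congruence is killed by \<open>t^i\<close>, hence divisible by
  \<open>t^(7-i)\<close>, which is at least the remaining exponent \<open>k - i\<close>.\<close>
lemma tcong_cancel:
  assumes "tcong k (T i a) (T i b)" "i \<le> k" "k \<le> 7" "a \<in> carrier L" "b \<in> carrier L"
  shows "tcong (k - i) a b"
proof -
  obtain e where e: "e \<in> carrier L" "T i a = T i b \<oplus> T k e"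
    using assms by (auto simp: tcong_def)
  have k: "T k e = T i (T (k - i) e)" by (rule T_split[OF assms(2) e(1)])
  let ?u = "a \<ominus> (b \<oplus> T (k - i) e)"
  have uc: "?u \<in> carrier L" using assms(4,5) e(1) by simp
  have "T i ?u = T i a \<ominus> (T i b \<oplus> T k e)"
    using assms(4,5) e(1) unfolding k by (simp add: a_minus_def r_distr r_minus)
  also have "\<dots> = \<zero>" unfolding e(2) using assms(5) e(1) by (simp add: a_minus_def r_neg)
  finally obtain v where v: "v \<in> carrier L" "?u = T (7 - i) v"
    using annihilator[of i ?u] uc assms(2,3) by auto
  have "tcong (k - i) ?u \<zero>" unfolding v(2) by (rule tcong_T_zero) (use assms v in auto)
  hence "tcong (k - i) (?u \<oplus> (b \<oplus> T (k - i) e)) (\<zero> \<oplus> (b \<oplus> T (k - i) e))"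
    by (rule tcong_add) (use assms e in auto)
  moreover have "?u \<oplus> (b \<oplus> T (k - i) e) = a"
    using assms(4,5) e(1) by (simp add: a_minus_def a_assoc l_neg)
  moreover have "tcong (k - i) (b \<oplus> T (k - i) e) (b \<oplus> \<zero>)"
    by (intro tcong_add tcong_T_zero tcong_refl) (use assms e in auto)
  ultimately show ?thesis using assms(5) e(1) tcong_trans by auto
qed

abbreviation F :: "(nat \<Rightarrow> 'a) set" where "F \<equiv> UNIV \<rightarrow> carrier L"

definition vcong :: "nat \<Rightarrow> nat \<Rightarrow> (nat \<Rightarrow> 'a) \<Rightarrow> (nat \<Rightarrow> 'a) \<Rightarrow> bool" where
  "vcong m k p q \<longleftrightarrow> (\<forall>i<m. tcong k (p i) (q i))"

lemma vcong_refl [simp, intro]: "p \<in> F \<Longrightarrow> vcong m k p p" by (auto simp: vcong_def)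
lemma vcong_sym: "vcong m k p q \<Longrightarrow> vcong m k q p" by (auto simp: vcong_def intro: tcong_sym)
lemma vcong_trans [trans]: "vcong m k p q \<Longrightarrow> vcong m k q r \<Longrightarrow> vcong m k p r" by (auto simp: vcong_def intro: tcong_trans)
lemma vcong_mono: "vcong m k p q \<Longrightarrow> j \<le> k \<Longrightarrow> vcong m j p q" by (auto simp: vcong_def intro: tcong_mono)
lemma vcong_add: "vcong m k p q \<Longrightarrow> vcong m k p' q' \<Longrightarrow> vcong m k (\<lambda>i. p i \<oplus> p' i) (\<lambda>i. q i \<oplus> q' i)"
  by (auto simp: vcong_def intro: tcong_add)
lemma vcong_diff: "vcong m k p q \<Longrightarrow> vcong m k p' q' \<Longrightarrow> vcong m k (\<lambda>i. p i \<ominus> p' i) (\<lambda>i. q i \<ominus> q' i)"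
  by (auto simp: vcong_def intro: tcong_diff)
lemma vcong_mult: "vcong m k p q \<Longrightarrow> c \<in> carrier L \<Longrightarrow> vcong m k (\<lambda>i. c \<otimes> p i) (\<lambda>i. c \<otimes> q i)"
  by (auto simp: vcong_def intro: tcong_mult)

lemma vcong_zeroE:
  assumes "vcong m k p Z" "p \<in> F"
  obtains e where "e \<in> F" "\<And>i. i < m \<Longrightarrow> p i = T k (e i)"
proof -
  have "\<forall>i. \<exists>e. e \<in> carrier L \<and> (i < m \<longrightarrow> p i = T k e)"
    using assms tcong_zeroE unfolding vcong_def by (metis zero_closed)
  then obtain e where "\<forall>i. e i \<in> carrier L \<and> (i < m \<longrightarrow> p i = T k (e i))" by metis
  thus ?thesis using that[of e] by auto
qed

end

text \<open>In a uniserial ring the last proper term of a composition series is the unique maximal ideal, so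
  non-units lie in it. Each element is then a unit times a power of \<open>t\<close>, or divisible by a high
  power. If \<open>t^6\<close> were zero, the only ideals would be the seven generated by
  \<open>t^0, ..., t^6\<close>, too few for a chain of eight.\<close>
lemma (in cring) uniserial7_of_length:
  assumes uni: "uniserial_ring R" and loc: "local_ring R"
    and len: "ring_has_length R n" and n: "n \<ge> 7"
    and t: "t \<in> carrier R" and rad: "ring_rad R = PIdl t"
  shows "uniserial7 R t"
proof -
  obtain C :: "nat \<Rightarrow> 'a set" where C0: "C 0 = {\<zero>}" and Cn: "C n = carrier R"
    and Ci: "\<And>i. i \<le> n \<Longrightarrow> ideal (C i) R"
    and Cs: "\<And>i. i < n \<Longrightarrow> C i \<subset> C (Suc i)"
    and Cmax: "\<And>i P. i < n \<Longrightarrow> ideal P R \<Longrightarrow> C i \<subset> P \<Longrightarrow> P \<subset> C (Suc i) \<Longrightarrow> False"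
    using len unfolding ring_has_length_def by metis
  let ?P = "C (n - 1)"
  have Pid: "ideal ?P R" using Ci by auto
  have Pprop: "?P \<subset> carrier R" using Cs[of "n - 1"] n Cn by auto
  have Pm: "maximalideal ?P R"
  proof (rule maximalidealI[OF Pid])
    show "carrier R \<noteq> ?P" using Pprop by blast
    fix J assume J: "ideal J R" "?P \<subseteq> J" "J \<subseteq> carrier R"
    show "J = ?P \<or> J = carrier R"
      using Cmax[of "n - 1" J] J n Cn by (auto simp: psubset_eq)
  qed
  have "ring_rad R = ?P"
    using loc Pm Pprop unfolding ring_rad_def local_ring_def by blast
  hence PT: "?P = {r \<otimes> t | r. r \<in> carrier R}"
    using rad by (auto simp: cgenideal_def)
  have unit: "u \<in> Units R" if u: "u \<in> carrier R" and nt: "\<nexists>v. v \<in> carrier R \<and> u = t \<otimes> v" for u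
  proof (rule ccontr)
    assume nu: "u \<notin> Units R"
    have I: "ideal (PIdl u) R" by (rule cgenideal_ideal[OF u])
    have uI: "u \<in> PIdl u" by (rule cgenideal_self[OF u])
    have "u \<notin> ?P" using nt t m_comm unfolding PT by auto
    hence "?P \<subseteq> PIdl u" using uni I Pid uI unfolding uniserial_ring_def by blast
    hence "PIdl u = carrier R"
      using maximalideal.I_maximal[OF Pm I] \<open>u \<notin> ?P\<close> uI ideal.Icarr[OF I] by blast
    hence "\<one> \<in> PIdl u" by simp
    then obtain r where "r \<in> carrier R" "\<one> = r \<otimes> u" by (auto simp: cgenideal_def)
    hence "u \<in> Units R" using u m_comm unfolding Units_def by auto
    thus False using nu by simp
  qed
  have shape: "u = \<zero> \<or> (\<exists>j\<le>k. \<exists>v\<in>Units R. u = t [^] j \<otimes> v) \<or> (\<exists>v\<in>carrier R. u = t [^] Suc k \<otimes> v)"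
    if u: "u \<in> carrier R" for u and k :: nat
  proof (induction k)
    case 0
    show ?case
    proof (cases "u \<in> Units R")
      case True
      thus ?thesis using u by (intro disjI2 disjI1 exI[of _ 0] conjI bexI[of _ u]) auto
    qed (use unit[OF u] u t in auto)
  next
    case (Suc k)
    { fix v assume v: "v \<in> carrier R" "u = t [^] Suc k \<otimes> v"
      have "v \<in> Units R \<or> (\<exists>w\<in>carrier R. v = t \<otimes> w)" using unit[OF v(1)] by blast
      moreover { fix w assume w: "w \<in> carrier R" "v = t \<otimes> w"
        have "u = t [^] Suc (Suc k) \<otimes> w" using v(2) w t by (simp add: m_assoc)
        hence "\<exists>w\<in>carrier R. u = t [^] Suc (Suc k) \<otimes> w" using w by blast }
      ultimately have ?case using v by blast }
    thus ?case using Suc by (meson le_SucI)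
  qed
  have t6: "t [^] (6::nat) \<noteq> \<zero>"
  proof
    assume z: "t [^] (6::nat) = \<zero>"
    have idl: "\<exists>j\<le>6. I = PIdl (t [^] (j::nat))" if I: "ideal I R" for I
    proof -
      define j where "j = (LEAST j::nat. t [^] j \<in> I)"
      have "t [^] (6::nat) \<in> I" using z I ideal.Icarr additive_subgroup.zero_closed ideal.axioms(1) by fastforce
      hence j: "t [^] j \<in> I" "j \<le> 6" unfolding j_def by (auto intro: LeastI Least_le)
      have tc: "t [^] j \<in> carrier R" using t by simp
      have "u \<in> PIdl (t [^] j)" if u: "u \<in> I" for u
      proof -
        have uc: "u \<in> carrier R" using ideal.Icarr[OF I u] .
        consider "u = \<zero>" | k v where "k \<le> 6" "v \<in> Units R" "u = t [^] (k::nat) \<otimes> v"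
          | v where "v \<in> carrier R" "u = t [^] Suc 6 \<otimes> v"
          using shape[OF uc, of 6] by blast
        thus ?thesis
        proof cases
          case 1 thus ?thesis using cgenideal_ideal[OF tc] additive_subgroup.zero_closed ideal.axioms(1) by blast
        next
          case 3
          have "t [^] Suc 6 = t [^] (6::nat) \<otimes> t" by (rule nat_pow_Suc)
          hence "t [^] Suc 6 = \<zero>" using z t by simp
          hence "u = \<zero>" using 3 by simp
          thus ?thesis using cgenideal_ideal[OF tc] additive_subgroup.zero_closed ideal.axioms(1) by blast
        next
          case 2
          have vi: "inv v \<in> carrier R" "v \<in> carrier R" using 2 by auto
          have "u \<otimes> inv v = t [^] k" using 2 t vi by (simp add: m_assoc)
          hence "t [^] k \<in> I" using ideal.I_r_closed[OF I u vi(1)] by simp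
          hence "j \<le> k" unfolding j_def by (rule Least_le)
          hence "t [^] k = t [^] (k - j) \<otimes> t [^] j" using t by (simp add: nat_pow_mult)
          hence "u = (t [^] (k - j) \<otimes> v) \<otimes> t [^] j" using 2 t vi by (simp add: m_ac)
          thus ?thesis using t vi unfolding cgenideal_def by auto
        qed
      qed
      moreover have "PIdl (t [^] j) \<subseteq> I" by (rule cgenideal_minimal[OF I j(1)])
      ultimately show ?thesis using j(2) by blast
    qed
    have mono: "i < j \<Longrightarrow> j \<le> n \<Longrightarrow> C i \<subset> C j" for i j
    proof (induction j)
      case (Suc j)
      thus ?case using Cs[of j] by (cases "i = j") auto
    qed simp
    have inj: "inj_on C {..7}"
    proof (rule inj_onI)
      fix i j :: nat assume ij: "i \<in> {..7}" "j \<in> {..7}" "C i = C j"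
      show "i = j"
        using mono[of i j] mono[of j i] ij n by (cases i j rule: linorder_cases) auto
    qed
    have "C ` {..7} \<subseteq> (\<lambda>j::nat. PIdl (t [^] j)) ` {..6}"
    proof
      fix I assume "I \<in> C ` {..7}"
      then obtain i where "i \<le> 7" "I = C i" by auto
      thus "I \<in> (\<lambda>j::nat. PIdl (t [^] j)) ` {..6}" using idl[OF Ci[of i]] n by auto
    qed
    hence "card (C ` {..7}) \<le> card ((\<lambda>j::nat. PIdl (t [^] j)) ` {..6})"
      by (intro card_mono) auto
    also have "\<dots> \<le> 7" using card_image_le[of "{..6::nat}" "\<lambda>j::nat. PIdl (t [^] j)"] by simp
    finally show False using card_image[OF inj] by simp
  qed
  show ?thesis
  proof (unfold_locales, rule t)
    fix i :: nat and u assume i: "i \<le> 7" and u: "u \<in> carrier R" and z: "t [^] i \<otimes> u = \<zero>"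
    show "\<exists>v\<in>carrier R. u = t [^] (7 - i) \<otimes> v"
    proof (cases "i = 7")
      case True thus ?thesis using u by auto
    next
      case False
      hence S: "Suc (6 - i) = 7 - i" using i by simp
      consider "u = \<zero>" | k v where "k \<le> 6 - i" "v \<in> Units R" "u = t [^] (k::nat) \<otimes> v"
          | v where "v \<in> carrier R" "u = t [^] (7 - i) \<otimes> v"
        using shape[OF u, of "6 - i"] unfolding S by blast
      thus ?thesis
      proof cases
        case 1 thus ?thesis using t by (intro bexI[of _ \<zero>]) auto
      next
        case 3 thus ?thesis by blast
      next
        case 2
        have vi: "inv v \<in> carrier R" "v \<in> carrier R" using 2 by auto
        have "t [^] (6::nat) = t [^] (6 - (i + k)) \<otimes> t [^] (i + k)"
          using 2 i False t by (simp add: nat_pow_mult)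
        also have "t [^] (i + k) = t [^] i \<otimes> u \<otimes> inv v"
          using 2 t vi by (simp add: m_assoc nat_pow_mult[symmetric])
        also have "\<dots> = \<zero>" using z vi by simp
        finally show ?thesis using t6 t by simp
      qed
    qed
  qed (use unit in auto)
qed

section \<open>Objects given by a pair of subspaces\<close>

text \<open>The preimages, among coordinate vectors of rank \<open>m\<close>, of subspaces of \<open>k^m\<close> and of
  \<open>k^m \<oplus> k^m\<close>; the closure under congruence modulo \<open>t\<close> says that they contain the kernel of
  the reduction.\<close>
locale subspace_pair = uniserial7 L t for L :: "('a, 'r) ring_scheme" (structure) and t +
  fixes m :: nat and U :: "(nat \<Rightarrow> 'a) set" and W :: "((nat \<Rightarrow> 'a) \<times> (nat \<Rightarrow> 'a)) set"
  assumes U_sub: "U \<subseteq> F"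
    and U_add: "\<lbrakk>p \<in> U; q \<in> U\<rbrakk> \<Longrightarrow> (\<lambda>i. p i \<oplus> q i) \<in> U"
    and U_smult: "\<lbrakk>p \<in> U; c \<in> carrier L\<rbrakk> \<Longrightarrow> (\<lambda>i. c \<otimes> p i) \<in> U"
    and U_zero: "Z \<in> U"
    and U_cong: "\<lbrakk>p \<in> U; p' \<in> F; vcong m 1 p' p\<rbrakk> \<Longrightarrow> p' \<in> U"
    and W_sub: "W \<subseteq> F \<times> F"
    and W_add: "\<lbrakk>(p, q) \<in> W; (p', q') \<in> W\<rbrakk> \<Longrightarrow> (\<lambda>i. p i \<oplus> p' i, \<lambda>i. q i \<oplus> q' i) \<in> W"
    and W_smult: "\<lbrakk>(p, q) \<in> W; c \<in> carrier L\<rbrakk> \<Longrightarrow> (\<lambda>i. c \<otimes> p i, \<lambda>i. c \<otimes> q i) \<in> W"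
    and W_zero: "(\<lambda>i. \<zero>, \<lambda>i. \<zero>) \<in> W"
    and W_cong: "\<lbrakk>(p, q) \<in> W; p' \<in> F; q' \<in> F; vcong m 1 p' p; vcong m 1 q' q\<rbrakk> \<Longrightarrow> (p', q') \<in> W"
begin

lemma U_F: "p \<in> U \<Longrightarrow> p \<in> F" using U_sub by blast
lemma W_F: "(p, q) \<in> W \<Longrightarrow> p \<in> F" "(p, q) \<in> W \<Longrightarrow> q \<in> F" using W_sub by auto

lemma U_T: "p \<in> F \<Longrightarrow> k \<ge> 1 \<Longrightarrow> (\<lambda>i. T k (p i)) \<in> U"
  by (rule U_cong[OF U_zero]) (auto simp: vcong_def intro!: tcong_T_zero)

end

text \<open>The object between \<open>I^m\<close> and \<open>J^m\<close> that belongs to \<open>U\<close> and \<open>W\<close>, up to the concrete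
  encoding of its elements: \<open>\<kappa> p q r\<close> stands for \<open>x p + y q + z r\<close>, the sum of the vectors
  \<open>p\<close>, \<open>q\<close>, \<open>r\<close> times the three families of generators. Only the law \<open>\<kappa>_eq\<close> knows the
  orders of the generators. Objects with carriers of different types are compared through this
  interface.\<close>
locale framed = subspace_pair L t m U W
  for L :: "('a, 'r) ring_scheme" (structure) and t and M :: "('a, 'j) sub_pair"
    and \<kappa> :: "(nat \<Rightarrow> 'a) \<Rightarrow> (nat \<Rightarrow> 'a) \<Rightarrow> (nat \<Rightarrow> 'a) \<Rightarrow> 'j" and m U W +
  assumes carrier_eq: "carrier (fst M) = {\<kappa> p q r | p q r. p \<in> U \<and> q \<in> F \<and> r \<in> F}"
    and sub_eq: "snd M = {J1_at \<kappa> p q | p q. (p, q) \<in> W}"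
    and \<kappa>_add: "\<lbrakk>p \<in> F; q \<in> F; r \<in> F; p' \<in> F; q' \<in> F; r' \<in> F\<rbrakk> \<Longrightarrow>
        \<kappa> p q r \<oplus>\<^bsub>fst M\<^esub> \<kappa> p' q' r' = \<kappa> (\<lambda>i. p i \<oplus> p' i) (\<lambda>i. q i \<oplus> q' i) (\<lambda>i. r i \<oplus> r' i)"
    and \<kappa>_smult: "\<lbrakk>p \<in> F; q \<in> F; r \<in> F; c \<in> carrier L\<rbrakk> \<Longrightarrow>
        c \<odot>\<^bsub>fst M\<^esub> \<kappa> p q r = \<kappa> (\<lambda>i. c \<otimes> p i) (\<lambda>i. c \<otimes> q i) (\<lambda>i. c \<otimes> r i)"
    and \<kappa>_zero: "\<zero>\<^bsub>fst M\<^esub> = \<kappa> Z Z Z"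
    and \<kappa>_eq: "\<lbrakk>p \<in> F; q \<in> F; r \<in> F; p' \<in> F; q' \<in> F; r' \<in> F\<rbrakk> \<Longrightarrow>
        \<kappa> p q r = \<kappa> p' q' r' \<longleftrightarrow> vcong m 7 p p' \<and> vcong m 4 q q' \<and> vcong m 2 r r'"
begin

lemma carrierI: "p \<in> U \<Longrightarrow> q \<in> F \<Longrightarrow> r \<in> F \<Longrightarrow> \<kappa> p q r \<in> carrier (fst M)"
  unfolding carrier_eq by blast

lemma carrierE:
  assumes "u \<in> carrier (fst M)" obtains p q r where "p \<in> U" "p \<in> F" "q \<in> F" "r \<in> F" "u = \<kappa> p q r"
  using assms U_F unfolding carrier_eq by blast

lemma subI: "(p, q) \<in> W \<Longrightarrow> J1_at \<kappa> p q \<in> snd M"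
  unfolding sub_eq by blast

lemma subE:
  assumes "u \<in> snd M"
  obtains p q where "(p, q) \<in> W" "p \<in> F" "q \<in> F" "u = J1_at \<kappa> p q"
  using assms W_F unfolding sub_eq by blast

lemma sub_carrier: "snd M \<subseteq> carrier (fst M)"
proof
  fix u assume "u \<in> snd M"
  then obtain p q where "p \<in> F" "q \<in> F" "u = J1_at \<kappa> p q"
    by (rule subE)
  thus "u \<in> carrier (fst M)" by (auto intro!: carrierI U_T)
qed

lemma \<kappa>_split: "p \<in> F \<Longrightarrow> q \<in> F \<Longrightarrow> r \<in> F \<Longrightarrow>
  \<kappa> p q r = \<kappa> p Z Z \<oplus>\<^bsub>fst M\<^esub> (\<kappa> Z q Z \<oplus>\<^bsub>fst M\<^esub> \<kappa> Z Z r)"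
  by (subst \<kappa>_add, auto)+ (auto simp: \<kappa>_eq Pi_def)

lemma is_module: "module L (fst M)"
proof (intro moduleI abelian_groupI is_cring)
  have cl: "(\<lambda>i. p i \<oplus> q i) \<in> F" "(\<lambda>i. c \<otimes> q i) \<in> F" if "p \<in> F" "q \<in> F" "c \<in> carrier L" for p q c
    using that by auto
  note [simp] = cl
  fix x y assume x: "x \<in> carrier (fst M)" and y: "y \<in> carrier (fst M)"
  show "x \<oplus>\<^bsub>fst M\<^esub> y \<in> carrier (fst M)"
    using x y by (elim carrierE) (auto simp: \<kappa>_add intro!: carrierI U_add)
  show "x \<oplus>\<^bsub>fst M\<^esub> y = y \<oplus>\<^bsub>fst M\<^esub> x"
    using x y by (elim carrierE) (auto simp: \<kappa>_add \<kappa>_eq vcong_def Pi_def a_comm)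
  { fix z assume z: "z \<in> carrier (fst M)"
    show "x \<oplus>\<^bsub>fst M\<^esub> y \<oplus>\<^bsub>fst M\<^esub> z = x \<oplus>\<^bsub>fst M\<^esub> (y \<oplus>\<^bsub>fst M\<^esub> z)"
      using x y z by (elim carrierE) (auto simp: \<kappa>_add \<kappa>_eq vcong_def Pi_def a_assoc) }
  fix a b assume a: "a \<in> carrier L" and b: "b \<in> carrier L"
  show "a \<odot>\<^bsub>fst M\<^esub> x \<in> carrier (fst M)"
    using x a by (elim carrierE) (auto simp: \<kappa>_smult intro!: carrierI U_smult)
  show "(a \<oplus> b) \<odot>\<^bsub>fst M\<^esub> x = a \<odot>\<^bsub>fst M\<^esub> x \<oplus>\<^bsub>fst M\<^esub> b \<odot>\<^bsub>fst M\<^esub> x"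
    using x a b by (elim carrierE) (auto simp: \<kappa>_add \<kappa>_smult \<kappa>_eq vcong_def Pi_def l_distr)
  show "a \<odot>\<^bsub>fst M\<^esub> (x \<oplus>\<^bsub>fst M\<^esub> y) = a \<odot>\<^bsub>fst M\<^esub> x \<oplus>\<^bsub>fst M\<^esub> a \<odot>\<^bsub>fst M\<^esub> y"
    using x y a by (elim carrierE) (auto simp: \<kappa>_add \<kappa>_smult \<kappa>_eq vcong_def Pi_def r_distr)
  show "a \<otimes> b \<odot>\<^bsub>fst M\<^esub> x = a \<odot>\<^bsub>fst M\<^esub> (b \<odot>\<^bsub>fst M\<^esub> x)"
    using x a b by (elim carrierE) (auto simp: \<kappa>_add \<kappa>_smult \<kappa>_eq vcong_def Pi_def m_assoc)
next
  show "\<zero>\<^bsub>fst M\<^esub> \<in> carrier (fst M)" unfolding \<kappa>_zero by (auto intro: carrierI U_zero)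
next
  fix x assume x: "x \<in> carrier (fst M)"
  show "\<zero>\<^bsub>fst M\<^esub> \<oplus>\<^bsub>fst M\<^esub> x = x"
    using x by (elim carrierE) (auto simp: \<kappa>_zero \<kappa>_add \<kappa>_eq vcong_def Pi_def)
  show "\<one> \<odot>\<^bsub>fst M\<^esub> x = x"
    using x by (elim carrierE) (auto simp: \<kappa>_smult \<kappa>_eq vcong_def Pi_def)
  show "\<exists>y\<in>carrier (fst M). y \<oplus>\<^bsub>fst M\<^esub> x = \<zero>\<^bsub>fst M\<^esub>"
  proof -
    obtain p q r where p: "p \<in> U" "p \<in> F" "q \<in> F" "r \<in> F" "x = \<kappa> p q r" by (rule carrierE[OF x])
    have "(\<lambda>i. (\<ominus> \<one>) \<otimes> p i) \<in> U" using p U_smult by simp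
    hence c: "\<kappa> (\<lambda>i. (\<ominus> \<one>) \<otimes> p i) (\<lambda>i. (\<ominus> \<one>) \<otimes> q i) (\<lambda>i. (\<ominus> \<one>) \<otimes> r i) \<in> carrier (fst M)"
      using p by (intro carrierI) auto
    show ?thesis
      by (rule bexI[OF _ c])
        (use p in \<open>auto simp: \<kappa>_add \<kappa>_zero \<kappa>_eq vcong_def Pi_def l_minus l_neg\<close>)
  qed
qed

lemma is_submodule: "submodule (snd M) L (fst M)"
proof -
  interpret mod: module L "fst M" by (rule is_module)
  have neg: "\<ominus>\<^bsub>fst M\<^esub> x = (\<ominus> \<one>) \<odot>\<^bsub>fst M\<^esub> x" if "x \<in> carrier (fst M)" for x
    using that by (simp add: mod.smult_l_minus)
  have sm: "a \<odot>\<^bsub>fst M\<^esub> x \<in> snd M" if a: "a \<in> carrier L" and x: "x \<in> snd M" for a x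
  proof -
    obtain p q where pq: "(p, q) \<in> W" "p \<in> F" "q \<in> F"
      and xe: "x = J1_at \<kappa> p q" by (rule subE[OF x])
    have "a \<odot>\<^bsub>fst M\<^esub> x = \<kappa> (\<lambda>i. T 3 (a \<otimes> p i)) (\<lambda>i. T 1 (a \<otimes> q i \<ominus> a \<otimes> p i)) (\<lambda>i. \<ominus> (a \<otimes> q i))"
      unfolding xe using pq a
      by (subst \<kappa>_smult) (auto simp: \<kappa>_eq vcong_def Pi_def r_minus r_distr a_minus_def m_lcomm)
    thus ?thesis using subI[OF W_smult[OF pq(1) a]] by simp
  qed
  show ?thesis
  proof (rule mod.submoduleI[OF sub_carrier])
    show "\<zero>\<^bsub>fst M\<^esub> \<in> snd M"
      using subI[OF W_zero] by (simp add: \<kappa>_zero a_minus_def)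
    show "\<ominus>\<^bsub>fst M\<^esub> x \<in> snd M" if "x \<in> snd M" for x
      using that sub_carrier by (subst neg) (auto intro: sm)
    show "x \<oplus>\<^bsub>fst M\<^esub> y \<in> snd M" if x: "x \<in> snd M" and y: "y \<in> snd M" for x y
    proof -
      obtain p q where pq: "(p, q) \<in> W" "p \<in> F" "q \<in> F"
        and xe: "x = J1_at \<kappa> p q" by (rule subE[OF x])
      obtain p' q' where pq': "(p', q') \<in> W" "p' \<in> F" "q' \<in> F"
        and ye: "y = J1_at \<kappa> p' q'" by (rule subE[OF y])
      have e: "T 3 (p i) \<oplus> T 3 (p' i) = T 3 (p i \<oplus> p' i)"
        "T 1 (q i \<ominus> p i) \<oplus> T 1 (q' i \<ominus> p' i) = T 1 (q i \<oplus> q' i \<ominus> (p i \<oplus> p' i))"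
        "\<ominus> q i \<oplus> \<ominus> q' i = \<ominus> (q i \<oplus> q' i)" for i
      proof -
        have c: "p i \<in> carrier L" "q i \<in> carrier L" "p' i \<in> carrier L" "q' i \<in> carrier L"
          using pq pq' by auto
        have d: "(q i \<ominus> p i) \<oplus> (q' i \<ominus> p' i) = q i \<oplus> q' i \<ominus> (p i \<oplus> p' i)"
          using c by (simp add: a_minus_def minus_add a_ac)
        show "T 3 (p i) \<oplus> T 3 (p' i) = T 3 (p i \<oplus> p' i)"
          "\<ominus> q i \<oplus> \<ominus> q' i = \<ominus> (q i \<oplus> q' i)" using c by (simp_all add: r_distr minus_add)
        show "T 1 (q i \<ominus> p i) \<oplus> T 1 (q' i \<ominus> p' i) = T 1 (q i \<oplus> q' i \<ominus> (p i \<oplus> p' i))"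
          unfolding d[symmetric] using c by (simp add: r_distr)
      qed
      have "x \<oplus>\<^bsub>fst M\<^esub> y = \<kappa> (\<lambda>i. T 3 (p i \<oplus> p' i)) (\<lambda>i. T 1 (q i \<oplus> q' i \<ominus> (p i \<oplus> p' i))) (\<lambda>i. \<ominus> (q i \<oplus> q' i))"
        unfolding xe ye e[symmetric] using pq pq' by (intro \<kappa>_add) (auto simp: Pi_def)
      thus ?thesis using subI[OF W_add[OF pq(1) pq'(1)]] by simp
    qed
  qed (rule sm)
qed

end

text \<open>The relation \<open>acts \<kappa> \<kappa>' f p a\<close> says that \<open>a\<close> lifts \<open>\<phi> p\<close>, where \<open>\<phi>\<close> is the map
  induced by \<open>f\<close> modulo \<open>t\<close>. It is read off at \<open>t x p\<close> and not at \<open>x p\<close>, because the latter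
  lies in the object only for \<open>p\<close> in \<open>U\<close>. A relation is used since \<open>a\<close> is determined only
  modulo \<open>t\<close>.\<close>
definition (in uniserial7) acts where
  "acts \<kappa> \<kappa>' f p a \<longleftrightarrow> p \<in> F \<and> a \<in> F \<and> (\<exists>b\<in>F. \<exists>c\<in>F.
     f (\<kappa> (\<lambda>i. T 1 (p i)) Z Z) = \<kappa>' (\<lambda>i. T 1 (a i)) b c)"

locale framed_hom = uniserial7 L t + src: framed L t M \<kappa> m U W + tgt: framed L t M' \<kappa>' m' U' W'
  for L :: "('a, 'r) ring_scheme" (structure) and t and M :: "('a, 'j) sub_pair" and \<kappa> m U W
    and M' :: "('a, 'k) sub_pair" and \<kappa>' m' U' W' +
  fixes f
  assumes f: "f \<in> S_hom L M M'"
begin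

abbreviation "A \<equiv> acts \<kappa> \<kappa>' f"

lemma hom_closed: "x \<in> carrier (fst M) \<Longrightarrow> f x \<in> carrier (fst M')"
  and hom_add: "\<lbrakk>x \<in> carrier (fst M); y \<in> carrier (fst M)\<rbrakk> \<Longrightarrow> f (x \<oplus>\<^bsub>fst M\<^esub> y) = f x \<oplus>\<^bsub>fst M'\<^esub> f y"
  and hom_smult: "\<lbrakk>a \<in> carrier L; x \<in> carrier (fst M)\<rbrakk> \<Longrightarrow> f (a \<odot>\<^bsub>fst M\<^esub> x) = a \<odot>\<^bsub>fst M'\<^esub> f x"
  and hom_sub: "x \<in> snd M \<Longrightarrow> f x \<in> snd M'"
  using f unfolding S_hom_def by auto

text \<open>An element killed by \<open>t^k\<close> has an image killed by \<open>t^k\<close>, whose coordinates are therefore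
  divisible by the complementary powers. Truncated subtraction gives exponent 0, hence no
  condition, when \<open>k\<close> exceeds the order of a generator.\<close>
lemma torsion:
  assumes p: "p \<in> U" "q \<in> F" "r \<in> F" "k \<le> 7"
    and z: "\<kappa> (\<lambda>i. T k (p i)) (\<lambda>i. T k (q i)) (\<lambda>i. T k (r i)) = \<kappa> Z Z Z"
  obtains u b c where "u \<in> F" "b \<in> F" "c \<in> F" "(\<lambda>i. T (7 - k) (u i)) \<in> U'"
    "f (\<kappa> p q r) = \<kappa>' (\<lambda>i. T (7 - k) (u i)) (\<lambda>i. T (4 - k) (b i)) (\<lambda>i. T (2 - k) (c i))"
proof -
  have c: "\<kappa> p q r \<in> carrier (fst M)" using p by (intro src.carrierI)
  obtain u b c where u: "u \<in> U'" "u \<in> F" "b \<in> F" "c \<in> F" "f (\<kappa> p q r) = \<kappa>' u b c"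
    using tgt.carrierE[OF hom_closed[OF c]] by metis
  have "\<kappa>' (\<lambda>i. T k (u i)) (\<lambda>i. T k (b i)) (\<lambda>i. T k (c i)) = (t [^] k) \<odot>\<^bsub>fst M'\<^esub> f (\<kappa> p q r)"
    unfolding u(5) using u by (subst tgt.\<kappa>_smult) auto
  also have "\<dots> = f (\<kappa> Z Z Z)"
    using c p src.U_F[OF p(1)] by (subst hom_smult[symmetric]) (auto simp: src.\<kappa>_smult z)
  also have "\<kappa> Z Z Z = \<zero> \<odot>\<^bsub>fst M\<^esub> \<kappa> Z Z Z" by (subst src.\<kappa>_smult) auto
  also have "f \<dots> = \<zero> \<odot>\<^bsub>fst M'\<^esub> f (\<kappa> Z Z Z)" by (rule hom_smult) (auto intro: src.carrierI src.U_zero)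
  also have "\<dots> = \<kappa>' Z Z Z"
  proof -
    have "\<kappa> Z Z Z \<in> carrier (fst M)" by (auto intro: src.carrierI src.U_zero)
    then obtain u b c where "u \<in> F" "b \<in> F" "c \<in> F" "f (\<kappa> Z Z Z) = \<kappa>' u b c"
      using tgt.carrierE hom_closed by metis
    thus ?thesis by (auto simp: tgt.\<kappa>_smult tgt.\<kappa>_eq vcong_def Pi_def)
  qed
  finally have e: "vcong m' 7 (\<lambda>i. T k (u i)) Z" "vcong m' 4 (\<lambda>i. T k (b i)) Z" "vcong m' 2 (\<lambda>i. T k (c i)) Z"
    using u by (subst (asm) tgt.\<kappa>_eq; auto)+
  have div: "\<exists>e\<in>F. \<forall>i<m'. v i = T (j - k) (e i)" if v: "v \<in> F" "vcong m' j (\<lambda>i. T k (v i)) Z" "j \<le> 7" for v j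
  proof (cases "k \<le> j")
    case True
    have "tcong (j - k) (v i) \<zero>" if "i < m'" for i
      using v that True by (intro tcong_cancel[of j k]) (auto simp: vcong_def)
    hence "vcong m' (j - k) v Z" by (simp add: vcong_def)
    from vcong_zeroE[OF this v(1)] show ?thesis by metis
  next
    case False thus ?thesis using v by (intro bexI[of _ v]) (auto simp: Pi_def)
  qed
  obtain u1 b1 c1 where u1: "u1 \<in> F" "\<forall>i<m'. u i = T (7 - k) (u1 i)"
    and b1: "b1 \<in> F" "\<forall>i<m'. b i = T (4 - k) (b1 i)"
    and c1: "c1 \<in> F" "\<forall>i<m'. c i = T (2 - k) (c1 i)"
    using div[OF u(2) e(1)] div[OF u(3) e(2)] div[OF u(4) e(3)] by auto
  have "f (\<kappa> p q r) = \<kappa>' (\<lambda>i. T (7 - k) (u1 i)) (\<lambda>i. T (4 - k) (b1 i)) (\<lambda>i. T (2 - k) (c1 i))"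
    unfolding u(5) using u u1 b1 c1 by (subst tgt.\<kappa>_eq) (auto simp: vcong_def Pi_def)
  moreover have "(\<lambda>i. T (7 - k) (u1 i)) \<in> U'"
    by (rule tgt.U_cong[OF u(1)]) (use u u1 in \<open>auto simp: vcong_def Pi_def\<close>)
  ultimately show ?thesis by (intro that[OF u1(1) b1(1) c1(1)])
qed

end

section \<open>Coefficients of a morphism\<close>

context framed_hom
begin

text \<open>Bookkeeping for linear combinations of values of \<open>f\<close> in coordinates: such facts can be added,
  scaled and compared.\<close>
definition carries where
  "carries p q r a b c \<longleftrightarrow> p \<in> U \<and> p \<in> F \<and> q \<in> F \<and> r \<in> F \<and> a \<in> F \<and> b \<in> F \<and> c \<in> F \<and>
     f (\<kappa> p q r) = \<kappa>' a b c"

lemma carries_F: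
  assumes "carries p q r a b c"
  shows "p \<in> U" "p \<in> F" "q \<in> F" "r \<in> F" "a \<in> F" "b \<in> F" "c \<in> F" "f (\<kappa> p q r) = \<kappa>' a b c"
  using assms by (auto simp: carries_def)

lemma carries_add:
  assumes 1: "carries p q r a b c" and 2: "carries p' q' r' a' b' c'"
  shows "carries (\<lambda>i. p i \<oplus> p' i) (\<lambda>i. q i \<oplus> q' i) (\<lambda>i. r i \<oplus> r' i)
             (\<lambda>i. a i \<oplus> a' i) (\<lambda>i. b i \<oplus> b' i) (\<lambda>i. c i \<oplus> c' i)"
proof -
  note d = carries_F[OF 1] carries_F[OF 2]
  have "f (\<kappa> (\<lambda>i. p i \<oplus> p' i) (\<lambda>i. q i \<oplus> q' i) (\<lambda>i. r i \<oplus> r' i)) = f (\<kappa> p q r \<oplus>\<^bsub>fst M\<^esub> \<kappa> p' q' r')"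
    using d by (simp add: src.\<kappa>_add)
  also have "\<dots> = f (\<kappa> p q r) \<oplus>\<^bsub>fst M'\<^esub> f (\<kappa> p' q' r')"
    using d by (intro hom_add src.carrierI)
  also have "\<dots> = \<kappa>' (\<lambda>i. a i \<oplus> a' i) (\<lambda>i. b i \<oplus> b' i) (\<lambda>i. c i \<oplus> c' i)"
    using d by (simp add: tgt.\<kappa>_add)
  finally show ?thesis using d unfolding carries_def by (auto intro: src.U_add)
qed

lemma carries_smult:
  assumes 1: "carries p q r a b c" and x: "x \<in> carrier L"
  shows "carries (\<lambda>i. x \<otimes> p i) (\<lambda>i. x \<otimes> q i) (\<lambda>i. x \<otimes> r i) (\<lambda>i. x \<otimes> a i) (\<lambda>i. x \<otimes> b i) (\<lambda>i. x \<otimes> c i)"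
proof -
  note d = carries_F[OF 1]
  have "f (\<kappa> (\<lambda>i. x \<otimes> p i) (\<lambda>i. x \<otimes> q i) (\<lambda>i. x \<otimes> r i)) = f (x \<odot>\<^bsub>fst M\<^esub> \<kappa> p q r)"
    using d x by (simp add: src.\<kappa>_smult)
  also have "\<dots> = x \<odot>\<^bsub>fst M'\<^esub> f (\<kappa> p q r)"
    using d x by (intro hom_smult src.carrierI)
  also have "\<dots> = \<kappa>' (\<lambda>i. x \<otimes> a i) (\<lambda>i. x \<otimes> b i) (\<lambda>i. x \<otimes> c i)"
    using d x by (simp add: tgt.\<kappa>_smult)
  finally show ?thesis using d x unfolding carries_def by (auto intro: src.U_smult)
qed

lemma carries_cong:
  assumes 1: "carries p q r a b c" and 2: "p' \<in> F" "q' \<in> F" "r' \<in> F"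
    and 3: "vcong m 7 p' p" "vcong m 4 q' q" "vcong m 2 r' r"
  shows "carries p' q' r' a b c"
proof -
  note d = carries_F[OF 1]
  have "\<kappa> p' q' r' = \<kappa> p q r" using d 2 3 by (subst src.\<kappa>_eq) auto
  moreover have "p' \<in> U" by (rule src.U_cong[OF d(1) 2(1)]) (rule vcong_mono[OF 3(1)], simp)
  ultimately show ?thesis using d 2 unfolding carries_def by auto
qed

lemma carries_pw:
  assumes 1: "carries p q r a b c"
    and "\<And>i. p' i = p i" "\<And>i. q' i = q i" "\<And>i. r' i = r i"
    and "\<And>i. a' i = a i" "\<And>i. b' i = b i" "\<And>i. c' i = c i"
  shows "carries p' q' r' a' b' c'"
proof -
  have "p' = p" "q' = q" "r' = r" "a' = a" "b' = b" "c' = c" using assms by auto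
  thus ?thesis using 1 by simp
qed

lemma carries_unique:
  assumes "carries p q r a b c" "carries p q r a' b' c'"
  shows "vcong m' 7 a a'" "vcong m' 4 b b'" "vcong m' 2 c c'"
  using assms tgt.\<kappa>_eq[of a b c a' b' c'] unfolding carries_def by auto

lemma carries_ex:
  assumes "p \<in> U" "q \<in> F" "r \<in> F"
  obtains a b c where "carries p q r a b c" "a \<in> U'"
proof -
  have "f (\<kappa> p q r) \<in> carrier (fst M')" using assms by (intro hom_closed src.carrierI)
  then obtain a b c where "a \<in> U'" "a \<in> F" "b \<in> F" "c \<in> F" "f (\<kappa> p q r) = \<kappa>' a b c"
    by (rule tgt.carrierE)
  thus ?thesis using that assms src.U_F unfolding carries_def by blast
qed

lemma acts_carries: "A p a \<longleftrightarrow> p \<in> F \<and> a \<in> F \<and> (\<exists>b c. carries (\<lambda>i. T 1 (p i)) Z Z (\<lambda>i. T 1 (a i)) b c)"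
proof -
  have "(\<lambda>i. T 1 (p i)) \<in> U" if "p \<in> F" using src.U_T[OF that, of 1] by simp
  thus ?thesis unfolding acts_def carries_def by (auto simp: Pi_def)
qed

lemma acts_F: "A p a \<Longrightarrow> p \<in> F" "A p a \<Longrightarrow> a \<in> F" by (auto simp: acts_def)

text \<open>The element \<open>t x p\<close> has order 6; as \<open>y\<close> and \<open>z\<close> have smaller orders, only the coefficient
  of \<open>x\<close> in the image is constrained. The next two lemmas are the analogues for \<open>y\<close> and \<open>z\<close>;
  they show that these contribute to the coefficient of \<open>x\<close> only with the factors \<open>t^3\<close> and
  \<open>t^5\<close>.\<close>
lemma X_ex:
  assumes p: "p \<in> F" obtains a where "A p a"
proof -
  have 1: "(\<lambda>i. T 1 (p i)) \<in> U" using src.U_T[OF p, of 1] by simp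
  have z: "\<kappa> (\<lambda>i. T 6 (T 1 (p i))) (\<lambda>i. T 6 \<zero>) (\<lambda>i. T 6 \<zero>) = \<kappa> Z Z Z"
    using p by (subst src.\<kappa>_eq) (auto simp: vcong_def Pi_def T_T simp del: One_nat_def intro!: tcong_T_zero)
  obtain u b c where u: "u \<in> F" "b \<in> F" "c \<in> F"
    "f (\<kappa> (\<lambda>i. T 1 (p i)) Z Z) = \<kappa>' (\<lambda>i. T (7 - 6) (u i)) (\<lambda>i. T (4 - 6) (b i)) (\<lambda>i. T (2 - 6) (c i))"
    by (rule torsion[OF 1 _ _ _ z]) auto
  have "(\<lambda>i. T (4 - 6) (b i)) \<in> F" "(\<lambda>i. T (2 - 6) (c i)) \<in> F" using u by auto
  moreover have "f (\<kappa> (\<lambda>i. T 1 (p i)) Z Z) = \<kappa>' (\<lambda>i. T 1 (u i)) (\<lambda>i. T (4 - 6) (b i)) (\<lambda>i. T (2 - 6) (c i))"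
    using u(4) by simp
  ultimately have "A p u" using p u(1) unfolding acts_def by blast
  thus ?thesis by (rule that)
qed

lemma Y_ex:
  assumes q: "q \<in> F" obtains a b c where "carries Z q Z (\<lambda>i. T 3 (a i)) b c" "a \<in> F" "b \<in> F" "c \<in> F"
proof -
  have z: "\<kappa> (\<lambda>i. T 4 \<zero>) (\<lambda>i. T 4 (q i)) (\<lambda>i. T 4 \<zero>) = \<kappa> Z Z Z"
    using q by (subst src.\<kappa>_eq) (auto simp: vcong_def Pi_def intro!: tcong_T_zero)
  obtain u b c where u: "u \<in> F" "b \<in> F" "c \<in> F"
    "f (\<kappa> Z q Z) = \<kappa>' (\<lambda>i. T (7 - 4) (u i)) (\<lambda>i. T (4 - 4) (b i)) (\<lambda>i. T (2 - 4) (c i))"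
    by (rule torsion[OF src.U_zero q _ _ z]) auto
  have "(\<lambda>i. T (4 - 4) (b i)) = b" "(\<lambda>i. T (2 - 4) (c i)) = c" using u by (auto simp: Pi_def)
  hence "f (\<kappa> Z q Z) = \<kappa>' (\<lambda>i. T 3 (u i)) b c" using u(4) by simp
  hence "carries Z q Z (\<lambda>i. T 3 (u i)) b c" unfolding carries_def using u q src.U_zero by auto
  thus ?thesis using that u by blast
qed

lemma Z_ex:
  assumes q: "q \<in> F"
  obtains a b c where "carries Z Z q (\<lambda>i. T 5 (a i)) (\<lambda>i. T 2 (b i)) c" "a \<in> F" "b \<in> F" "c \<in> F"
proof -
  have z: "\<kappa> (\<lambda>i. T 2 \<zero>) (\<lambda>i. T 2 \<zero>) (\<lambda>i. T 2 (q i)) = \<kappa> Z Z Z"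
    using q by (subst src.\<kappa>_eq) (auto simp: vcong_def Pi_def intro!: tcong_T_zero)
  obtain u b c where u: "u \<in> F" "b \<in> F" "c \<in> F"
    "f (\<kappa> Z Z q) = \<kappa>' (\<lambda>i. T (7 - 2) (u i)) (\<lambda>i. T (4 - 2) (b i)) (\<lambda>i. T (2 - 2) (c i))"
    by (rule torsion[OF src.U_zero _ q _ z]) auto
  have "(\<lambda>i. T (2 - 2) (c i)) = c" using u by (auto simp: Pi_def)
  hence "f (\<kappa> Z Z q) = \<kappa>' (\<lambda>i. T 5 (u i)) (\<lambda>i. T 2 (b i)) c" using u(4) by simp
  hence "carries Z Z q (\<lambda>i. T 5 (u i)) (\<lambda>i. T 2 (b i)) c" unfolding carries_def using u q src.U_zero by auto
  thus ?thesis using that u by blast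
qed

lemma acts_add: assumes "A p a" "A q b" shows "A (\<lambda>i. p i \<oplus> q i) (\<lambda>i. a i \<oplus> b i)"
proof -
  note F = acts_F[OF assms(1)] acts_F[OF assms(2)]
  obtain b1 c1 b2 c2 where "carries (\<lambda>i. T 1 (p i)) Z Z (\<lambda>i. T 1 (a i)) b1 c1"
    "carries (\<lambda>i. T 1 (q i)) Z Z (\<lambda>i. T 1 (b i)) b2 c2"
    using assms unfolding acts_carries by blast
  from carries_add[OF this]
  have "carries (\<lambda>i. T 1 (p i \<oplus> q i)) Z Z (\<lambda>i. T 1 (a i \<oplus> b i)) (\<lambda>i. b1 i \<oplus> b2 i) (\<lambda>i. c1 i \<oplus> c2 i)"
    by (rule carries_pw) (use F in \<open>auto simp: Pi_def r_distr\<close>)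
  thus ?thesis unfolding acts_carries using F by auto
qed

lemma acts_smult: assumes "A p a" "x \<in> carrier L" shows "A (\<lambda>i. x \<otimes> p i) (\<lambda>i. x \<otimes> a i)"
proof -
  note F = acts_F[OF assms(1)]
  obtain b1 c1 where "carries (\<lambda>i. T 1 (p i)) Z Z (\<lambda>i. T 1 (a i)) b1 c1"
    using assms unfolding acts_carries by blast
  from carries_smult[OF this assms(2)]
  have "carries (\<lambda>i. T 1 (x \<otimes> p i)) Z Z (\<lambda>i. T 1 (x \<otimes> a i)) (\<lambda>i. x \<otimes> b1 i) (\<lambda>i. x \<otimes> c1 i)"
    by (rule carries_pw) (use F assms in \<open>auto simp: Pi_def m_lcomm\<close>)
  thus ?thesis unfolding acts_carries using F assms by auto
qed

text \<open>Changing \<open>p\<close> by a multiple of \<open>t\<close> changes the value by a multiple of \<open>t\<close>, so the induced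
  map on residue vectors is well defined.\<close>
lemma acts_unique:
  assumes A: "A p a" "A p' a'" and v: "vcong m 1 p p'"
  shows "vcong m' 1 a a'"
proof -
  note F = acts_F[OF A(1)] acts_F[OF A(2)]
  have "vcong m 1 (\<lambda>i. p i \<ominus> p' i) (\<lambda>i. p' i \<ominus> p' i)" using v F by (intro vcong_diff) auto
  moreover have "(\<lambda>i. p' i \<ominus> p' i) = Z" using F by (auto simp: a_minus_def r_neg Pi_def)
  ultimately obtain e where e: "e \<in> F" "\<And>i. i < m \<Longrightarrow> p i \<ominus> p' i = T 1 (e i)"
    using vcong_zeroE[of m 1 "\<lambda>i. p i \<ominus> p' i"] F by (auto simp: Pi_def)
  \<comment> \<open>the value at \<open>p\<close> differs from the one at \<open>p'\<close> by \<open>t\<close> times a value at \<open>e\<close>\<close>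
  obtain ae where ae: "A e ae" by (rule X_ex[OF e(1)])
  note F = F acts_F[OF ae]
  have s: "A (\<lambda>i. p' i \<oplus> t \<otimes> e i) (\<lambda>i. a' i \<oplus> t \<otimes> ae i)"
    by (intro acts_add A acts_smult ae) simp
  have eq: "p i = p' i \<oplus> t \<otimes> e i" if "i < m" for i
  proof -
    have c: "p i \<in> carrier L" "p' i \<in> carrier L" using F by auto
    have "p' i \<oplus> (p i \<ominus> p' i) = p i" using c by (simp add: a_minus_def a_lcomm r_neg)
    thus ?thesis using e(2)[OF that] e(1) by (simp add: Pi_def)
  qed
  obtain b c where 1: "carries (\<lambda>i. T 1 (p' i \<oplus> t \<otimes> e i)) Z Z (\<lambda>i. T 1 (a' i \<oplus> t \<otimes> ae i)) b c"
    using s unfolding acts_carries by blast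
  have 2: "carries (\<lambda>i. T 1 (p i)) Z Z (\<lambda>i. T 1 (a' i \<oplus> t \<otimes> ae i)) b c"
    by (rule carries_cong[OF 1]) (use F eq in \<open>auto simp: vcong_def Pi_def\<close>)
  obtain b' c' where 3: "carries (\<lambda>i. T 1 (p i)) Z Z (\<lambda>i. T 1 (a i)) b' c'"
    using A(1) unfolding acts_carries by blast
  have 4: "vcong m' 7 (\<lambda>i. T 1 (a i)) (\<lambda>i. T 1 (a' i \<oplus> t \<otimes> ae i))"
    by (rule carries_unique(1)[OF 3 2])
  show ?thesis unfolding vcong_def
  proof (intro allI impI)
    fix i assume i: "i < m'"
    have c: "a i \<in> carrier L" "a' i \<in> carrier L" "ae i \<in> carrier L" using F by auto
    have "tcong (7 - 1) (a i) (a' i \<oplus> t \<otimes> ae i)"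
      using 4 i c unfolding vcong_def by (intro tcong_cancel) auto
    hence "tcong 1 (a i) (a' i \<oplus> t \<otimes> ae i)" by (rule tcong_mono) simp
    also have "tcong 1 (a' i \<oplus> t \<otimes> ae i) (a' i \<oplus> \<zero>)"
      using c tcong_T_zero[of 1 1 "ae i"] by (intro tcong_add) auto
    finally show "tcong 1 (a i) (a' i)" using c by simp
  qed
qed

text \<open>For \<open>p\<close> in \<open>U\<close> the element \<open>x p\<close> itself has an image, whose coefficient of \<open>x\<close> lies in
  \<open>U'\<close>; multiplying by \<open>t\<close> identifies that coefficient as a lift of \<open>\<phi> p\<close>.\<close>
lemma acts_U: assumes p: "p \<in> U" and A: "A p a" shows "a \<in> U'"
proof -
  note F = acts_F[OF A]
  obtain u b c where u: "carries p Z Z u b c" "u \<in> U'" by (rule carries_ex[OF p, of Z Z]) auto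
  have "carries (\<lambda>i. T 1 (p i)) Z Z (\<lambda>i. T 1 (u i)) (\<lambda>i. T 1 (b i)) (\<lambda>i. T 1 (c i))"
    by (rule carries_pw[OF carries_smult[OF u(1), of "t [^] (1::nat)"]]) auto
  hence "A p u" using F carries_F[OF u(1)] unfolding acts_carries by auto
  hence "vcong m' 1 a u" by (intro acts_unique[OF A]) (use F in auto)
  thus ?thesis by (rule tgt.U_cong[OF u(2) F(2)])
qed

end

context uniserial7
begin

text \<open>This lemma and the next three are the entrywise arithmetic. Here \<open>a\<close>, \<open>b\<close>, \<open>c\<close> and \<open>a'\<close>,
  \<open>b'\<close>, \<open>c'\<close> describe the images of \<open>t x v\<close> and \<open>y v\<close>. The hypotheses say that the image of
  \<open>(t^4 x - t^2 y) v\<close> is \<open>(t^3 x - t y) P + (t y - z) Q\<close>. The coefficient of \<open>z\<close> forces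
  \<open>Q = 0\<close>, that of \<open>x\<close> forces \<open>P = t a\<close>, both modulo \<open>t^2\<close>, and then the coefficient of \<open>y\<close>
  compares \<open>t a\<close> with \<open>t b'\<close>.\<close>
lemma coeff_y_x:
  assumes c: "a \<in> carrier L" "a' \<in> carrier L" "b \<in> carrier L" "b' \<in> carrier L" "c \<in> carrier L" "c' \<in> carrier L"
     "P \<in> carrier L" "Q \<in> carrier L"
  and 1: "tcong 7 (T 3 (T 1 a) \<ominus> T 2 (T 3 a')) (T 3 P)"
  and 2: "tcong 4 (T 3 b \<ominus> T 2 b') (T 1 (Q \<ominus> P))"
  and 3: "tcong 2 (T 3 c \<ominus> T 2 c') (\<ominus> Q)"
  shows "tcong 1 b' a"
proof -
  have neg: "tcong 2 (\<ominus> x) (\<ominus> y) \<Longrightarrow> x \<in> carrier L \<Longrightarrow> y \<in> carrier L \<Longrightarrow> tcong 2 x y" for x y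
    using tcong_minus[of 2 "\<ominus> x" "\<ominus> y"] by simp
  have Q: "tcong 2 Q \<zero>"
  proof -
    have "tcong 2 (\<ominus> Q) (T 3 c \<ominus> T 2 c')" by (rule tcong_sym[OF 3])
    also have "tcong 2 \<dots> (\<zero> \<ominus> \<zero>)" using c by (intro tcong_diff tcong_T_zero) auto
    finally have *: "tcong 2 (\<ominus> Q) (\<ominus> \<zero>)" using c by (auto simp: a_minus_def)
    show ?thesis by (rule neg[OF *]) (use c in auto)
  qed
  have P: "tcong 2 P (T 1 a)"
  proof -
    have e: "T 3 (T 1 a) \<ominus> T 2 (T 3 a') = T 3 (T 1 a \<ominus> T 2 a')"
      using c by (simp add: a_minus_def r_distr r_minus T_T del: One_nat_def)
    have "tcong (7 - 3) (T 1 a \<ominus> T 2 a') P"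
      using 1 c unfolding e by (intro tcong_cancel) auto
    hence "tcong 2 P (T 1 a \<ominus> T 2 a')" by (rule tcong_sym[OF tcong_mono]) simp
    also have "tcong 2 \<dots> (T 1 a \<ominus> \<zero>)" using c by (intro tcong_diff tcong_T_zero) auto
    finally show ?thesis using c by (simp add: a_minus_def)
  qed
  have e: "T 3 b \<ominus> T 2 b' = T 1 (T 2 b \<ominus> T 1 b')"
    using c by (simp add: a_minus_def r_distr r_minus T_T del: One_nat_def)
  have "tcong (4 - 1) (T 2 b \<ominus> T 1 b') (Q \<ominus> P)"
    using 2 c unfolding e by (intro tcong_cancel) auto
  hence d: "tcong 2 (T 2 b \<ominus> T 1 b') (Q \<ominus> P)" by (rule tcong_mono) simp
  have "tcong 2 (\<zero> \<ominus> T 1 b') (T 2 b \<ominus> T 1 b')"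
    using c by (intro tcong_diff tcong_sym[OF tcong_T_zero]) auto
  also note d
  also have "tcong 2 (Q \<ominus> P) (\<zero> \<ominus> T 1 a)" by (intro tcong_diff Q P)
  finally have *: "tcong 2 (\<ominus> T 1 b') (\<ominus> T 1 a)" using c by (auto simp: a_minus_def)
  have "tcong 2 (T 1 b') (T 1 a)" by (rule neg[OF *]) (use c in auto)
  hence "tcong (2 - 1) b' a" using c by (intro tcong_cancel) auto
  thus ?thesis by simp
qed

text \<open>The same argument for \<open>(t^2 y - t z) v\<close>, with \<open>c''\<close> the coefficient of \<open>z\<close> in the image of
  \<open>z v\<close>: now \<open>P = 0\<close> and \<open>Q = t c''\<close> modulo \<open>t^2\<close>.\<close>
lemma coeff_z_y:
  assumes c: "a' \<in> carrier L" "a'' \<in> carrier L" "b' \<in> carrier L" "b'' \<in> carrier L" "c' \<in> carrier L" "c'' \<in> carrier L"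
     "P \<in> carrier L" "Q \<in> carrier L"
  and 1: "tcong 7 (T 2 (T 3 a') \<ominus> T 1 (T 5 a'')) (T 3 P)"
  and 2: "tcong 4 (T 2 b' \<ominus> T 1 (T 2 b'')) (T 1 (Q \<ominus> P))"
  and 3: "tcong 2 (T 2 c' \<ominus> T 1 c'') (\<ominus> Q)"
  shows "tcong 1 c'' b'"
proof -
  have neg: "tcong 2 (\<ominus> x) (\<ominus> y) \<Longrightarrow> x \<in> carrier L \<Longrightarrow> y \<in> carrier L \<Longrightarrow> tcong 2 x y" for x y
    using tcong_minus[of 2 "\<ominus> x" "\<ominus> y"] by simp
  have Q: "tcong 2 (T 1 c'') Q"
  proof (rule neg)
    have "tcong 2 (\<zero> \<ominus> T 1 c'') (T 2 c' \<ominus> T 1 c'')" using c by (intro tcong_diff tcong_sym[OF tcong_T_zero]) auto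
    also note 3
    finally show "tcong 2 (\<ominus> T 1 c'') (\<ominus> Q)" using c by (auto simp: a_minus_def)
  qed (use c in auto)
  have P: "tcong 2 P \<zero>"
  proof -
    have e: "T 2 (T 3 a') \<ominus> T 1 (T 5 a'') = T 3 (T 2 a' \<ominus> T 3 a'')"
      using c by (simp add: a_minus_def r_distr r_minus T_T del: One_nat_def)
    have "tcong (7 - 3) (T 2 a' \<ominus> T 3 a'') P"
      using 1 c unfolding e by (intro tcong_cancel) auto
    hence "tcong 2 P (T 2 a' \<ominus> T 3 a'')" by (rule tcong_sym[OF tcong_mono]) simp
    also have "tcong 2 \<dots> (\<zero> \<ominus> \<zero>)" using c by (intro tcong_diff tcong_T_zero) auto
    finally show ?thesis using c by (simp add: a_minus_def)
  qed
  have e: "T 2 b' \<ominus> T 1 (T 2 b'') = T 1 (T 1 b' \<ominus> T 2 b'')"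
    using c by (simp add: a_minus_def r_distr r_minus T_T del: One_nat_def)
  have "tcong (4 - 1) (T 1 b' \<ominus> T 2 b'') (Q \<ominus> P)"
    using 2 c unfolding e by (intro tcong_cancel) auto
  hence d: "tcong 2 (Q \<ominus> P) (T 1 b' \<ominus> T 2 b'')" by (rule tcong_sym[OF tcong_mono]) simp
  have "tcong 2 (T 1 c'' \<ominus> \<zero>) (Q \<ominus> P)"
    by (intro tcong_diff Q tcong_sym[OF P])
  also note d
  also have "tcong 2 (T 1 b' \<ominus> T 2 b'') (T 1 b' \<ominus> \<zero>)" using c by (intro tcong_diff tcong_T_zero) auto
  finally have "tcong 2 (T 1 c'') (T 1 b')" using c by (auto simp: a_minus_def)
  hence "tcong (2 - 1) c'' b'" using c by (intro tcong_cancel) auto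
  thus ?thesis by simp
qed

lemma coeff_J1_left:
  assumes c: "a \<in> carrier L" "a' \<in> carrier L" "a'' \<in> carrier L" "P \<in> carrier L"
  and 1: "tcong 7 (T 2 (T 1 a) \<oplus> (T 1 (T 3 a') \<ominus> T 5 a'')) (T 3 P)"
  shows "tcong 1 P a"
proof -
  have e: "T 2 (T 1 a) \<oplus> (T 1 (T 3 a') \<ominus> T 5 a'') = T 3 (a \<oplus> (T 1 a' \<ominus> T 2 a''))"
    using c by (simp add: a_minus_def r_distr r_minus T_T del: One_nat_def)
  have "tcong (7 - 3) (a \<oplus> (T 1 a' \<ominus> T 2 a'')) P"
    using 1 c unfolding e by (intro tcong_cancel) auto
  hence "tcong 1 P (a \<oplus> (T 1 a' \<ominus> T 2 a''))" by (rule tcong_sym[OF tcong_mono]) simp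
  also have "tcong 1 \<dots> (a \<oplus> (\<zero> \<ominus> \<zero>))" using c by (intro tcong_diff tcong_T_zero tcong_add) auto
  finally show ?thesis using c by (simp add: a_minus_def)
qed

lemma coeff_J1_right:
  assumes c: "c \<in> carrier L" "c' \<in> carrier L" "c'' \<in> carrier L" "Q \<in> carrier L"
  and 1: "tcong 2 (T 2 c \<oplus> (T 1 c' \<ominus> c'')) (\<ominus> Q)"
  shows "tcong 1 Q c''"
proof -
  have "tcong 1 (\<ominus> Q) (T 2 c \<oplus> (T 1 c' \<ominus> c''))" using 1 by (rule tcong_sym[OF tcong_mono]) simp
  also have "tcong 1 \<dots> (\<zero> \<oplus> (\<zero> \<ominus> c''))" using c by (intro tcong_diff tcong_T_zero tcong_add) auto
  finally have "tcong 1 (\<ominus> Q) (\<ominus> c'')" using c by (simp add: a_minus_def)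
  from tcong_minus[OF this] show ?thesis using c by simp
qed

end

section \<open>The induced map modulo the radical\<close>

context framed_hom
begin

lemma carries_diff:
  assumes 1: "carries p q r a b c" and 2: "carries p' q' r' a' b' c'"
  shows "carries (\<lambda>i. p i \<ominus> p' i) (\<lambda>i. q i \<ominus> q' i) (\<lambda>i. r i \<ominus> r' i)
             (\<lambda>i. a i \<ominus> a' i) (\<lambda>i. b i \<ominus> b' i) (\<lambda>i. c i \<ominus> c' i)"
  by (rule carries_pw[OF carries_add[OF 1 carries_smult[OF 2, of "\<ominus> \<one>"]]])
    (use carries_F[OF 1] carries_F[OF 2] in \<open>auto simp: Pi_def a_minus_def l_minus\<close>)

lemma carries_sub:
  assumes r: "carries (\<lambda>i. T 3 (P i)) (\<lambda>i. T 1 (Q i \<ominus> P i)) (\<lambda>i. \<ominus> Q i) a b c" and W: "(P, Q) \<in> W"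
  obtains P' Q' where "(P', Q') \<in> W'" "P' \<in> F" "Q' \<in> F"
    "f (J1_at \<kappa> P Q) =
       J1_at \<kappa>' P' Q'"
    "vcong m' 7 a (\<lambda>i. T 3 (P' i))" "vcong m' 4 b (\<lambda>i. T 1 (Q' i \<ominus> P' i))" "vcong m' 2 c (\<lambda>i. \<ominus> Q' i)"
proof -
  note d = carries_F[OF r]
  have "f (J1_at \<kappa> P Q) \<in> snd M'"
    by (intro hom_sub src.subI W)
  then obtain P' Q' where PQ: "(P', Q') \<in> W'" "P' \<in> F" "Q' \<in> F"
    "f (J1_at \<kappa> P Q) =
       J1_at \<kappa>' P' Q'"
    by (rule tgt.subE)
  have F3: "(\<lambda>i. T 3 (P' i)) \<in> F" "(\<lambda>i. T 1 (Q' i \<ominus> P' i)) \<in> F" "(\<lambda>i. \<ominus> Q' i) \<in> F"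
    using PQ by (auto simp: Pi_def)
  have "\<kappa>' a b c = J1_at \<kappa>' P' Q'"
    using d(8) PQ(4) by simp
  hence "vcong m' 7 a (\<lambda>i. T 3 (P' i))" "vcong m' 4 b (\<lambda>i. T 1 (Q' i \<ominus> P' i))" "vcong m' 2 c (\<lambda>i. \<ominus> Q' i)"
    using tgt.\<kappa>_eq[OF d(5-7) F3] by blast+
  thus ?thesis using that PQ by blast
qed

lemma W_T: "p \<in> F \<Longrightarrow> q \<in> F \<Longrightarrow> (\<lambda>i. T 1 (p i), \<lambda>i. T 1 (q i)) \<in> W"
  by (rule src.W_cong[OF src.W_zero]) (auto simp: vcong_def Pi_def simp del: One_nat_def intro!: tcong_T_zero)

text \<open>The actions on the coefficients of \<open>t x\<close>, \<open>y\<close> and \<open>z\<close> agree modulo \<open>t\<close>. This is where the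
  special shape of \<open>J1\<close> is used: the elements \<open>(t^4 x - t^2 y) p\<close> and \<open>(t^2 y - t z) p\<close> belong
  to \<open>t J1\<close>, hence to the submodule of the object whatever \<open>W\<close> is.\<close>
lemma acts_Z:
  assumes A: "A p a" and r: "carries Z Z p u b0 c0"
  shows "vcong m' 1 c0 a"
proof -
  note F = acts_F[OF A]
  obtain b c where X: "carries (\<lambda>i. T 1 (p i)) Z Z (\<lambda>i. T 1 (a i)) b c"
    using A unfolding acts_carries by blast
  obtain a' b' c' where Y: "carries Z p Z (\<lambda>i. T 3 (a' i)) b' c'" "a' \<in> F" "b' \<in> F" "c' \<in> F"
    by (rule Y_ex[OF F(1)])
  obtain a'' b'' c'' where Zr: "carries Z Z p (\<lambda>i. T 5 (a'' i)) (\<lambda>i. T 2 (b'' i)) c''"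
    "a'' \<in> F" "b'' \<in> F" "c'' \<in> F"
    by (rule Z_ex[OF F(1)])
  note FF = F carries_F[OF X] Y(2-) Zr(2-)
  have R1: "carries (\<lambda>i. T 3 (T 1 (p i))) (\<lambda>i. T 1 (\<zero> \<ominus> T 1 (p i))) (\<lambda>i. \<ominus> \<zero>)
     (\<lambda>i. T 3 (T 1 (a i)) \<ominus> T 2 (T 3 (a' i))) (\<lambda>i. T 3 (b i) \<ominus> T 2 (b' i)) (\<lambda>i. T 3 (c i) \<ominus> T 2 (c' i))"
    by (rule carries_pw[OF carries_diff[OF carries_smult[OF X, of "t [^] (3::nat)"] carries_smult[OF Y(1), of "t [^] (2::nat)"]]])
      (use FF in \<open>auto simp: a_minus_def r_minus T_T Pi_def simp del: One_nat_def\<close>)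
  have W1: "(\<lambda>i. T 1 (p i), Z) \<in> W" using W_T[OF F(1), of Z] by simp
  have b'a: "vcong m' 1 b' a"
  proof (rule carries_sub[OF R1 W1])
    fix P Q assume PQ: "P \<in> F" "Q \<in> F"
      and v: "vcong m' 7 (\<lambda>i. T 3 (T 1 (a i)) \<ominus> T 2 (T 3 (a' i))) (\<lambda>i. T 3 (P i))"
        "vcong m' 4 (\<lambda>i. T 3 (b i) \<ominus> T 2 (b' i)) (\<lambda>i. T 1 (Q i \<ominus> P i))"
        "vcong m' 2 (\<lambda>i. T 3 (c i) \<ominus> T 2 (c' i)) (\<lambda>i. \<ominus> Q i)"
    show ?thesis unfolding vcong_def
    proof (intro allI impI)
      fix i assume i: "i < m'"
      show "tcong 1 (b' i) (a i)"
        by (rule coeff_y_x[OF _ _ _ _ _ _ _ _ v(1)[unfolded vcong_def, rule_format, OF i]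
             v(2)[unfolded vcong_def, rule_format, OF i] v(3)[unfolded vcong_def, rule_format, OF i]])
          (use FF PQ in auto)
    qed
  qed
  have R2: "carries (\<lambda>i. T 3 \<zero>) (\<lambda>i. T 1 (T 1 (p i) \<ominus> \<zero>)) (\<lambda>i. \<ominus> T 1 (p i))
     (\<lambda>i. T 2 (T 3 (a' i)) \<ominus> T 1 (T 5 (a'' i))) (\<lambda>i. T 2 (b' i) \<ominus> T 1 (T 2 (b'' i))) (\<lambda>i. T 2 (c' i) \<ominus> T 1 (c'' i))"
    by (rule carries_pw[OF carries_diff[OF carries_smult[OF Y(1), of "t [^] (2::nat)"] carries_smult[OF Zr(1), of "t [^] (1::nat)"]]])
      (use FF in \<open>auto simp: a_minus_def r_minus T_T Pi_def simp del: One_nat_def\<close>)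
  have W2: "(Z, \<lambda>i. T 1 (p i)) \<in> W" using W_T[of Z p] F by simp
  have c''b': "vcong m' 1 c'' b'"
  proof (rule carries_sub[OF R2 W2])
    fix P Q assume PQ: "P \<in> F" "Q \<in> F"
      and v: "vcong m' 7 (\<lambda>i. T 2 (T 3 (a' i)) \<ominus> T 1 (T 5 (a'' i))) (\<lambda>i. T 3 (P i))"
        "vcong m' 4 (\<lambda>i. T 2 (b' i) \<ominus> T 1 (T 2 (b'' i))) (\<lambda>i. T 1 (Q i \<ominus> P i))"
        "vcong m' 2 (\<lambda>i. T 2 (c' i) \<ominus> T 1 (c'' i)) (\<lambda>i. \<ominus> Q i)"
    show ?thesis unfolding vcong_def
    proof (intro allI impI)
      fix i assume i: "i < m'"
      show "tcong 1 (c'' i) (b' i)"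
        by (rule coeff_z_y[OF _ _ _ _ _ _ _ _ v(1)[unfolded vcong_def, rule_format, OF i]
             v(2)[unfolded vcong_def, rule_format, OF i] v(3)[unfolded vcong_def, rule_format, OF i]])
          (use FF PQ in auto)
    qed
  qed
  have "vcong m' 1 c0 c''" by (rule vcong_mono[OF carries_unique(3)[OF r Zr(1)]]) simp
  also note c''b'
  also note b'a
  finally show ?thesis .
qed

text \<open>The parameters of an element of the submodule are transformed by the induced map: \<open>P\<close> is read
  off from the coefficient of \<open>x\<close> and \<open>Q\<close> from that of \<open>z\<close>, which explains why the action on
  \<open>z\<close> has to be known as well.\<close>
lemma hom_W:
  assumes W: "(p, q) \<in> W" and A: "A p a" "A q a2"
  obtains P Q where "(P, Q) \<in> W'" "P \<in> F" "Q \<in> F"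
    "f (J1_at \<kappa> p q) =
       J1_at \<kappa>' P Q"
    "vcong m' 1 P a" "vcong m' 1 Q a2"
proof -
  note F = acts_F[OF A(1)] acts_F[OF A(2)]
  have dF: "(\<lambda>i. q i \<ominus> p i) \<in> F" using F by (auto simp: Pi_def)
  obtain b c where X: "carries (\<lambda>i. T 1 (p i)) Z Z (\<lambda>i. T 1 (a i)) b c"
    using A unfolding acts_carries by blast
  obtain a' b' c' where Y: "carries Z (\<lambda>i. q i \<ominus> p i) Z (\<lambda>i. T 3 (a' i)) b' c'" "a' \<in> F" "b' \<in> F" "c' \<in> F"
    by (rule Y_ex[OF dF])
  obtain a'' b'' c'' where Zr: "carries Z Z q (\<lambda>i. T 5 (a'' i)) (\<lambda>i. T 2 (b'' i)) c''"
    "a'' \<in> F" "b'' \<in> F" "c'' \<in> F"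
    by (rule Z_ex[OF F(3)])
  note FF = F carries_F[OF X] Y(2-) Zr(2-)
  note S = carries_add[OF carries_smult[OF X, of "t [^] (2::nat)"] carries_diff[OF carries_smult[OF Y(1), of "t [^] (1::nat)"] Zr(1)]]
  have R: "carries (\<lambda>i. T 3 (p i)) (\<lambda>i. T 1 (q i \<ominus> p i)) (\<lambda>i. \<ominus> q i)
     (\<lambda>i. T 2 (T 1 (a i)) \<oplus> (T 1 (T 3 (a' i)) \<ominus> T 5 (a'' i))) 
     (\<lambda>i. T 2 (b i) \<oplus> (T 1 (b' i) \<ominus> T 2 (b'' i))) (\<lambda>i. T 2 (c i) \<oplus> (T 1 (c' i) \<ominus> c'' i))"
    by (rule carries_pw[OF S])
      (use FF in \<open>auto simp: a_minus_def r_minus T_T Pi_def simp del: One_nat_def\<close>)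
  show ?thesis
  proof (rule carries_sub[OF R W])
    fix P Q assume PQ: "(P, Q) \<in> W'" "P \<in> F" "Q \<in> F"
      and feq: "f (J1_at \<kappa> p q) =
       J1_at \<kappa>' P Q"
      and v: "vcong m' 7 (\<lambda>i. T 2 (T 1 (a i)) \<oplus> (T 1 (T 3 (a' i)) \<ominus> T 5 (a'' i))) (\<lambda>i. T 3 (P i))"
        "vcong m' 2 (\<lambda>i. T 2 (c i) \<oplus> (T 1 (c' i) \<ominus> c'' i)) (\<lambda>i. \<ominus> Q i)"
    have "tcong 1 (P i) (a i)" if i: "i < m'" for i
      by (rule coeff_J1_left[OF _ _ _ _ v(1)[unfolded vcong_def, rule_format, OF i]]) (use FF PQ in auto)
    hence "vcong m' 1 P a" by (simp add: vcong_def)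
    moreover have "tcong 1 (Q i) (c'' i)" if i: "i < m'" for i
      by (rule coeff_J1_right[OF _ _ _ _ v(2)[unfolded vcong_def, rule_format, OF i]]) (use FF PQ in auto)
    hence "vcong m' 1 Q c''" by (simp add: vcong_def)
    hence "vcong m' 1 Q a2" using acts_Z[OF A(2) Zr(1)] vcong_trans by blast
    ultimately show ?thesis using that PQ feq by blast
  qed
qed

lemma acts_W: assumes "(p, q) \<in> W" "A p a" "A q a2" shows "(a, a2) \<in> W'"
proof (rule hom_W[OF assms])
  fix P Q assume "(P, Q) \<in> W'" "vcong m' 1 P a" "vcong m' 1 Q a2"
  thus ?thesis using acts_F assms by (intro tgt.W_cong[of P Q a a2]) (auto intro: vcong_sym)
qed

text \<open>If the induced map vanishes, the image lies in the copy of \<open>I0^m\<close>, because its coefficient of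
  \<open>x\<close> is divisible by \<open>t\<close>.\<close>
lemma nil_carrier:
  assumes nil: "\<And>p a. A p a \<Longrightarrow> vcong m' 1 a Z" and x: "x \<in> carrier (fst M)"
  obtains u b c where "u \<in> F" "vcong m' 1 u Z" "b \<in> F" "c \<in> F" "f x = \<kappa>' u b c"
proof -
  obtain p q r where p: "p \<in> U" "p \<in> F" "q \<in> F" "r \<in> F" "x = \<kappa> p q r" by (rule src.carrierE[OF x])
  obtain u b c where u: "carries p q r u b c" "u \<in> U'" by (rule carries_ex[OF p(1,3,4)])
  obtain a where A: "A p a" by (rule X_ex[OF p(2)])
  obtain b1 c1 where X: "carries (\<lambda>i. T 1 (p i)) Z Z (\<lambda>i. T 1 (a i)) b1 c1"
    using A unfolding acts_carries by blast
  obtain a' b' c' where Y: "carries Z q Z (\<lambda>i. T 3 (a' i)) b' c'" "a' \<in> F" "b' \<in> F" "c' \<in> F"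
    by (rule Y_ex[OF p(3)])
  obtain a'' b'' c'' where Zr: "carries Z Z r (\<lambda>i. T 5 (a'' i)) (\<lambda>i. T 2 (b'' i)) c''"
    "a'' \<in> F" "b'' \<in> F" "c'' \<in> F"
    by (rule Z_ex[OF p(4)])
  note FF = acts_F[OF A] carries_F[OF X] Y(2-) Zr(2-) p carries_F[OF u(1)]
  note S = carries_add[OF X carries_add[OF carries_smult[OF Y(1), of "t [^] (1::nat)"] carries_smult[OF Zr(1), of "t [^] (1::nat)"]]]
  have R1: "carries (\<lambda>i. T 1 (p i)) (\<lambda>i. T 1 (q i)) (\<lambda>i. T 1 (r i))
     (\<lambda>i. T 1 (a i \<oplus> (T 3 (a' i) \<oplus> T 5 (a'' i))))
     (\<lambda>i. b1 i \<oplus> (T 1 (b' i) \<oplus> T 1 (T 2 (b'' i)))) (\<lambda>i. c1 i \<oplus> (T 1 (c' i) \<oplus> T 1 (c'' i)))"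
    by (rule carries_pw[OF S])
      (use FF in \<open>auto simp: r_distr Pi_def simp del: One_nat_def\<close>)
  have "vcong m' 7 (\<lambda>i. T 1 (u i)) (\<lambda>i. T 1 (a i \<oplus> (T 3 (a' i) \<oplus> T 5 (a'' i))))"
    by (rule carries_unique(1)[OF carries_smult[OF u(1)] R1]) simp
  note v = this[unfolded vcong_def, rule_format]
  have "vcong m' 1 u Z" unfolding vcong_def
  proof (intro allI impI)
    fix i assume i: "i < m'"
    have c: "a i \<in> carrier L" "a' i \<in> carrier L" "a'' i \<in> carrier L" "u i \<in> carrier L" using FF by auto
    have "tcong (7 - 1) (u i) (a i \<oplus> (T 3 (a' i) \<oplus> T 5 (a'' i)))"
      using v[OF i] c by (intro tcong_cancel) auto
    hence "tcong 1 (u i) (a i \<oplus> (T 3 (a' i) \<oplus> T 5 (a'' i)))" by (rule tcong_mono) simp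
    also have "tcong 1 (a i \<oplus> (T 3 (a' i) \<oplus> T 5 (a'' i))) (\<zero> \<oplus> (\<zero> \<oplus> \<zero>))"
      using c nil[OF A] i by (intro tcong_add tcong_T_zero) (auto simp: vcong_def)
    finally show "tcong 1 (u i) \<zero>" by simp
  qed
  thus ?thesis using that FF by blast
qed

text \<open>Likewise the submodule is mapped into the copy of \<open>I1^m = t J1^m\<close>.\<close>
lemma nil_sub:
  assumes nil: "\<And>p a. A p a \<Longrightarrow> vcong m' 1 a Z" and x: "x \<in> snd M"
  obtains P Q where "P \<in> F" "Q \<in> F" "vcong m' 1 P Z" "vcong m' 1 Q Z"
    "f x = J1_at \<kappa>' P Q"
proof -
  obtain p q where p: "(p, q) \<in> W" "p \<in> F" "q \<in> F" "x = J1_at \<kappa> p q"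
    by (rule src.subE[OF x])
  obtain a a2 where A: "A p a" "A q a2" using X_ex[OF p(2)] X_ex[OF p(3)] by metis
  show ?thesis
    by (rule hom_W[OF p(1) A]) (use that p(4) nil[OF A(1)] nil[OF A(2)] vcong_trans in blast)
qed

end

text \<open>Composition is respected since the coefficients of \<open>y\<close> and \<open>z\<close> in the first image contribute
  only multiples of \<open>t^3\<close> to the coefficient of \<open>x\<close> in the second.\<close>
lemma acts_comp:
  assumes f: "framed_hom L t M \<kappa> m U W M' \<kappa>' m' U' W' f"
    and g: "framed_hom L t M' \<kappa>' m' U' W' M'' \<kappa>'' m'' U'' W'' g"
    and A: "uniserial7.acts L t \<kappa> \<kappa>' f p a" and B: "uniserial7.acts L t \<kappa>' \<kappa>'' g a a2"
  shows "\<exists>a3. uniserial7.acts L t \<kappa> \<kappa>'' (compose (carrier (fst M)) g f) p a3 \<and> uniserial7.vcong L t m'' 1 a3 a2"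
proof -
  interpret f: framed_hom L t M \<kappa> m U W M' \<kappa>' m' U' W' f by (rule f)
  interpret g: framed_hom L t M' \<kappa>' m' U' W' M'' \<kappa>'' m'' U'' W'' g by (rule g)
  obtain b c where X: "f.carries (\<lambda>i. f.T 1 (p i)) f.Z f.Z (\<lambda>i. f.T 1 (a i)) b c"
    using A unfolding f.acts_carries by blast
  obtain b1 c1 where X1: "g.carries (\<lambda>i. f.T 1 (a i)) f.Z f.Z (\<lambda>i. f.T 1 (a2 i)) b1 c1"
    using B unfolding g.acts_carries by blast
  note FF = f.carries_F[OF X] f.acts_F[OF A] g.acts_F[OF B] g.carries_F[OF X1]
  obtain a' b' c' where Y: "g.carries f.Z b f.Z (\<lambda>i. f.T 3 (a' i)) b' c'" "a' \<in> f.F" "b' \<in> f.F" "c' \<in> f.F"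
    by (rule g.Y_ex[OF FF(6)])
  obtain a'' b'' c'' where Zr: "g.carries f.Z f.Z c (\<lambda>i. f.T 5 (a'' i)) (\<lambda>i. f.T 2 (b'' i)) c''"
    "a'' \<in> f.F" "b'' \<in> f.F" "c'' \<in> f.F"
    by (rule g.Z_ex[OF FF(7)])
  note FF = FF Y(2-) Zr(2-)
  note S = g.carries_add[OF X1 g.carries_add[OF Y(1) Zr(1)]]
  let ?a3 = "\<lambda>i. a2 i \<oplus>\<^bsub>L\<^esub> (f.T 2 (a' i) \<oplus>\<^bsub>L\<^esub> f.T 4 (a'' i))"
  have a3F: "?a3 \<in> f.F" using FF by (auto simp: Pi_def)
  have R: "g.carries (\<lambda>i. f.T 1 (a i)) b c (\<lambda>i. f.T 1 (?a3 i))
     (\<lambda>i. b1 i \<oplus>\<^bsub>L\<^esub> (b' i \<oplus>\<^bsub>L\<^esub> f.T 2 (b'' i))) (\<lambda>i. c1 i \<oplus>\<^bsub>L\<^esub> (c' i \<oplus>\<^bsub>L\<^esub> c'' i))"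
    by (rule g.carries_pw[OF S])
      (use FF in \<open>auto simp: f.r_distr f.T_T Pi_def simp del: One_nat_def\<close>)
  have "\<kappa> (\<lambda>i. f.T 1 (p i)) f.Z f.Z \<in> carrier (fst M)" using FF by (intro f.src.carrierI) auto
  hence "compose (carrier (fst M)) g f (\<kappa> (\<lambda>i. f.T 1 (p i)) f.Z f.Z) = g (\<kappa>' (\<lambda>i. f.T 1 (a i)) b c)"
    using FF by (simp add: compose_def)
  also have "\<dots> = \<kappa>'' (\<lambda>i. f.T 1 (?a3 i)) (\<lambda>i. b1 i \<oplus>\<^bsub>L\<^esub> (b' i \<oplus>\<^bsub>L\<^esub> f.T 2 (b'' i))) (\<lambda>i. c1 i \<oplus>\<^bsub>L\<^esub> (c' i \<oplus>\<^bsub>L\<^esub> c'' i))"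
    using g.carries_F[OF R] by simp
  finally have "uniserial7.acts L t \<kappa> \<kappa>'' (compose (carrier (fst M)) g f) p ?a3"
    unfolding f.acts_def using FF(9) a3F g.carries_F(6,7)[OF R] by blast
  moreover have "f.vcong m'' 1 ?a3 a2" unfolding f.vcong_def
  proof (intro allI impI)
    fix i assume "i < m''"
    have c: "a2 i \<in> carrier L" "a' i \<in> carrier L" "a'' i \<in> carrier L" using FF by auto
    have "f.tcong 1 (?a3 i) (a2 i \<oplus>\<^bsub>L\<^esub> (\<zero>\<^bsub>L\<^esub> \<oplus>\<^bsub>L\<^esub> \<zero>\<^bsub>L\<^esub>))" 
      using c by (intro f.tcong_add f.tcong_T_zero) auto
    thus "f.tcong 1 (?a3 i) (a2 i)" using c by simp
  qed
  ultimately show ?thesis by blast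
qed

section \<open>Lifting maps, and the endomorphism ring\<close>

text \<open>A linear map of coordinate vectors that preserves the two subspaces acts diagonally on the three
  families of generators. The identity yields the two maps by which an endomorphism is factored
  through a power of \<open>I\<close>; lifts of left multiplications yield endomorphisms.\<close>
lemma framed_lift:
  assumes S: "framed L t M \<kappa> m U W" and S': "framed L t M' \<kappa>' m' U' W'"
    and \<Theta>F: "\<And>p. p \<in> UNIV \<rightarrow> carrier L \<Longrightarrow> \<Theta> p \<in> UNIV \<rightarrow> carrier L"
    and \<Theta>add: "\<And>p q. p \<in> UNIV \<rightarrow> carrier L \<Longrightarrow> q \<in> UNIV \<rightarrow> carrier L \<Longrightarrow>
      \<Theta> (\<lambda>i. p i \<oplus>\<^bsub>L\<^esub> q i) = (\<lambda>i. \<Theta> p i \<oplus>\<^bsub>L\<^esub> \<Theta> q i)"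
    and \<Theta>smult: "\<And>p c. p \<in> UNIV \<rightarrow> carrier L \<Longrightarrow> c \<in> carrier L \<Longrightarrow>
      \<Theta> (\<lambda>i. c \<otimes>\<^bsub>L\<^esub> p i) = (\<lambda>i. c \<otimes>\<^bsub>L\<^esub> \<Theta> p i)"
    and \<Theta>vcong: "\<And>k p q. p \<in> UNIV \<rightarrow> carrier L \<Longrightarrow> q \<in> UNIV \<rightarrow> carrier L \<Longrightarrow>
      uniserial7.vcong L t m k p q \<Longrightarrow> uniserial7.vcong L t m' k (\<Theta> p) (\<Theta> q)"
    and \<Theta>U: "\<And>p. p \<in> U \<Longrightarrow> \<Theta> p \<in> U'"
    and \<Theta>W: "\<And>p q. (p, q) \<in> W \<Longrightarrow> (\<Theta> p, \<Theta> q) \<in> W'"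
  obtains f where "f \<in> S_hom L M M'"
    "\<And>p q r. p \<in> U \<Longrightarrow> q \<in> UNIV \<rightarrow> carrier L \<Longrightarrow> r \<in> UNIV \<rightarrow> carrier L \<Longrightarrow>
       f (\<kappa> p q r) = \<kappa>' (\<Theta> p) (\<Theta> q) (\<Theta> r)"
proof -
  interpret s: framed L t M \<kappa> m U W by (rule S)
  interpret g: framed L t M' \<kappa>' m' U' W' by (rule S')
  define f where "f = (\<lambda>u\<in>carrier (fst M). SOME v. \<exists>p q r. p \<in> U \<and> q \<in> s.F \<and> r \<in> s.F \<and> u = \<kappa> p q r \<and> v = \<kappa>' (\<Theta> p) (\<Theta> q) (\<Theta> r))"
  have f: "f (\<kappa> p q r) = \<kappa>' (\<Theta> p) (\<Theta> q) (\<Theta> r)" if p: "p \<in> U" "q \<in> s.F" "r \<in> s.F" for p q r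
  proof -
    have "(SOME v. \<exists>p' q' r'. p' \<in> U \<and> q' \<in> s.F \<and> r' \<in> s.F \<and> \<kappa> p q r = \<kappa> p' q' r' \<and> v = \<kappa>' (\<Theta> p') (\<Theta> q') (\<Theta> r'))
      = \<kappa>' (\<Theta> p) (\<Theta> q) (\<Theta> r)" (is "(SOME v. ?P v) = _")
    proof (rule some_equality)
      show "?P (\<kappa>' (\<Theta> p) (\<Theta> q) (\<Theta> r))" using p by blast
      fix v assume "?P v"
      then obtain p' q' r' where q: "p' \<in> U" "q' \<in> s.F" "r' \<in> s.F" "\<kappa> p q r = \<kappa> p' q' r'"
        "v = \<kappa>' (\<Theta> p') (\<Theta> q') (\<Theta> r')" by blast
      have "s.vcong m 7 p' p \<and> s.vcong m 4 q' q \<and> s.vcong m 2 r' r"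
        using q(4)[symmetric] p q s.U_F by (subst s.\<kappa>_eq[symmetric]) auto
      thus "v = \<kappa>' (\<Theta> p) (\<Theta> q) (\<Theta> r)"
        unfolding q(5) using p q s.U_F[OF p(1)] s.U_F[OF q(1)] by (subst g.\<kappa>_eq) (auto intro!: \<Theta>F \<Theta>vcong)
    qed
    thus ?thesis using s.carrierI[OF p] by (simp add: f_def)
  qed
  have \<Theta>T: "\<Theta> (\<lambda>i. s.T k (p i)) = (\<lambda>i. s.T k (\<Theta> p i))" if "p \<in> s.F" for p k
    using that by (intro \<Theta>smult) auto
  have \<Theta>neg: "\<Theta> (\<lambda>i. \<ominus>\<^bsub>L\<^esub> p i) = (\<lambda>i. \<ominus>\<^bsub>L\<^esub> \<Theta> p i)" if p: "p \<in> s.F" for p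
  proof -
    have "(\<lambda>i. \<ominus>\<^bsub>L\<^esub> p i) = (\<lambda>i. (\<ominus>\<^bsub>L\<^esub> \<one>\<^bsub>L\<^esub>) \<otimes>\<^bsub>L\<^esub> p i)" using p by (auto simp: s.l_minus Pi_def)
    hence "\<Theta> (\<lambda>i. \<ominus>\<^bsub>L\<^esub> p i) = (\<lambda>i. (\<ominus>\<^bsub>L\<^esub> \<one>\<^bsub>L\<^esub>) \<otimes>\<^bsub>L\<^esub> \<Theta> p i)" using \<Theta>smult[OF p] by simp
    thus ?thesis using \<Theta>F[OF p] by (auto simp: s.l_minus Pi_def)
  qed
  have \<Theta>diff: "\<Theta> (\<lambda>i. p i \<ominus>\<^bsub>L\<^esub> q i) = (\<lambda>i. \<Theta> p i \<ominus>\<^bsub>L\<^esub> \<Theta> q i)" if p: "p \<in> s.F" "q \<in> s.F" for p q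
    unfolding a_minus_def using p by (subst \<Theta>add) (auto simp: \<Theta>neg Pi_def)
  have hom: "f \<in> S_hom L M M'"
    unfolding S_hom_def
  proof (intro CollectI conjI ballI)
    show "f \<in> carrier (fst M) \<rightarrow>\<^sub>E carrier (fst M')"
    proof (rule PiE_I)
      fix u assume "u \<in> carrier (fst M)"
      then obtain p q r where "p \<in> U" "p \<in> s.F" "q \<in> s.F" "r \<in> s.F" "u = \<kappa> p q r" by (rule s.carrierE)
      thus "f u \<in> carrier (fst M')" by (simp add: f g.carrierI \<Theta>U \<Theta>F)
    qed (simp add: f_def)
  next
    fix u v assume "u \<in> carrier (fst M)" "v \<in> carrier (fst M)"
    then obtain p q r p' q' r' where p: "p \<in> U" "p \<in> s.F" "q \<in> s.F" "r \<in> s.F" "u = \<kappa> p q r"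
      "p' \<in> U" "p' \<in> s.F" "q' \<in> s.F" "r' \<in> s.F" "v = \<kappa> p' q' r'" by (elim s.carrierE) blast
    have "(\<lambda>i. q i \<oplus>\<^bsub>L\<^esub> q' i) \<in> s.F" "(\<lambda>i. r i \<oplus>\<^bsub>L\<^esub> r' i) \<in> s.F" using p by auto
    thus "f (u \<oplus>\<^bsub>fst M\<^esub> v) = f u \<oplus>\<^bsub>fst M'\<^esub> f v"
      using p by (simp add: s.\<kappa>_add g.\<kappa>_add f s.U_add \<Theta>add \<Theta>F)
  next
    fix c u assume c: "c \<in> carrier L" and "u \<in> carrier (fst M)"
    then obtain p q r where p: "p \<in> U" "p \<in> s.F" "q \<in> s.F" "r \<in> s.F" "u = \<kappa> p q r" by (elim s.carrierE) blast
    have "(\<lambda>i. c \<otimes>\<^bsub>L\<^esub> q i) \<in> s.F" "(\<lambda>i. c \<otimes>\<^bsub>L\<^esub> r i) \<in> s.F" using p c by auto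
    thus "f (c \<odot>\<^bsub>fst M\<^esub> u) = c \<odot>\<^bsub>fst M'\<^esub> f u"
      using p c by (simp add: s.\<kappa>_smult g.\<kappa>_smult f s.U_smult \<Theta>smult \<Theta>F)
  next
    show "f ` snd M \<subseteq> snd M'"
    proof (rule image_subsetI)
      fix u assume "u \<in> snd M"
      then obtain p q where p: "(p, q) \<in> W" "p \<in> s.F" "q \<in> s.F"
        and u: "u = \<kappa> (\<lambda>i. s.T 3 (p i)) (\<lambda>i. s.T 1 (q i \<ominus>\<^bsub>L\<^esub> p i)) (\<lambda>i. \<ominus>\<^bsub>L\<^esub> q i)" by (rule s.subE)
      have F: "(\<lambda>i. q i \<ominus>\<^bsub>L\<^esub> p i) \<in> s.F" "(\<lambda>i. \<ominus>\<^bsub>L\<^esub> q i) \<in> s.F" "(\<lambda>i. s.T 1 (q i \<ominus>\<^bsub>L\<^esub> p i)) \<in> s.F"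
        using p by (auto simp: Pi_def)
      have "f u = \<kappa>' (\<lambda>i. s.T 3 (\<Theta> p i)) (\<lambda>i. s.T 1 (\<Theta> q i \<ominus>\<^bsub>L\<^esub> \<Theta> p i)) (\<lambda>i. \<ominus>\<^bsub>L\<^esub> \<Theta> q i)"
        unfolding u using s.U_T[OF p(2), of 3] F p \<Theta>T[OF p(2), of 3] \<Theta>T[OF F(1), of 1]
        by (subst f) (auto simp: \<Theta>diff \<Theta>neg simp del: One_nat_def)
      thus "f u \<in> snd M'" using g.subI[OF \<Theta>W[OF p(1)]] by simp
    qed
  qed
  show ?thesis using that[OF hom f] by blast
qed

lemma S_End_ring:
  assumes M: "S_obj L M"
  shows "ring (S_End L M)"
proof -
  interpret M: module L "fst M" using M by (simp add: S_obj_def)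
  have sub: "submodule (snd M) L (fst M)" using M by (simp add: S_obj_def)
  note sE = M.submoduleE[OF sub]
  let ?C = "carrier (fst M)"
  have mem: "f \<in> S_hom L M M \<longleftrightarrow> f \<in> extensional ?C \<and> (\<forall>x\<in>?C. f x \<in> ?C) \<and>
     (\<forall>x\<in>?C. \<forall>y\<in>?C. f (x \<oplus>\<^bsub>fst M\<^esub> y) = f x \<oplus>\<^bsub>fst M\<^esub> f y) \<and>
     (\<forall>a\<in>carrier L. \<forall>x\<in>?C. f (a \<odot>\<^bsub>fst M\<^esub> x) = a \<odot>\<^bsub>fst M\<^esub> f x) \<and> (\<forall>x\<in>snd M. f x \<in> snd M)" for f
    unfolding S_hom_def PiE_def by auto
  have ext: "f = g" if "f \<in> S_hom L M M" "g \<in> S_hom L M M" "\<And>x. x \<in> ?C \<Longrightarrow> f x = g x" for f g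
    using that unfolding mem by (intro extensionalityI[of f ?C g]) auto
  have addc: "(\<lambda>x\<in>?C. f x \<oplus>\<^bsub>fst M\<^esub> g x) \<in> S_hom L M M" if "f \<in> S_hom L M M" "g \<in> S_hom L M M" for f g
    using that sE(1) unfolding mem
    by (auto simp: M.a_ac M.smult_r_distr subset_iff intro!: sE)
  have z0: "\<zero>\<^bsub>fst M\<^esub> \<in> snd M"
    using submodule.axioms(1)[OF sub] subgroup.one_closed by fastforce
  have zc: "(\<lambda>x\<in>?C. \<zero>\<^bsub>fst M\<^esub>) \<in> S_hom L M M"
    using sE z0 unfolding mem by (auto simp: subset_iff)
  have oc: "(\<lambda>x\<in>?C. x) \<in> S_hom L M M"
    using sE unfolding mem by (auto simp: subset_iff)
  have cc: "compose ?C f g \<in> S_hom L M M" if "f \<in> S_hom L M M" "g \<in> S_hom L M M" for f g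
    using that sE(1) unfolding mem by (auto simp: compose_def subset_iff)
  have nc: "(\<lambda>x\<in>?C. \<ominus>\<^bsub>fst M\<^esub> f x) \<in> S_hom L M M" if "f \<in> S_hom L M M" for f
    using that sE(1) unfolding mem
    by (auto simp: M.minus_add M.smult_r_minus subset_iff intro!: sE)
  show ?thesis
  proof (intro ringI abelian_groupI monoidI)
    fix x assume x: "x \<in> carrier (S_End L M)"
    show "\<exists>y\<in>carrier (S_End L M). y \<oplus>\<^bsub>S_End L M\<^esub> x = \<zero>\<^bsub>S_End L M\<^esub>"
    proof (rule bexI)
      show "(\<lambda>u\<in>?C. \<ominus>\<^bsub>fst M\<^esub> x u) \<in> carrier (S_End L M)" using x nc by (simp add: S_End_def)
      show "(\<lambda>u\<in>?C. \<ominus>\<^bsub>fst M\<^esub> x u) \<oplus>\<^bsub>S_End L M\<^esub> x = \<zero>\<^bsub>S_End L M\<^esub>"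
        using x unfolding S_End_def by (auto simp: mem M.l_neg intro!: restrict_ext)
    qed
  next
    fix x y z assume x: "x \<in> carrier (S_End L M)" "y \<in> carrier (S_End L M)" "z \<in> carrier (S_End L M)"
    show "(x \<otimes>\<^bsub>S_End L M\<^esub> y) \<otimes>\<^bsub>S_End L M\<^esub> z = x \<otimes>\<^bsub>S_End L M\<^esub> (y \<otimes>\<^bsub>S_End L M\<^esub> z)"
      using x unfolding S_End_def by (auto simp: mem compose_def intro!: restrict_ext)
    show "(x \<oplus>\<^bsub>S_End L M\<^esub> y) \<otimes>\<^bsub>S_End L M\<^esub> z = x \<otimes>\<^bsub>S_End L M\<^esub> z \<oplus>\<^bsub>S_End L M\<^esub> y \<otimes>\<^bsub>S_End L M\<^esub> z"
      using x unfolding S_End_def by (auto simp: mem compose_def intro!: restrict_ext)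
    show "z \<otimes>\<^bsub>S_End L M\<^esub> (x \<oplus>\<^bsub>S_End L M\<^esub> y) = z \<otimes>\<^bsub>S_End L M\<^esub> x \<oplus>\<^bsub>S_End L M\<^esub> z \<otimes>\<^bsub>S_End L M\<^esub> y"
      using x unfolding S_End_def by (auto simp: mem compose_def intro!: restrict_ext)
    show "(x \<oplus>\<^bsub>S_End L M\<^esub> y) \<oplus>\<^bsub>S_End L M\<^esub> z = x \<oplus>\<^bsub>S_End L M\<^esub> (y \<oplus>\<^bsub>S_End L M\<^esub> z)"
      using x unfolding S_End_def by (auto simp: mem M.a_assoc intro!: restrict_ext)
  next
    fix x y assume x: "x \<in> carrier (S_End L M)" "y \<in> carrier (S_End L M)"
    show "x \<oplus>\<^bsub>S_End L M\<^esub> y = y \<oplus>\<^bsub>S_End L M\<^esub> x"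
      using x unfolding S_End_def by (auto simp: mem M.a_comm intro!: restrict_ext)
    show "x \<oplus>\<^bsub>S_End L M\<^esub> y \<in> carrier (S_End L M)"
      using x addc by (simp add: S_End_def)
    show "x \<otimes>\<^bsub>S_End L M\<^esub> y \<in> carrier (S_End L M)"
      using x cc by (simp add: S_End_def)
  next
    show "\<zero>\<^bsub>S_End L M\<^esub> \<in> carrier (S_End L M)" using zc by (simp add: S_End_def)
    show "\<one>\<^bsub>S_End L M\<^esub> \<in> carrier (S_End L M)" using oc by (simp add: S_End_def)
  next
    fix x assume x: "x \<in> carrier (S_End L M)"
    hence x': "x \<in> S_hom L M M" by (simp add: S_End_def)
    show "\<zero>\<^bsub>S_End L M\<^esub> \<oplus>\<^bsub>S_End L M\<^esub> x = x"
      unfolding S_End_def using x' addc[OF zc x'] by (simp, intro ext) (auto simp: mem)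
    show "\<one>\<^bsub>S_End L M\<^esub> \<otimes>\<^bsub>S_End L M\<^esub> x = x"
      unfolding S_End_def using x' cc[OF oc x'] by (simp, intro ext) (auto simp: mem compose_def)
    show "x \<otimes>\<^bsub>S_End L M\<^esub> \<one>\<^bsub>S_End L M\<^esub> = x"
      unfolding S_End_def using x' cc[OF x' oc] by (simp, intro ext) (auto simp: mem compose_def)
  qed
qed

section \<open>A concrete model of the ambient module\<close>

lemma (in cring) regular_module_module: "module R (regular_module R)"
proof (intro moduleI abelian_groupI is_cring)
  fix x assume "x \<in> carrier (regular_module R)"
  thus "\<exists>y\<in>carrier (regular_module R). y \<oplus>\<^bsub>regular_module R\<^esub> x = \<zero>\<^bsub>regular_module R\<^esub>"
    by (intro bexI[of _ "\<ominus> x"]) (auto simp: regular_module_def l_neg)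
qed (auto simp: regular_module_def a_ac m_assoc l_distr r_distr)

lemma module_power_module:
  assumes "module L M" shows "module L (module_power M m)"
proof -
  interpret module L M by (rule assms)
  show ?thesis
  proof (intro moduleI abelian_groupI is_cring)
    fix x assume x: "x \<in> carrier (module_power M m)"
    show "\<exists>y\<in>carrier (module_power M m). y \<oplus>\<^bsub>module_power M m\<^esub> x = \<zero>\<^bsub>module_power M m\<^esub>"
      using x by (intro bexI[of _ "\<lambda>i\<in>{..<m}. \<ominus>\<^bsub>M\<^esub> x i"])
        (auto simp: module_power_def M.l_neg PiE_iff intro!: restrict_ext)
    show "\<zero>\<^bsub>module_power M m\<^esub> \<oplus>\<^bsub>module_power M m\<^esub> x = x"
      using x by (auto simp: module_power_def PiE_iff extensional_def)
    show "\<one>\<^bsub>L\<^esub> \<odot>\<^bsub>module_power M m\<^esub> x = x"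
      using x by (auto simp: module_power_def PiE_iff extensional_def)
  qed (auto simp: module_power_def PiE_iff M.a_ac smult_l_distr smult_r_distr smult_assoc1 intro!: restrict_ext)
qed

lemma quot_module_facts:
  assumes M: "module L M" and N: "submodule N L M"
  shows "carrier (quot_module M N) = (\<lambda>x. N +>\<^bsub>M\<^esub> x) ` carrier M"
    and "\<And>x y. x \<in> carrier M \<Longrightarrow> y \<in> carrier M \<Longrightarrow>
      (N +>\<^bsub>M\<^esub> x) \<oplus>\<^bsub>quot_module M N\<^esub> (N +>\<^bsub>M\<^esub> y) = N +>\<^bsub>M\<^esub> (x \<oplus>\<^bsub>M\<^esub> y)"
    and "\<And>a x. a \<in> carrier L \<Longrightarrow> x \<in> carrier M \<Longrightarrow>
      a \<odot>\<^bsub>quot_module M N\<^esub> (N +>\<^bsub>M\<^esub> x) = N +>\<^bsub>M\<^esub> (a \<odot>\<^bsub>M\<^esub> x)"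
    and "\<zero>\<^bsub>quot_module M N\<^esub> = N +>\<^bsub>M\<^esub> \<zero>\<^bsub>M\<^esub>"
    and "\<And>x y. x \<in> carrier M \<Longrightarrow> y \<in> carrier M \<Longrightarrow>
      N +>\<^bsub>M\<^esub> x = N +>\<^bsub>M\<^esub> y \<longleftrightarrow> x \<ominus>\<^bsub>M\<^esub> y \<in> N"
proof -
  interpret module L M by (rule M)
  interpret N: submodule N L M by (rule N)
  interpret abelian_subgroup N M
    by (intro abelian_subgroupI3 additive_subgroup.intro N.subgroup_axioms M.abelian_group_axioms)
  note sE = submoduleE[OF N]
  show "carrier (quot_module M N) = (\<lambda>x. N +>\<^bsub>M\<^esub> x) ` carrier M"
    by (auto simp: quot_module_def A_RCOSETS_def RCOSETS_def a_r_coset_def)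
  show eq: "N +>\<^bsub>M\<^esub> x = N +>\<^bsub>M\<^esub> y \<longleftrightarrow> x \<ominus>\<^bsub>M\<^esub> y \<in> N" if x: "x \<in> carrier M" "y \<in> carrier M" for x y
  proof
    assume "N +>\<^bsub>M\<^esub> x = N +>\<^bsub>M\<^esub> y"
    hence "x \<in> N +>\<^bsub>M\<^esub> y" using a_rcos_self[OF x(1)] by simp
    then obtain h where h: "h \<in> N" "x = h \<oplus>\<^bsub>M\<^esub> y" by (auto simp: a_r_coset_def r_coset_def)
    have "h \<in> carrier M" using h sE(1) by auto
    hence "x \<ominus>\<^bsub>M\<^esub> y = h" using h x by (simp add: a_minus_def M.a_assoc M.r_neg)
    thus "x \<ominus>\<^bsub>M\<^esub> y \<in> N" using h by simp
  next
    assume h: "x \<ominus>\<^bsub>M\<^esub> y \<in> N"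
    have "x = (x \<ominus>\<^bsub>M\<^esub> y) \<oplus>\<^bsub>M\<^esub> y" using x by (simp add: a_minus_def M.a_assoc M.l_neg)
    hence "x \<in> N +>\<^bsub>M\<^esub> y" using h by (auto simp: a_r_coset_def r_coset_def)
    thus "N +>\<^bsub>M\<^esub> x = N +>\<^bsub>M\<^esub> y" using a_repr_independence[OF _ x(2) N.subgroup_axioms] by simp
  qed
  show "(N +>\<^bsub>M\<^esub> x) \<oplus>\<^bsub>quot_module M N\<^esub> (N +>\<^bsub>M\<^esub> y) = N +>\<^bsub>M\<^esub> (x \<oplus>\<^bsub>M\<^esub> y)"
    if "x \<in> carrier M" "y \<in> carrier M" for x y
    using a_rcos_sum that by (simp add: quot_module_def)
  show "\<zero>\<^bsub>quot_module M N\<^esub> = N +>\<^bsub>M\<^esub> \<zero>\<^bsub>M\<^esub>"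
    using a_coset_add_zero[OF sE(1)] by (simp add: quot_module_def)
  show "a \<odot>\<^bsub>quot_module M N\<^esub> (N +>\<^bsub>M\<^esub> x) = N +>\<^bsub>M\<^esub> (a \<odot>\<^bsub>M\<^esub> x)"
    if a: "a \<in> carrier L" and x: "x \<in> carrier M" for a x
  proof -
    have "N +>\<^bsub>M\<^esub> (a \<odot>\<^bsub>M\<^esub> z) = N +>\<^bsub>M\<^esub> (a \<odot>\<^bsub>M\<^esub> x)" if z: "z \<in> N +>\<^bsub>M\<^esub> x" for z
    proof -
      obtain h where h: "h \<in> N" "z = h \<oplus>\<^bsub>M\<^esub> x" using z by (auto simp: a_r_coset_def r_coset_def)
      have hc: "h \<in> carrier M" using h sE(1) by auto
      have "a \<odot>\<^bsub>M\<^esub> z \<ominus>\<^bsub>M\<^esub> a \<odot>\<^bsub>M\<^esub> x = a \<odot>\<^bsub>M\<^esub> h"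
        using h hc x a by (simp add: smult_r_distr a_minus_def M.a_assoc M.r_neg)
      thus ?thesis using eq h hc x a by auto
    qed
    moreover have "x \<in> N +>\<^bsub>M\<^esub> x" by (rule a_rcos_self[OF x])
    ultimately have "(\<Union>z\<in>N +>\<^bsub>M\<^esub> x. N +>\<^bsub>M\<^esub> (a \<odot>\<^bsub>M\<^esub> z)) = N +>\<^bsub>M\<^esub> (a \<odot>\<^bsub>M\<^esub> x)"
      by blast
    thus ?thesis by (simp add: quot_module_def)
  qed
qed

lemma module_spanI:
  assumes "submodule X R M" "S \<subseteq> X" "\<And>N x. submodule N R M \<Longrightarrow> S \<subseteq> N \<Longrightarrow> x \<in> X \<Longrightarrow> x \<in> N"
  shows "module_span R M S = X"
  unfolding module_span_def using assms by blast

context uniserial7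
begin

abbreviation FM where "FM m \<equiv> free_module L (3 * m)"

text \<open>Three vectors are interleaved into one: the entries \<open>3 i\<close>, \<open>3 i + 1\<close> and \<open>3 i + 2\<close> are the
  coefficients of the i-th copies of \<open>x\<close>, \<open>y\<close> and \<open>z\<close>.\<close>
definition pick :: "(nat \<Rightarrow> 'a) \<Rightarrow> (nat \<Rightarrow> 'a) \<Rightarrow> (nat \<Rightarrow> 'a) \<Rightarrow> nat \<Rightarrow> 'a" where
  "pick p q r l = (if l mod 3 = 0 then p else if l mod 3 = 1 then q else r) (l div 3)"

definition coords :: "nat \<Rightarrow> (nat \<Rightarrow> 'a) \<Rightarrow> (nat \<Rightarrow> 'a) \<Rightarrow> (nat \<Rightarrow> 'a) \<Rightarrow> nat \<Rightarrow> 'a" where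
  "coords m p q r = (\<lambda>l\<in>{..<3*m}. pick p q r l)"

lemma pick_index:
  "pick p q r (3 * i) = p i" "pick p q r (3 * i + 1) = q i" "pick p q r (3 * i + 2) = r i"
proof -
  have m: "(3 * i) mod 3 = 0" "(3 * i + 1) mod 3 = 1" "(3 * i + 2) mod 3 = 2"
    "(3 * i) div 3 = i" "(3 * i + 1) div 3 = i" "(3 * i + 2) div 3 = i" by presburger+
  show "pick p q r (3 * i) = p i" "pick p q r (3 * i + 1) = q i" "pick p q r (3 * i + 2) = r i"
    unfolding pick_def m by simp_all
qed

lemma FM_module: "module L (FM m)"
  unfolding free_module_def by (intro module_power_module regular_module_module)

lemma coords_closed: "p \<in> F \<Longrightarrow> q \<in> F \<Longrightarrow> r \<in> F \<Longrightarrow> coords m p q r \<in> carrier (FM m)"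
  by (auto simp: free_module_def module_power_def regular_module_def coords_def pick_def Pi_def)

lemma coords_surj: assumes x: "x \<in> carrier (FM m)" obtains p q r where "p \<in> F" "q \<in> F" "r \<in> F" "x = coords m p q r"
proof -
  have x': "x \<in> {..<3*m} \<rightarrow>\<^sub>E carrier L"
    using x by (simp add: free_module_def module_power_def regular_module_def)
  define y where "y l = (if l < 3 * m then x l else \<zero>)" for l
  have y: "y l \<in> carrier L" for l using PiE_mem[OF x', of l] by (simp add: y_def)
  have "x l = coords m (\<lambda>i. y (3 * i)) (\<lambda>i. y (3 * i + 1)) (\<lambda>i. y (3 * i + 2)) l" for l
  proof (cases "l < 3 * m")
    case True
    have l: "3 * (l div 3) + l mod 3 = l" by simp
    consider "l mod 3 = 0" | "l mod 3 = 1" | "l mod 3 = 2" by linarith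
    hence "pick (\<lambda>i. y (3 * i)) (\<lambda>i. y (3 * i + 1)) (\<lambda>i. y (3 * i + 2)) l = y (3 * (l div 3) + l mod 3)"
      by cases (simp_all add: pick_def)
    hence "pick (\<lambda>i. y (3 * i)) (\<lambda>i. y (3 * i + 1)) (\<lambda>i. y (3 * i + 2)) l = y l" unfolding l .
    thus ?thesis using True by (simp add: coords_def y_def)
  qed (use PiE_arb[OF x', of l] in \<open>simp add: coords_def\<close>)
  thus ?thesis using y by (intro that[of "\<lambda>i. y (3 * i)" "\<lambda>i. y (3 * i + 1)" "\<lambda>i. y (3 * i + 2)"]) auto
qed

lemma coords_eq: "coords m p q r = coords m p' q' r' \<longleftrightarrow> (\<forall>i<m. p i = p' i \<and> q i = q' i \<and> r i = r' i)"
proof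
  assume h: "coords m p q r = coords m p' q' r'"
  have "pick p q r l = pick p' q' r' l" if "l < 3 * m" for l
    using fun_cong[OF h, of l] that by (simp add: coords_def)
  note e = this
  show "\<forall>i<m. p i = p' i \<and> q i = q' i \<and> r i = r' i"
  proof (intro allI impI)
    fix i assume "i < m"
    hence "3 * i < 3 * m" "3 * i + 1 < 3 * m" "3 * i + 2 < 3 * m" by presburger+
    thus "p i = p' i \<and> q i = q' i \<and> r i = r' i"
      using e[of "3 * i"] e[of "3 * i + 1"] e[of "3 * i + 2"] unfolding pick_index by metis
  qed
next
  assume h: "\<forall>i<m. p i = p' i \<and> q i = q' i \<and> r i = r' i"
  show "coords m p q r = coords m p' q' r'"
    unfolding coords_def
  proof (rule restrict_ext)
    fix l assume "l \<in> {..<3*m}"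
    hence "l div 3 < m" by auto
    thus "pick p q r l = pick p' q' r' l" using h by (simp add: pick_def)
  qed
qed

lemma coords_add: "coords m p q r \<oplus>\<^bsub>FM m\<^esub> coords m p' q' r' = coords m (\<lambda>i. p i \<oplus> p' i) (\<lambda>i. q i \<oplus> q' i) (\<lambda>i. r i \<oplus> r' i)"
  by (auto simp: free_module_def module_power_def regular_module_def coords_def pick_def intro!: restrict_ext)
lemma coords_smult: "c \<odot>\<^bsub>FM m\<^esub> coords m p q r = coords m (\<lambda>i. c \<otimes> p i) (\<lambda>i. c \<otimes> q i) (\<lambda>i. c \<otimes> r i)"
  by (auto simp: free_module_def module_power_def regular_module_def coords_def pick_def intro!: restrict_ext)
lemma coords_zero: "\<zero>\<^bsub>FM m\<^esub> = coords m Z Z Z"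
  by (auto simp: free_module_def module_power_def regular_module_def coords_def pick_def intro!: restrict_ext)

lemma coords_minus:
  assumes "p \<in> F" "q \<in> F" "r \<in> F"
  shows "\<ominus>\<^bsub>FM m\<^esub> coords m p q r = coords m (\<lambda>i. \<ominus> p i) (\<lambda>i. \<ominus> q i) (\<lambda>i. \<ominus> r i)"
proof -
  interpret FM: module L "FM m" by (rule FM_module)
  have "coords m (\<lambda>i. \<ominus> p i) (\<lambda>i. \<ominus> q i) (\<lambda>i. \<ominus> r i) \<oplus>\<^bsub>FM m\<^esub> coords m p q r = \<zero>\<^bsub>FM m\<^esub>"
    using assms by (simp add: coords_add coords_zero coords_eq l_neg Pi_def)
  moreover have "coords m (\<lambda>i. \<ominus> p i) (\<lambda>i. \<ominus> q i) (\<lambda>i. \<ominus> r i) \<in> carrier (FM m)"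
    using assms by (intro coords_closed) (auto simp: Pi_def)
  ultimately show ?thesis using assms coords_closed FM.minus_equality by metis
qed

text \<open>For \<open>m = 1\<close> this is the relation module of \<open>J0\<close>; the quotient by it in general is \<open>J0^m\<close>,
  whose elements are sets of functions from \<open>nat\<close> to the ring, as the theorem demands.\<close>
definition relations :: "nat \<Rightarrow> (nat \<Rightarrow> 'a) set" where
  "relations m = {coords m (\<lambda>i. T 7 (a i)) (\<lambda>i. T 4 (b i)) (\<lambda>i. T 2 (c i)) | a b c. a \<in> F \<and> b \<in> F \<and> c \<in> F}"

lemma relationsI: "a \<in> F \<Longrightarrow> b \<in> F \<Longrightarrow> c \<in> F \<Longrightarrow> coords m (\<lambda>i. T 7 (a i)) (\<lambda>i. T 4 (b i)) (\<lambda>i. T 2 (c i)) \<in> relations m"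
  unfolding relations_def by blast

lemma relationsE:
  assumes "x \<in> relations m" obtains a b c where "a \<in> F" "b \<in> F" "c \<in> F"
    "x = coords m (\<lambda>i. T 7 (a i)) (\<lambda>i. T 4 (b i)) (\<lambda>i. T 2 (c i))"
  using assms unfolding relations_def by blast

lemma relations_submodule: "submodule (relations m) L (FM m)"
proof -
  interpret FM: module L "FM m" by (rule FM_module)
  show ?thesis
  proof (rule FM.submoduleI)
    show "relations m \<subseteq> carrier (FM m)" by (auto elim!: relationsE intro!: coords_closed)
    show "\<zero>\<^bsub>FM m\<^esub> \<in> relations m" using relationsI[of "\<lambda>i. \<zero>" "\<lambda>i. \<zero>" "\<lambda>i. \<zero>" m] by (simp add: coords_zero Pi_def)
    fix x assume "x \<in> relations m"
    then obtain a b c where abc: "a \<in> F" "b \<in> F" "c \<in> F" "x = coords m (\<lambda>i. T 7 (a i)) (\<lambda>i. T 4 (b i)) (\<lambda>i. T 2 (c i))"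
      by (rule relationsE)
    have "\<ominus>\<^bsub>FM m\<^esub> x = coords m (\<lambda>i. T 7 (\<ominus> a i)) (\<lambda>i. T 4 (\<ominus> b i)) (\<lambda>i. T 2 (\<ominus> c i))"
      using abc by (simp add: coords_minus coords_eq r_minus Pi_def)
    also have "\<dots> \<in> relations m" using abc by (intro relationsI) (auto simp: Pi_def)
    finally show "\<ominus>\<^bsub>FM m\<^esub> x \<in> relations m" .
    { fix k assume k: "k \<in> carrier L"
      have "k \<odot>\<^bsub>FM m\<^esub> x = coords m (\<lambda>i. T 7 (k \<otimes> a i)) (\<lambda>i. T 4 (k \<otimes> b i)) (\<lambda>i. T 2 (k \<otimes> c i))"
        using abc k by (simp add: coords_smult coords_eq m_lcomm Pi_def)
      also have "\<dots> \<in> relations m" using abc k by (intro relationsI) auto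
      finally show "k \<odot>\<^bsub>FM m\<^esub> x \<in> relations m" . }
    { fix y assume "y \<in> relations m"
      then obtain a' b' c' where abc': "a' \<in> F" "b' \<in> F" "c' \<in> F"
        "y = coords m (\<lambda>i. T 7 (a' i)) (\<lambda>i. T 4 (b' i)) (\<lambda>i. T 2 (c' i))" by (rule relationsE)
      have "x \<oplus>\<^bsub>FM m\<^esub> y = coords m (\<lambda>i. T 7 (a i \<oplus> a' i)) (\<lambda>i. T 4 (b i \<oplus> b' i)) (\<lambda>i. T 2 (c i \<oplus> c' i))"
        using abc abc' by (simp add: coords_add coords_eq r_distr Pi_def)
      also have "\<dots> \<in> relations m" using abc abc' by (intro relationsI) auto
      finally show "x \<oplus>\<^bsub>FM m\<^esub> y \<in> relations m" . }
  qed
qed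

lemma tcong_diff_iff: "a \<in> carrier L \<Longrightarrow> b \<in> carrier L \<Longrightarrow> tcong k (a \<ominus> b) \<zero> \<longleftrightarrow> tcong k a b"
proof
  assume c: "a \<in> carrier L" "b \<in> carrier L" and "tcong k (a \<ominus> b) \<zero>"
  hence "tcong k ((a \<ominus> b) \<oplus> b) (\<zero> \<oplus> b)" by (intro tcong_add) auto
  thus "tcong k a b" using c by (simp add: a_minus_def a_assoc l_neg)
next
  assume c: "a \<in> carrier L" "b \<in> carrier L" and "tcong k a b"
  hence "tcong k (a \<ominus> b) (b \<ominus> b)" by (intro tcong_diff) auto
  thus "tcong k (a \<ominus> b) \<zero>" using c by (simp add: a_minus_def r_neg)
qed

lemma coords_in_relations:
  assumes "p \<in> F" "q \<in> F" "r \<in> F"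
  shows "coords m p q r \<in> relations m \<longleftrightarrow> vcong m 7 p Z \<and> vcong m 4 q Z \<and> vcong m 2 r Z"
proof
  assume "coords m p q r \<in> relations m"
  then obtain a b c where abc: "a \<in> F" "b \<in> F" "c \<in> F" "coords m p q r = coords m (\<lambda>i. T 7 (a i)) (\<lambda>i. T 4 (b i)) (\<lambda>i. T 2 (c i))"
    by (rule relationsE)
  have "tcong 7 (T 7 (a i)) \<zero> \<and> tcong 4 (T 4 (b i)) \<zero> \<and> tcong 2 (T 2 (c i)) \<zero>" for i
    using abc(1-3) by (intro conjI tcong_T_zero) auto
  thus "vcong m 7 p Z \<and> vcong m 4 q Z \<and> vcong m 2 r Z"
    using abc(4)[unfolded coords_eq] by (simp add: vcong_def)
next
  assume v: "vcong m 7 p Z \<and> vcong m 4 q Z \<and> vcong m 2 r Z"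
  obtain a where a: "a \<in> F" "\<And>i. i < m \<Longrightarrow> p i = T 7 (a i)"
    using vcong_zeroE[of m 7 p] v assms by blast
  obtain b where b: "b \<in> F" "\<And>i. i < m \<Longrightarrow> q i = T 4 (b i)"
    using vcong_zeroE[of m 4 q] v assms by blast
  obtain c where c: "c \<in> F" "\<And>i. i < m \<Longrightarrow> r i = T 2 (c i)"
    using vcong_zeroE[of m 2 r] v assms by blast
  note abc = a b c
  from abc have "coords m p q r = coords m (\<lambda>i. T 7 (a i)) (\<lambda>i. T 4 (b i)) (\<lambda>i. T 2 (c i))" by (simp add: coords_eq)
  thus "coords m p q r \<in> relations m" using relationsI abc by simp
qed

definition cosetv :: "nat \<Rightarrow> (nat \<Rightarrow> 'a) \<Rightarrow> (nat \<Rightarrow> 'a) \<Rightarrow> (nat \<Rightarrow> 'a) \<Rightarrow> (nat \<Rightarrow> 'a) set" where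
  "cosetv m p q r = relations m +>\<^bsub>FM m\<^esub> coords m p q r"

abbreviation ambient where "ambient m \<equiv> quot_module (FM m) (relations m)"

lemmas quot_laws = quot_module_facts[OF FM_module relations_submodule]

lemma cosetv_add: "\<lbrakk>p \<in> F; q \<in> F; r \<in> F; p' \<in> F; q' \<in> F; r' \<in> F\<rbrakk> \<Longrightarrow>
    cosetv m p q r \<oplus>\<^bsub>ambient m\<^esub> cosetv m p' q' r' = cosetv m (\<lambda>i. p i \<oplus> p' i) (\<lambda>i. q i \<oplus> q' i) (\<lambda>i. r i \<oplus> r' i)"
  unfolding cosetv_def by (subst quot_laws(2)) (simp_all add: coords_add coords_closed)

lemma cosetv_smult: "\<lbrakk>p \<in> F; q \<in> F; r \<in> F; c \<in> carrier L\<rbrakk> \<Longrightarrow>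
    c \<odot>\<^bsub>ambient m\<^esub> cosetv m p q r = cosetv m (\<lambda>i. c \<otimes> p i) (\<lambda>i. c \<otimes> q i) (\<lambda>i. c \<otimes> r i)"
  unfolding cosetv_def by (subst quot_laws(3)) (simp_all add: coords_smult coords_closed)

lemma cosetv_zero: "\<zero>\<^bsub>ambient m\<^esub> = cosetv m Z Z Z"
  unfolding cosetv_def quot_laws(4) by (simp add: coords_zero)

lemma cosetv_eq:
  assumes F: "p \<in> F" "q \<in> F" "r \<in> F" "p' \<in> F" "q' \<in> F" "r' \<in> F"
  shows "cosetv m p q r = cosetv m p' q' r' \<longleftrightarrow> vcong m 7 p p' \<and> vcong m 4 q q' \<and> vcong m 2 r r'"
proof -
  have dF: "(\<lambda>i. p i \<ominus> p' i) \<in> F" "(\<lambda>i. q i \<ominus> q' i) \<in> F" "(\<lambda>i. r i \<ominus> r' i) \<in> F"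
    using F by (auto simp: Pi_def)
  have "cosetv m p q r = cosetv m p' q' r' \<longleftrightarrow> coords m p q r \<ominus>\<^bsub>FM m\<^esub> coords m p' q' r' \<in> relations m"
    unfolding cosetv_def using F by (intro quot_laws(5) coords_closed)
  also have "coords m p q r \<ominus>\<^bsub>FM m\<^esub> coords m p' q' r' = coords m (\<lambda>i. p i \<ominus> p' i) (\<lambda>i. q i \<ominus> q' i) (\<lambda>i. r i \<ominus> r' i)"
    using F by (simp add: a_minus_def coords_minus coords_add)
  also have "\<dots> \<in> relations m \<longleftrightarrow> vcong m 7 p p' \<and> vcong m 4 q q' \<and> vcong m 2 r r'"
    unfolding coords_in_relations[OF dF] using F by (simp add: vcong_def tcong_diff_iff Pi_def)
  finally show ?thesis .
qed

definition object_of :: "nat \<Rightarrow> (nat \<Rightarrow> 'a) set \<Rightarrow> ((nat \<Rightarrow> 'a) \<times> (nat \<Rightarrow> 'a)) set \<Rightarrow> ('a, (nat \<Rightarrow> 'a) set) sub_pair" where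
  "object_of m U W = ((ambient m)\<lparr>carrier := {cosetv m p q r | p q r. p \<in> U \<and> q \<in> F \<and> r \<in> F}\<rparr>,
      {J1_at (cosetv m) p q | p q. (p, q) \<in> W})"

lemma object_of_framed:
  assumes "subspace_pair L t m U W"
  shows "framed L t (object_of m U W) (cosetv m) m U W"
  by (intro framed.intro assms framed_axioms.intro)
    (simp_all add: object_of_def cosetv_add cosetv_smult cosetv_zero cosetv_eq)

lemma full_subspace_pair: "subspace_pair L t m F (F \<times> F)"
  by unfold_locales auto

abbreviation FM1 where "FM1 \<equiv> free_module L 3"
abbreviation J where "J \<equiv> J0 L t"

definition Jel :: "'a \<Rightarrow> 'a \<Rightarrow> 'a \<Rightarrow> (nat \<Rightarrow> 'a) set" where
  "Jel p q r = cosetv 1 (\<lambda>_. p) (\<lambda>_. q) (\<lambda>_. r)"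

lemma cosetv_Jel: "cosetv 1 p q r = Jel (p 0) (q 0) (r 0)"
proof -
  have "coords 1 p q r = coords 1 (\<lambda>_. p 0) (\<lambda>_. q 0) (\<lambda>_. r 0)" by (simp add: coords_eq)
  thus ?thesis by (simp add: Jel_def cosetv_def)
qed

lemma F_const: "p \<in> carrier L \<Longrightarrow> (\<lambda>_. p) \<in> F" by auto

lemma basis_coords: "free_basis L 3 0 = coords 1 (\<lambda>_. \<one>) (\<lambda>_. \<zero>) (\<lambda>_. \<zero>)"
  "free_basis L 3 1 = coords 1 (\<lambda>_. \<zero>) (\<lambda>_. \<one>) (\<lambda>_. \<zero>)"
  "free_basis L 3 2 = coords 1 (\<lambda>_. \<zero>) (\<lambda>_. \<zero>) (\<lambda>_. \<one>)"
  by (auto simp: free_basis_def coords_def pick_def intro!: restrict_ext)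

lemma J_rel_eq: "J_rel L t = relations 1"
proof -
  interpret FM: module L "FM 1" by (rule FM_module)
  have F1: "FM1 = FM 1" by simp
  let ?e = "\<lambda>a b c. coords 1 (\<lambda>_. T 7 a) (\<lambda>_. T 4 b) (\<lambda>_. T 2 c)"
  have g: "(t [^] (7::nat)) \<odot>\<^bsub>FM1\<^esub> free_basis L 3 0 = ?e \<one> \<zero> \<zero>"
    "(t [^] (4::nat)) \<odot>\<^bsub>FM1\<^esub> free_basis L 3 1 = ?e \<zero> \<one> \<zero>"
    "(t [^] (2::nat)) \<odot>\<^bsub>FM1\<^esub> free_basis L 3 2 = ?e \<zero> \<zero> \<one>"
    unfolding basis_coords F1 coords_smult by (simp_all add: coords_eq)
  show ?thesis unfolding J_rel_def g unfolding F1
  proof (rule module_spanI[OF relations_submodule])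
    have eK: "?e a b c \<in> relations 1" if "a \<in> carrier L" "b \<in> carrier L" "c \<in> carrier L" for a b c
      using that by (intro relationsI F_const)
    show "{?e \<one> \<zero> \<zero>, ?e \<zero> \<one> \<zero>, ?e \<zero> \<zero> \<one>} \<subseteq> relations 1" by (intro insert_subsetI eK) auto
    fix N x assume N: "submodule N L (FM 1)" and S: "{?e \<one> \<zero> \<zero>, ?e \<zero> \<one> \<zero>, ?e \<zero> \<zero> \<one>} \<subseteq> N" and "x \<in> relations 1"
    then obtain a b c where abc: "a \<in> F" "b \<in> F" "c \<in> F" "x = coords 1 (\<lambda>i. T 7 (a i)) (\<lambda>i. T 4 (b i)) (\<lambda>i. T 2 (c i))"
      by (elim relationsE)
    have c: "a 0 \<in> carrier L" "b 0 \<in> carrier L" "c 0 \<in> carrier L" using abc by auto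
    have "x = a 0 \<odot>\<^bsub>FM 1\<^esub> ?e \<one> \<zero> \<zero> \<oplus>\<^bsub>FM 1\<^esub> (b 0 \<odot>\<^bsub>FM 1\<^esub> ?e \<zero> \<one> \<zero> \<oplus>\<^bsub>FM 1\<^esub> c 0 \<odot>\<^bsub>FM 1\<^esub> ?e \<zero> \<zero> \<one>)"
      unfolding abc(4) coords_smult coords_add coords_eq using c by (simp add: m_comm)
    moreover have "a 0 \<odot>\<^bsub>FM 1\<^esub> ?e \<one> \<zero> \<zero> \<in> N" "b 0 \<odot>\<^bsub>FM 1\<^esub> ?e \<zero> \<one> \<zero> \<in> N" "c 0 \<odot>\<^bsub>FM 1\<^esub> ?e \<zero> \<zero> \<one> \<in> N"
      by (rule FM.submoduleE(4)[OF N]; use S c in simp)+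
    ultimately show "x \<in> N" using FM.submoduleE(5)[OF N] by metis
  qed
qed

lemma J0_eq: "J = ambient 1" unfolding J0_def J_rel_eq by simp

lemma J_carrier: "carrier J = {Jel p q r | p q r. p \<in> carrier L \<and> q \<in> carrier L \<and> r \<in> carrier L}"
proof (intro equalityI subsetI)
  fix x assume "x \<in> carrier J"
  then obtain y where y: "y \<in> carrier (FM 1)" "x = relations 1 +>\<^bsub>FM 1\<^esub> y" unfolding J0_eq quot_laws(1) by blast
  obtain p q r where "p \<in> F" "q \<in> F" "r \<in> F" "y = coords 1 p q r" by (rule coords_surj[OF y(1)])
  hence "x = Jel (p 0) (q 0) (r 0)" "p 0 \<in> carrier L" "q 0 \<in> carrier L" "r 0 \<in> carrier L"
    using y(2) cosetv_Jel by (auto simp: cosetv_def)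
  thus "x \<in> {Jel p q r | p q r. p \<in> carrier L \<and> q \<in> carrier L \<and> r \<in> carrier L}" by blast
next
  fix x assume "x \<in> {Jel p q r | p q r. p \<in> carrier L \<and> q \<in> carrier L \<and> r \<in> carrier L}"
  then obtain p q r where "x = Jel p q r" "p \<in> carrier L" "q \<in> carrier L" "r \<in> carrier L" by blast
  thus "x \<in> carrier J"
    using coords_closed[of "\<lambda>_. p" "\<lambda>_. q" "\<lambda>_. r" 1] F_const unfolding J0_eq quot_laws(1) Jel_def cosetv_def by blast
qed

lemma Jel_add: "\<lbrakk>p \<in> carrier L; q \<in> carrier L; r \<in> carrier L; p' \<in> carrier L; q' \<in> carrier L; r' \<in> carrier L\<rbrakk>
  \<Longrightarrow> Jel p q r \<oplus>\<^bsub>J\<^esub> Jel p' q' r' = Jel (p \<oplus> p') (q \<oplus> q') (r \<oplus> r')"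
  unfolding J0_eq Jel_def by (rule cosetv_add) auto

lemma Jel_smult: "\<lbrakk>p \<in> carrier L; q \<in> carrier L; r \<in> carrier L; c \<in> carrier L\<rbrakk>
  \<Longrightarrow> c \<odot>\<^bsub>J\<^esub> Jel p q r = Jel (c \<otimes> p) (c \<otimes> q) (c \<otimes> r)"
  unfolding J0_eq Jel_def by (rule cosetv_smult) auto

lemma Jel_zero: "\<zero>\<^bsub>J\<^esub> = Jel \<zero> \<zero> \<zero>"
  unfolding J0_eq Jel_def by (rule cosetv_zero)

lemma Jel_eq: "\<lbrakk>p \<in> carrier L; q \<in> carrier L; r \<in> carrier L; p' \<in> carrier L; q' \<in> carrier L; r' \<in> carrier L\<rbrakk>
  \<Longrightarrow> Jel p q r = Jel p' q' r' \<longleftrightarrow> tcong 7 p p' \<and> tcong 4 q q' \<and> tcong 2 r r'"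
  unfolding Jel_def by (subst cosetv_eq) (auto simp: vcong_def)

lemma J_xyz: "J_x L t = Jel \<one> \<zero> \<zero>" "J_y L t = Jel \<zero> \<one> \<zero>" "J_z L t = Jel \<zero> \<zero> \<one>"
  unfolding J_x_def J_y_def J_z_def Jel_def cosetv_def basis_coords J_rel_eq by simp_all

definition J1set where
  "J1set = {Jel (T 3 p) (T 1 (q \<ominus> p)) (\<ominus> q) | p q. p \<in> carrier L \<and> q \<in> carrier L}"

lemma J_module: "module L J"
  and J1set_submodule: "submodule J1set L J"
proof -
  let ?M = "object_of 1 F (F \<times> F)"
  interpret framed L t ?M "cosetv 1" 1 F "F \<times> F" by (rule object_of_framed[OF full_subspace_pair])
  have c: "carrier J = {cosetv 1 p q r | p q r. p \<in> F \<and> q \<in> F \<and> r \<in> F}"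
    unfolding J_carrier cosetv_Jel
  proof (intro equalityI subsetI)
    fix x assume "x \<in> {Jel p q r | p q r. p \<in> carrier L \<and> q \<in> carrier L \<and> r \<in> carrier L}"
    then obtain p q r where "x = Jel p q r" "p \<in> carrier L" "q \<in> carrier L" "r \<in> carrier L" by blast
    thus "x \<in> {Jel (p 0) (q 0) (r 0) | p q r. p \<in> F \<and> q \<in> F \<and> r \<in> F}"
      by (intro CollectI exI[of _ "\<lambda>_. p"] exI[of _ "\<lambda>_. q"] exI[of _ "\<lambda>_. r"]) simp
  next
    fix x assume "x \<in> {Jel (p 0) (q 0) (r 0) | p q r. p \<in> F \<and> q \<in> F \<and> r \<in> F}"
    then obtain p q r where "x = Jel (p 0) (q 0) (r 0)" "p \<in> F" "q \<in> F" "r \<in> F" by blast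
    moreover have "p 0 \<in> carrier L" "q 0 \<in> carrier L" "r 0 \<in> carrier L" using calculation by auto
    ultimately show "x \<in> {Jel p q r | p q r. p \<in> carrier L \<and> q \<in> carrier L \<and> r \<in> carrier L}"
      by blast
  qed
  have "fst ?M = (ambient 1)\<lparr>carrier := carrier J\<rparr>" by (simp only: object_of_def fst_conv c)
  hence J: "fst ?M = J" unfolding J0_eq by simp
  have J1: "snd ?M = J1set"
    unfolding object_of_def snd_conv J1set_def cosetv_Jel
  proof (intro equalityI subsetI)
    fix x assume "x \<in> {Jel (T 3 p) (T 1 (q \<ominus> p)) (\<ominus> q) | p q. p \<in> carrier L \<and> q \<in> carrier L}"
    then obtain p q where "x = Jel (T 3 p) (T 1 (q \<ominus> p)) (\<ominus> q)" "p \<in> carrier L" "q \<in> carrier L" by blast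
    thus "x \<in> {Jel (T 3 (p 0)) (T 1 (q 0 \<ominus> p 0)) (\<ominus> q 0) |p q. (p, q) \<in> F \<times> F}"
      by (intro CollectI exI[of _ "\<lambda>_. p"] exI[of _ "\<lambda>_. q"]) simp
  next
    fix x assume "x \<in> {Jel (T 3 (p 0)) (T 1 (q 0 \<ominus> p 0)) (\<ominus> q 0) |p q. (p, q) \<in> F \<times> F}"
    then obtain p q where "x = Jel (T 3 (p 0)) (T 1 (q 0 \<ominus> p 0)) (\<ominus> q 0)" "p \<in> F" "q \<in> F" by blast
    moreover have "p 0 \<in> carrier L" "q 0 \<in> carrier L" using calculation by auto
    ultimately show "x \<in> {Jel (T 3 p) (T 1 (q \<ominus> p)) (\<ominus> q) | p q. p \<in> carrier L \<and> q \<in> carrier L}"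
      by blast
  qed
  show "module L J" "submodule J1set L J" using is_module is_submodule unfolding J J1 .
qed

end

section \<open>Powers of the object I\<close>

context uniserial7
begin

lemma J1_eq: "J1 L t = J1set"
proof -
  interpret JM: module L J by (rule J_module)
  have neg: "\<ominus>\<^bsub>J\<^esub> Jel p q r = Jel (\<ominus> p) (\<ominus> q) (\<ominus> r)"
    if "p \<in> carrier L" "q \<in> carrier L" "r \<in> carrier L" for p q r
  proof -
    have "Jel (\<ominus> p) (\<ominus> q) (\<ominus> r) \<oplus>\<^bsub>J\<^esub> Jel p q r = \<zero>\<^bsub>J\<^esub>" using that by (simp add: Jel_add Jel_zero l_neg)
    moreover have "Jel (\<ominus> p) (\<ominus> q) (\<ominus> r) \<in> carrier J" "Jel p q r \<in> carrier J"
      using that unfolding J_carrier by auto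
    ultimately show ?thesis using JM.minus_equality by auto
  qed
  have g1: "((t [^] (3::nat)) \<odot>\<^bsub>J\<^esub> J_x L t) \<ominus>\<^bsub>J\<^esub> (t \<odot>\<^bsub>J\<^esub> J_y L t) = Jel (T 3 \<one>) (\<ominus> t) \<zero>"
    and g2: "(t \<odot>\<^bsub>J\<^esub> J_y L t) \<ominus>\<^bsub>J\<^esub> J_z L t = Jel \<zero> t (\<ominus> \<one>)"
    unfolding J_xyz a_minus_def by (simp_all add: Jel_smult neg Jel_add)
  show ?thesis unfolding J1_def g1 g2
  proof (rule module_spanI[OF J1set_submodule])
    have "Jel (T 3 \<one>) (\<ominus> t) \<zero> = Jel (T 3 \<one>) (T 1 (\<zero> \<ominus> \<one>)) (\<ominus> \<zero>)"
      "Jel \<zero> t (\<ominus> \<one>) = Jel (T 3 \<zero>) (T 1 (\<one> \<ominus> \<zero>)) (\<ominus> \<one>)"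
      by (simp_all add: a_minus_def r_minus)
    moreover have "Jel (T 3 \<one>) (T 1 (\<zero> \<ominus> \<one>)) (\<ominus> \<zero>) \<in> J1set" "Jel (T 3 \<zero>) (T 1 (\<one> \<ominus> \<zero>)) (\<ominus> \<one>) \<in> J1set"
      unfolding J1set_def by blast+
    ultimately show "{Jel (T 3 \<one>) (\<ominus> t) \<zero>, Jel \<zero> t (\<ominus> \<one>)} \<subseteq> J1set" by simp
    fix N x assume N: "submodule N L J" and S: "{Jel (T 3 \<one>) (\<ominus> t) \<zero>, Jel \<zero> t (\<ominus> \<one>)} \<subseteq> N" and "x \<in> J1set"
    then obtain p q where x: "x = Jel (T 3 p) (T 1 (q \<ominus> p)) (\<ominus> q)" and pq: "p \<in> carrier L" "q \<in> carrier L"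
      unfolding J1set_def by blast
    have "x = p \<odot>\<^bsub>J\<^esub> Jel (T 3 \<one>) (\<ominus> t) \<zero> \<oplus>\<^bsub>J\<^esub> q \<odot>\<^bsub>J\<^esub> Jel \<zero> t (\<ominus> \<one>)"
      using pq unfolding x by (simp add: Jel_smult Jel_add m_comm r_minus r_distr a_minus_def a_comm)
    moreover have "p \<odot>\<^bsub>J\<^esub> Jel (T 3 \<one>) (\<ominus> t) \<zero> \<in> N" "q \<odot>\<^bsub>J\<^esub> Jel \<zero> t (\<ominus> \<one>) \<in> N"
      using S pq by (auto intro: JM.submoduleE(4)[OF N])
    ultimately show "x \<in> N" using JM.submoduleE(5)[OF N] by simp
  qed
qed

definition I0set where
  "I0set = {Jel (T 1 a) b c | a b c. a \<in> carrier L \<and> b \<in> carrier L \<and> c \<in> carrier L}"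

lemma I0_span: "module_span L J {t \<odot>\<^bsub>J\<^esub> J_x L t, J_y L t, J_z L t} = I0set"
proof -
  interpret JM: module L J by (rule J_module)
  have gx: "t \<odot>\<^bsub>J\<^esub> J_x L t = Jel (T 1 \<one>) \<zero> \<zero>" and gy: "J_y L t = Jel (T 1 \<zero>) \<one> \<zero>" and gz: "J_z L t = Jel (T 1 \<zero>) \<zero> \<one>"
    unfolding J_xyz by (simp_all add: Jel_smult)
  have sm: "k \<odot>\<^bsub>J\<^esub> x \<in> I0set" if k: "k \<in> carrier L" and x: "x \<in> I0set" for k x
  proof -
    obtain a b c where x: "x = Jel (T 1 a) b c" "a \<in> carrier L" "b \<in> carrier L" "c \<in> carrier L"
      using x unfolding I0set_def by blast
    have "k \<odot>\<^bsub>J\<^esub> x = Jel (T 1 (k \<otimes> a)) (k \<otimes> b) (k \<otimes> c)" using x k by (simp add: Jel_smult m_lcomm)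
    thus ?thesis unfolding I0set_def using x k by blast
  qed
  have sub: "I0set \<subseteq> carrier J"
  proof
    fix x assume "x \<in> I0set"
    then obtain a b c where x: "x = Jel (T 1 a) b c" "a \<in> carrier L" "b \<in> carrier L" "c \<in> carrier L"
      unfolding I0set_def by blast
    have "T 1 a \<in> carrier L" using x by simp
    thus "x \<in> carrier J" unfolding J_carrier x(1) using x by blast
  qed
  have I: "submodule I0set L J"
  proof (rule JM.submoduleI[OF sub])
    show "\<zero>\<^bsub>J\<^esub> \<in> I0set" unfolding I0set_def Jel_zero
      by (intro CollectI exI[of _ \<zero>]) simp
    fix x assume x: "x \<in> I0set"
    have "\<ominus>\<^bsub>J\<^esub> x = (\<ominus> \<one>) \<odot>\<^bsub>J\<^esub> x" using x sub by (auto simp: JM.smult_l_minus)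
    thus "\<ominus>\<^bsub>J\<^esub> x \<in> I0set" using sm x by simp
    fix y assume y: "y \<in> I0set"
    obtain a b c where x: "x = Jel (T 1 a) b c" "a \<in> carrier L" "b \<in> carrier L" "c \<in> carrier L"
      using x unfolding I0set_def by blast
    obtain a' b' c' where y: "y = Jel (T 1 a') b' c'" "a' \<in> carrier L" "b' \<in> carrier L" "c' \<in> carrier L"
      using y unfolding I0set_def by blast
    have "x \<oplus>\<^bsub>J\<^esub> y = Jel (T 1 (a \<oplus> a')) (b \<oplus> b') (c \<oplus> c')" using x y by (simp add: Jel_add r_distr)
    thus "x \<oplus>\<^bsub>J\<^esub> y \<in> I0set" unfolding I0set_def using x y by blast
  qed (rule sm)
  show ?thesis unfolding gx gy gz
  proof (rule module_spanI[OF I])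
    show "{Jel (T 1 \<one>) \<zero> \<zero>, Jel (T 1 \<zero>) \<one> \<zero>, Jel (T 1 \<zero>) \<zero> \<one>} \<subseteq> I0set" unfolding I0set_def by blast
    fix N x assume N: "submodule N L J" and S: "{Jel (T 1 \<one>) \<zero> \<zero>, Jel (T 1 \<zero>) \<one> \<zero>, Jel (T 1 \<zero>) \<zero> \<one>} \<subseteq> N" and "x \<in> I0set"
    then obtain a b c where x: "x = Jel (T 1 a) b c" "a \<in> carrier L" "b \<in> carrier L" "c \<in> carrier L"
      unfolding I0set_def by blast
    have "x = a \<odot>\<^bsub>J\<^esub> Jel (T 1 \<one>) \<zero> \<zero> \<oplus>\<^bsub>J\<^esub> (b \<odot>\<^bsub>J\<^esub> Jel (T 1 \<zero>) \<one> \<zero> \<oplus>\<^bsub>J\<^esub> c \<odot>\<^bsub>J\<^esub> Jel (T 1 \<zero>) \<zero> \<one>)"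
      using x by (simp add: Jel_smult Jel_add m_comm)
    moreover have "a \<odot>\<^bsub>J\<^esub> Jel (T 1 \<one>) \<zero> \<zero> \<in> N" "b \<odot>\<^bsub>J\<^esub> Jel (T 1 \<zero>) \<one> \<zero> \<in> N" "c \<odot>\<^bsub>J\<^esub> Jel (T 1 \<zero>) \<zero> \<one> \<in> N"
      by (rule JM.submoduleE(4)[OF N]; use x S in blast)+
    ultimately show "x \<in> N" using JM.submoduleE(5)[OF N] by simp
  qed
qed

lemma I_sub: "snd (I_obj L t) = {Jel (T 3 (T 1 p)) (T 1 (T 1 q \<ominus> T 1 p)) (\<ominus> T 1 q) | p q. p \<in> carrier L \<and> q \<in> carrier L}"
proof -
  have e: "t \<odot>\<^bsub>J\<^esub> Jel (T 3 p) (T 1 (q \<ominus> p)) (\<ominus> q) = Jel (T 3 (T 1 p)) (T 1 (T 1 q \<ominus> T 1 p)) (\<ominus> T 1 q)"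
    if "p \<in> carrier L" "q \<in> carrier L" for p q
  proof -
    have "t \<otimes> T 3 p = T 3 (T 1 p)" "t \<otimes> T 1 (q \<ominus> p) = T 1 (T 1 q \<ominus> T 1 p)" "t \<otimes> (\<ominus> q) = \<ominus> T 1 q"
      using that by (simp_all add: m_lcomm r_minus r_distr a_minus_def)
    thus ?thesis using that by (simp add: Jel_smult)
  qed
  have "snd (I_obj L t) = (\<lambda>u. t \<odot>\<^bsub>J\<^esub> u) ` J1set" by (simp add: I_obj_def J1_eq)
  also have "\<dots> = {t \<odot>\<^bsub>J\<^esub> Jel (T 3 p) (T 1 (q \<ominus> p)) (\<ominus> q) | p q. p \<in> carrier L \<and> q \<in> carrier L}"
    unfolding J1set_def by blast
  also have "\<dots> = {Jel (T 3 (T 1 p)) (T 1 (T 1 q \<ominus> T 1 p)) (\<ominus> T 1 q) | p q. p \<in> carrier L \<and> q \<in> carrier L}"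
    using e by (intro Collect_cong) metis
  finally show ?thesis .
qed

text \<open>The vectors that vanish modulo \<open>t\<close>, that is, the zero subspace of \<open>V\<close>.\<close>
definition tF :: "nat \<Rightarrow> (nat \<Rightarrow> 'a) set" where "tF m = {p \<in> F. vcong m 1 p Z}"

definition powel :: "nat \<Rightarrow> (nat \<Rightarrow> 'a) \<Rightarrow> (nat \<Rightarrow> 'a) \<Rightarrow> (nat \<Rightarrow> 'a) \<Rightarrow> nat \<Rightarrow> (nat \<Rightarrow> 'a) set" where
  "powel m p q r = (\<lambda>i\<in>{..<m}. Jel (p i) (q i) (r i))"

lemma tF_laws:
  shows "tF m \<subseteq> F"
    and "\<lbrakk>p \<in> tF m; q \<in> tF m\<rbrakk> \<Longrightarrow> (\<lambda>i. p i \<oplus> q i) \<in> tF m"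
    and "\<lbrakk>p \<in> tF m; c \<in> carrier L\<rbrakk> \<Longrightarrow> (\<lambda>i. c \<otimes> p i) \<in> tF m"
    and "Z \<in> tF m"
    and "\<lbrakk>p \<in> tF m; p' \<in> F; vcong m 1 p' p\<rbrakk> \<Longrightarrow> p' \<in> tF m"
proof -
  show "tF m \<subseteq> F" by (auto simp: tF_def)
  show "(\<lambda>i. p i \<oplus> q i) \<in> tF m" if "p \<in> tF m" "q \<in> tF m"
    using that vcong_add[of m 1 p "\<lambda>i. \<zero>" q "\<lambda>i. \<zero>"] by (auto simp: tF_def Pi_def)
  show "(\<lambda>i. c \<otimes> p i) \<in> tF m" if "p \<in> tF m" "c \<in> carrier L"
    using that vcong_mult[of m 1 p "\<lambda>i. \<zero>" c] by (auto simp: tF_def Pi_def)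
  show "Z \<in> tF m" by (auto simp: tF_def)
  show "p' \<in> tF m" if "p \<in> tF m" "p' \<in> F" "vcong m 1 p' p"
    using that vcong_trans unfolding tF_def by blast
qed

lemma tF_subspace_pair: "subspace_pair L t m (tF m) (tF m \<times> tF m)"
proof
  show "tF m \<times> tF m \<subseteq> F \<times> F" using tF_laws(1) by blast
  fix p q p' q' :: "nat \<Rightarrow> 'a" and c
  assume pq: "(p, q) \<in> tF m \<times> tF m"
  show "(\<lambda>i. p i \<oplus> p' i, \<lambda>i. q i \<oplus> q' i) \<in> tF m \<times> tF m" if "(p', q') \<in> tF m \<times> tF m"
    using pq that by (simp add: tF_laws(2))
  show "(\<lambda>i. c \<otimes> p i, \<lambda>i. c \<otimes> q i) \<in> tF m \<times> tF m" if "c \<in> carrier L"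
    using pq that by (simp add: tF_laws(3))
  show "(p', q') \<in> tF m \<times> tF m" if "p' \<in> F" "q' \<in> F" "vcong m 1 p' p" "vcong m 1 q' q"
    using pq tF_laws(5)[OF _ that(1,3)] tF_laws(5)[OF _ that(2,4)] by simp
next
  show "(\<lambda>i. \<zero>, \<lambda>i. \<zero>) \<in> tF m \<times> tF m" by (simp add: tF_laws(4))
qed (rule tF_laws; assumption)+

text \<open>A power of \<open>I\<close> is the object that belongs to the zero subspaces: its submodule \<open>t J1\<close> arises
  from parameters divisible by \<open>t\<close>.\<close>
lemma I_power_framed: "framed L t (S_power (I_obj L t) m) (powel m) m (tF m) (tF m \<times> tF m)"
proof (intro framed.intro framed_axioms.intro tF_subspace_pair)
  let ?M = "S_power (I_obj L t) m"
  show "carrier (fst ?M) = {powel m p q r | p q r. p \<in> tF m \<and> q \<in> F \<and> r \<in> F}"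
  proof -
    have C: "carrier (fst ?M) = {..<m} \<rightarrow>\<^sub>E I0set"
      by (simp add: S_power_def module_power_def I_obj_def I0_span)
    show ?thesis unfolding C
    proof (intro equalityI subsetI)
      fix x assume x: "x \<in> {..<m} \<rightarrow>\<^sub>E I0set"
      have "\<exists>a b c. a \<in> carrier L \<and> b \<in> carrier L \<and> c \<in> carrier L \<and> (i < m \<longrightarrow> x i = Jel (T 1 a) b c)" for i
      proof (cases "i < m")
        case True
        have "x i \<in> I0set" by (rule PiE_mem[OF x]) (simp add: True)
        thus ?thesis unfolding I0set_def by blast
      qed (use zero_closed in blast)
      then obtain a b c where abc: "\<And>i. a i \<in> carrier L \<and> b i \<in> carrier L \<and> c i \<in> carrier L \<and> (i < m \<longrightarrow> x i = Jel (T 1 (a i)) (b i) (c i))"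
        by metis
      have "x = powel m (\<lambda>i. T 1 (a i)) b c"
      proof
        fix i show "x i = powel m (\<lambda>i. T 1 (a i)) b c i"
          using abc[of i] PiE_arb[OF x, of i] by (cases "i < m") (simp_all add: powel_def)
      qed
      moreover have "(\<lambda>i. T 1 (a i)) \<in> tF m"
        using abc tcong_T_zero[of 1 1] by (auto simp: tF_def vcong_def)
      moreover have "b \<in> F" "c \<in> F" using abc by auto
      ultimately show "x \<in> {powel m p q r | p q r. p \<in> tF m \<and> q \<in> F \<and> r \<in> F}" by blast
    next
      fix x assume "x \<in> {powel m p q r | p q r. p \<in> tF m \<and> q \<in> F \<and> r \<in> F}"
      then obtain p q r where x: "x = powel m p q r" "p \<in> tF m" "q \<in> F" "r \<in> F" by blast
      have "p \<in> F" "vcong m 1 p Z" using x by (auto simp: tF_def)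
      then obtain e where e: "e \<in> F" "\<And>i. i < m \<Longrightarrow> p i = T 1 (e i)" using vcong_zeroE by blast
      have "Jel (p i) (q i) (r i) \<in> I0set" if "i < m" for i
      proof -
        have "e i \<in> carrier L" "q i \<in> carrier L" "r i \<in> carrier L" using e x by auto
        thus ?thesis unfolding I0set_def e(2)[OF that] by blast
      qed
      thus "x \<in> {..<m} \<rightarrow>\<^sub>E I0set" unfolding x(1) powel_def by auto
    qed
  qed
  show "snd ?M = {J1_at (powel m) p q | p q. (p, q) \<in> tF m \<times> tF m}"
  proof -
    have C: "snd ?M = {..<m} \<rightarrow>\<^sub>E snd (I_obj L t)" by (simp add: S_power_def)
    show ?thesis unfolding C
    proof (intro equalityI subsetI)
      fix x assume x: "x \<in> {..<m} \<rightarrow>\<^sub>E snd (I_obj L t)"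
      have "\<exists>a b. a \<in> carrier L \<and> b \<in> carrier L \<and> (i < m \<longrightarrow> x i = Jel (T 3 (T 1 a)) (T 1 (T 1 b \<ominus> T 1 a)) (\<ominus> T 1 b))" for i
      proof (cases "i < m")
        case True
        have "x i \<in> snd (I_obj L t)" by (rule PiE_mem[OF x]) (simp add: True)
        thus ?thesis unfolding I_sub by blast
      qed (use zero_closed in blast)
      then obtain a b where abc: "\<And>i. a i \<in> carrier L \<and> b i \<in> carrier L \<and> 
        (i < m \<longrightarrow> x i = Jel (T 3 (T 1 (a i))) (T 1 (T 1 (b i) \<ominus> T 1 (a i))) (\<ominus> T 1 (b i)))"
        by metis
      have "x = powel m (\<lambda>i. T 3 (T 1 (a i))) (\<lambda>i. T 1 (T 1 (b i) \<ominus> T 1 (a i))) (\<lambda>i. \<ominus> T 1 (b i))"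
      proof
        fix i show "x i = powel m (\<lambda>i. T 3 (T 1 (a i))) (\<lambda>i. T 1 (T 1 (b i) \<ominus> T 1 (a i))) (\<lambda>i. \<ominus> T 1 (b i)) i"
          using abc[of i] PiE_arb[OF x, of i] by (cases "i < m") (simp_all add: powel_def)
      qed
      moreover have "(\<lambda>i. T 1 (a i)) \<in> tF m" "(\<lambda>i. T 1 (b i)) \<in> tF m"
        using abc tcong_T_zero[of 1 1] by (auto simp: tF_def vcong_def)
      ultimately show "x \<in> {J1_at (powel m) p q | p q. (p, q) \<in> tF m \<times> tF m}"
        by (intro CollectI exI[of _ "\<lambda>i. T 1 (a i)"] exI[of _ "\<lambda>i. T 1 (b i)"]) simp
    next
      fix x assume "x \<in> {J1_at (powel m) p q | p q. (p, q) \<in> tF m \<times> tF m}"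
      then obtain p q where x: "x = J1_at (powel m) p q" "p \<in> tF m" "q \<in> tF m" by blast
      have "p \<in> F" "vcong m 1 p Z" "q \<in> F" "vcong m 1 q Z" using x by (auto simp: tF_def)
      then obtain e e' where e: "e \<in> F" "\<And>i. i < m \<Longrightarrow> p i = T 1 (e i)"
        and e': "e' \<in> F" "\<And>i. i < m \<Longrightarrow> q i = T 1 (e' i)" using vcong_zeroE by metis
      have "Jel (T 3 (p i)) (T 1 (q i \<ominus> p i)) (\<ominus> q i) \<in> snd (I_obj L t)" if "i < m" for i
      proof -
        have "e i \<in> carrier L" "e' i \<in> carrier L" using e e' by auto
        thus ?thesis unfolding I_sub e(2)[OF that] e'(2)[OF that] by blast
      qed
      thus "x \<in> {..<m} \<rightarrow>\<^sub>E snd (I_obj L t)" unfolding x(1) powel_def by auto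
    qed
  qed
  fix p q r p' q' r' :: "nat \<Rightarrow> 'a" and c assume c: "p \<in> F" "q \<in> F" "r \<in> F"
  { assume c': "p' \<in> F" "q' \<in> F" "r' \<in> F"
    show "powel m p q r \<oplus>\<^bsub>fst ?M\<^esub> powel m p' q' r' = powel m (\<lambda>i. p i \<oplus> p' i) (\<lambda>i. q i \<oplus> q' i) (\<lambda>i. r i \<oplus> r' i)"
      using c c' by (auto simp: S_power_def module_power_def I_obj_def powel_def Jel_add Pi_def intro!: restrict_ext)
    show "powel m p q r = powel m p' q' r' \<longleftrightarrow> vcong m 7 p p' \<and> vcong m 4 q q' \<and> vcong m 2 r r'"
    proof -
      have "powel m p q r = powel m p' q' r' \<longleftrightarrow> (\<forall>i<m. Jel (p i) (q i) (r i) = Jel (p' i) (q' i) (r' i))"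
      proof
        assume h: "powel m p q r = powel m p' q' r'"
        show "\<forall>i<m. Jel (p i) (q i) (r i) = Jel (p' i) (q' i) (r' i)"
        proof (intro allI impI)
          fix i assume "i < m"
          thus "Jel (p i) (q i) (r i) = Jel (p' i) (q' i) (r' i)"
            using fun_cong[OF h, of i] by (simp add: powel_def)
        qed
      qed (auto simp: powel_def intro!: restrict_ext)
      also have "\<dots> \<longleftrightarrow> vcong m 7 p p' \<and> vcong m 4 q q' \<and> vcong m 2 r r'"
        using c c' unfolding vcong_def by (auto simp: Jel_eq Pi_def)
      finally show ?thesis .
    qed }
  assume cc: "c \<in> carrier L"
  show "c \<odot>\<^bsub>fst ?M\<^esub> powel m p q r = powel m (\<lambda>i. c \<otimes> p i) (\<lambda>i. c \<otimes> q i) (\<lambda>i. c \<otimes> r i)"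
    using c cc by (auto simp: S_power_def module_power_def I_obj_def powel_def Jel_smult Pi_def intro!: restrict_ext)
next
  show "\<zero>\<^bsub>fst (S_power (I_obj L t) m)\<^esub> = powel m Z Z Z"
    by (auto simp: S_power_def module_power_def I_obj_def powel_def Jel_zero)
qed

end

section \<open>Finite generation\<close>

text \<open>Induction along unit vectors; it replaces sums over the coordinates.\<close>
lemma (in uniserial7) coordinate_induct [consumes 1, case_names zero add smult unit cong]:
  assumes p: "p \<in> F"
    and zero: "P Z"
    and add: "\<And>p q. p \<in> F \<Longrightarrow> q \<in> F \<Longrightarrow> P p \<Longrightarrow> P q \<Longrightarrow> P (\<lambda>i. p i \<oplus> q i)"
    and smult: "\<And>p c. p \<in> F \<Longrightarrow> c \<in> carrier L \<Longrightarrow> P p \<Longrightarrow> P (\<lambda>i. c \<otimes> p i)"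
    and unit: "\<And>i. i < m \<Longrightarrow> P (\<lambda>j. if j = i then \<one> else \<zero>)"
    and cong: "\<And>p q. p \<in> F \<Longrightarrow> q \<in> F \<Longrightarrow> P p \<Longrightarrow> (\<And>i. i < m \<Longrightarrow> q i = p i) \<Longrightarrow> P q"
  shows "P p"
proof -
  have "p \<in> F \<Longrightarrow> (\<And>i. l \<le> i \<Longrightarrow> i < m \<Longrightarrow> p i = \<zero>) \<Longrightarrow> l \<le> m \<Longrightarrow> P p" for l p
  proof (induction l arbitrary: p)
    case 0
    have "Z \<in> F" by auto
    thus ?case using cong[OF _ 0(1) zero] 0(2) by simp
  next
    case (Suc l)
    let ?q = "p(l := \<zero>)" and ?e = "\<lambda>j. if j = l then \<one> else \<zero>"
    have q: "?q \<in> F" using Suc(2) by auto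
    have pl: "p l \<in> carrier L" using Suc(2) by auto
    have e: "?e \<in> F" "(\<lambda>i. p l \<otimes> ?e i) \<in> F" using pl by auto
    have "P ?q"
    proof (rule Suc.IH[OF q])
      show "?q i = \<zero>" if "l \<le> i" "i < m" for i using Suc(3)[of i] that by auto
    qed (use Suc in simp)
    moreover have "P (\<lambda>i. p l \<otimes> ?e i)" using Suc(4) by (intro smult e pl unit) simp
    ultimately have "P (\<lambda>i. ?q i \<oplus> p l \<otimes> ?e i)" by (intro add q e)
    moreover have "(\<lambda>i. ?q i \<oplus> p l \<otimes> ?e i) = p" using Suc(2) pl by (auto simp: Pi_def)
    ultimately show ?case by simp
  qed
  from this[of p m] p show ?thesis by auto
qed

text \<open>The generation hypothesis about \<open>U\<close> is stated through closed subsets \<open>V\<close>, so that it can be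
  applied to the set of those \<open>p\<close> for which \<open>x p\<close> lies in a given submodule.\<close>
lemma (in framed) finitely_generated:
  assumes B: "finite B" "B \<subseteq> U"
    and gen: "\<And>V. \<lbrakk>B \<subseteq> V; V \<subseteq> U; \<And>p q. p \<in> V \<Longrightarrow> q \<in> V \<Longrightarrow> (\<lambda>i. p i \<oplus> q i) \<in> V;
        \<And>p c. p \<in> V \<Longrightarrow> c \<in> carrier L \<Longrightarrow> (\<lambda>i. c \<otimes> p i) \<in> V;
        \<And>p q. p \<in> V \<Longrightarrow> q \<in> F \<Longrightarrow> vcong m 1 q p \<Longrightarrow> q \<in> V; Z \<in> V\<rbrakk> \<Longrightarrow> U \<subseteq> V"
  shows "finitely_generated L (fst M)"
proof -
  interpret mod: module L "fst M" by (rule is_module)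
  
  define e where "e i = (\<lambda>j::nat. if j = i then \<one> else \<zero>)" for i :: nat
  have eF: "e i \<in> F" for i by (auto simp: e_def)
  have TeU: "(\<lambda>j. T 1 (e i j)) \<in> U" for i using U_T[OF eF, of 1] by simp
  define S where "S = (\<lambda>i. \<kappa> (\<lambda>j. T 1 (e i j)) Z Z) ` {..<m} \<union> (\<lambda>i. \<kappa> Z (e i) Z) ` {..<m}
    \<union> (\<lambda>i. \<kappa> Z Z (e i)) ` {..<m} \<union> (\<lambda>b. \<kappa> b Z Z) ` B"
  have fin: "finite S" using B by (simp add: S_def)
  have Sc: "S \<subseteq> carrier (fst M)"
    using B TeU eF U_zero by (auto simp: S_def intro!: carrierI simp del: One_nat_def)
  have "x \<in> N" if N: "submodule N L (fst M)" and SN: "S \<subseteq> N" and x: "x \<in> carrier (fst M)" for N x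
  proof -
    note NE = mod.submoduleE[OF N]
    have z: "\<kappa> Z Z Z \<in> N"
      using subgroup.one_closed[OF submodule.axioms(1)[OF N]] by (simp add: \<kappa>_zero)
    have Y: "\<kappa> Z q Z \<in> N" if "q \<in> F" for q
      using that
    proof (induction rule: coordinate_induct[where m = m])
      case (add p q) thus ?case using NE(5)[OF add(3,4)] by (simp add: \<kappa>_add)
    next
      case (smult p c) thus ?case using NE(4)[OF smult(2,3)] by (simp add: \<kappa>_smult)
    next
      case (unit i) thus ?case using SN by (auto simp: S_def e_def)
    next
      case (cong p q)
      have "\<kappa> Z q Z = \<kappa> Z p Z" using cong by (subst \<kappa>_eq) (auto simp: vcong_def Pi_def)
      thus ?case using cong by simp
    qed (rule z)
    have Zr: "\<kappa> Z Z q \<in> N" if "q \<in> F" for q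
      using that
    proof (induction rule: coordinate_induct[where m = m])
      case (add p q) thus ?case using NE(5)[OF add(3,4)] by (simp add: \<kappa>_add)
    next
      case (smult p c) thus ?case using NE(4)[OF smult(2,3)] by (simp add: \<kappa>_smult)
    next
      case (unit i) thus ?case using SN by (auto simp: S_def e_def)
    next
      case (cong p q)
      have "\<kappa> Z Z q = \<kappa> Z Z p" using cong by (subst \<kappa>_eq) (auto simp: vcong_def Pi_def)
      thus ?case using cong by simp
    qed (rule z)
    have X: "\<kappa> (\<lambda>i. T 1 (q i)) Z Z \<in> N" if "q \<in> F" for q
      using that
    proof (induction rule: coordinate_induct[where m = m])
      case zero show ?case using z by simp
    next
      case (add p q)
      have "\<kappa> (\<lambda>i. T 1 (p i \<oplus> q i)) Z Z = \<kappa> (\<lambda>i. T 1 (p i)) Z Z \<oplus>\<^bsub>fst M\<^esub> \<kappa> (\<lambda>i. T 1 (q i)) Z Z"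
        using add by (subst \<kappa>_add) (auto simp: \<kappa>_eq vcong_def Pi_def r_distr)
      thus ?case using NE(5)[OF add(3,4)] by simp
    next
      case (smult p c)
      have "\<kappa> (\<lambda>i. T 1 (c \<otimes> p i)) Z Z = c \<odot>\<^bsub>fst M\<^esub> \<kappa> (\<lambda>i. T 1 (p i)) Z Z"
        using smult by (subst \<kappa>_smult) (auto simp: \<kappa>_eq vcong_def Pi_def m_lcomm)
      thus ?case using NE(4)[OF smult(2,3)] by simp
    next
      case (unit i) thus ?case using SN by (auto simp: S_def e_def)
    next
      case (cong p q)
      have "\<kappa> (\<lambda>i. T 1 (q i)) Z Z = \<kappa> (\<lambda>i. T 1 (p i)) Z Z" using cong by (subst \<kappa>_eq) (auto simp: vcong_def Pi_def)
      thus ?case using cong by simp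
    qed
    have "U \<subseteq> {p \<in> U. \<kappa> p Z Z \<in> N}" (is "_ \<subseteq> ?V")
    proof (rule gen)
      show "B \<subseteq> ?V" using B SN by (auto simp: S_def)
      show "?V \<subseteq> U" by blast
      show "Z \<in> ?V" using z U_zero by blast
      show "(\<lambda>i. p i \<oplus> q i) \<in> ?V" if "p \<in> ?V" "q \<in> ?V" for p q
      proof -
        have pq: "p \<in> U" "p \<in> F" "q \<in> U" "q \<in> F" using that U_F by auto
        have "\<kappa> p Z Z \<oplus>\<^bsub>fst M\<^esub> \<kappa> q Z Z \<in> N" using that NE(5) by blast
        thus ?thesis using pq by (simp add: \<kappa>_add U_add)
      qed
      show "(\<lambda>i. c \<otimes> p i) \<in> ?V" if "p \<in> ?V" "c \<in> carrier L" for p c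
      proof -
        have pq: "p \<in> U" "p \<in> F" using that U_F by auto
        have "c \<odot>\<^bsub>fst M\<^esub> \<kappa> p Z Z \<in> N" using that NE(4) by blast
        thus ?thesis using pq that(2) by (simp add: \<kappa>_smult U_smult)
      qed
      show "q \<in> ?V" if p: "p \<in> ?V" and q: "q \<in> F" "vcong m 1 q p" for p q
      proof -
        have pU: "p \<in> U" "p \<in> F" using p U_F by auto
        have qU: "q \<in> U" using U_cong[OF pU(1) q] .
        have "vcong m 1 (\<lambda>i. q i \<ominus> p i) (\<lambda>i. p i \<ominus> p i)" using q pU by (intro vcong_diff) auto
        moreover have "(\<lambda>i. p i \<ominus> p i) = Z" using pU by (auto simp: a_minus_def r_neg Pi_def)
        ultimately have "vcong m 1 (\<lambda>i. q i \<ominus> p i) Z" by simp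
        moreover have "(\<lambda>i. q i \<ominus> p i) \<in> F" using q pU by (auto simp: Pi_def)
        ultimately obtain d where d: "d \<in> F" "\<And>i. i < m \<Longrightarrow> q i \<ominus> p i = T 1 (d i)"
          using vcong_zeroE by blast
        have qi: "q i = p i \<oplus> T 1 (d i)" if "i < m" for i
        proof -
          have c: "q i \<in> carrier L" "p i \<in> carrier L" using q pU by auto
          have "p i \<oplus> (q i \<ominus> p i) = q i" using c by (subst a_comm) (simp_all add: a_minus_def a_assoc l_neg)
          thus ?thesis using d(2)[OF that] by simp
        qed
        have "\<kappa> q Z Z = \<kappa> p Z Z \<oplus>\<^bsub>fst M\<^esub> \<kappa> (\<lambda>i. T 1 (d i)) Z Z"
          using q pU d(1) qi by (subst \<kappa>_add) (auto simp: \<kappa>_eq vcong_def Pi_def)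
        thus ?thesis using NE(5) X[OF d(1)] p qU by simp
      qed
    qed
    hence P: "\<kappa> p Z Z \<in> N" if "p \<in> U" for p using that by blast
    obtain p q r where pqr: "p \<in> U" "p \<in> F" "q \<in> F" "r \<in> F" "x = \<kappa> p q r" by (rule carrierE[OF x])
    show ?thesis unfolding pqr(5) \<kappa>_split[OF pqr(2-4)] by (intro NE(5) P Y Zr pqr)
  qed
  moreover have "submodule (carrier (fst M)) L (fst M)" by (rule mod.carrier_is_submodule)
  ultimately have "module_span L (fst M) S = carrier (fst M)"
    using Sc by (intro module_spanI) auto
  thus ?thesis unfolding finitely_generated_def using fin Sc by blast
qed

section \<open>Coordinates over a finite-dimensional algebra\<close>

text \<open>An algebra over the residue field, viewed as an algebra over the ring on which \<open>t\<close> acts as zero.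
  This avoids choosing representatives of residue classes.\<close>
locale residue_action = uniserial7 L t + R: ring R for L :: "('a, 'm) ring_scheme" (structure) and t
    and R :: "('r, 'n) ring_scheme" +
  fixes sm :: "'a \<Rightarrow> 'r \<Rightarrow> 'r" (infixr "\<bullet>" 75)
  assumes sm_closed [simp, intro]: "\<lbrakk>a \<in> carrier L; x \<in> carrier R\<rbrakk> \<Longrightarrow> a \<bullet> x \<in> carrier R"
    and sm_l_distr: "\<lbrakk>a \<in> carrier L; b \<in> carrier L; x \<in> carrier R\<rbrakk> \<Longrightarrow> (a \<oplus> b) \<bullet> x = a \<bullet> x \<oplus>\<^bsub>R\<^esub> b \<bullet> x"
    and sm_r_distr: "\<lbrakk>a \<in> carrier L; x \<in> carrier R; y \<in> carrier R\<rbrakk> \<Longrightarrow> a \<bullet> (x \<oplus>\<^bsub>R\<^esub> y) = a \<bullet> x \<oplus>\<^bsub>R\<^esub> a \<bullet> y"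
    and sm_assoc: "\<lbrakk>a \<in> carrier L; b \<in> carrier L; x \<in> carrier R\<rbrakk> \<Longrightarrow> (a \<otimes> b) \<bullet> x = a \<bullet> b \<bullet> x"
    and sm_one: "x \<in> carrier R \<Longrightarrow> \<one> \<bullet> x = x"
    and sm_mult_l: "\<lbrakk>a \<in> carrier L; x \<in> carrier R; y \<in> carrier R\<rbrakk> \<Longrightarrow> (a \<bullet> x) \<otimes>\<^bsub>R\<^esub> y = a \<bullet> (x \<otimes>\<^bsub>R\<^esub> y)"
    and sm_mult_r: "\<lbrakk>a \<in> carrier L; x \<in> carrier R; y \<in> carrier R\<rbrakk> \<Longrightarrow> x \<otimes>\<^bsub>R\<^esub> (a \<bullet> y) = a \<bullet> (x \<otimes>\<^bsub>R\<^esub> y)"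
    and sm_rad: "\<lbrakk>a \<in> carrier L; x \<in> carrier R\<rbrakk> \<Longrightarrow> (t \<otimes> a) \<bullet> x = \<zero>\<^bsub>R\<^esub>"
begin

lemma sm_zero: "x \<in> carrier R \<Longrightarrow> \<zero> \<bullet> x = \<zero>\<^bsub>R\<^esub>" using sm_rad[of \<zero> x] by simp

lemma sm_r_zero: assumes "a \<in> carrier L" shows "a \<bullet> \<zero>\<^bsub>R\<^esub> = \<zero>\<^bsub>R\<^esub>"
proof -
  have "a \<bullet> \<zero>\<^bsub>R\<^esub> = a \<bullet> (\<zero> \<bullet> \<zero>\<^bsub>R\<^esub>)" by (simp add: sm_zero)
  also have "\<dots> = (a \<otimes> \<zero>) \<bullet> \<zero>\<^bsub>R\<^esub>" using assms by (subst sm_assoc) auto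
  also have "\<dots> = \<zero>\<^bsub>R\<^esub>" using assms by (simp add: sm_zero)
  finally show ?thesis .
qed

lemma sm_tcong: assumes "tcong 1 a b" "x \<in> carrier R" shows "a \<bullet> x = b \<bullet> x"
proof -
  obtain e where e: "a \<in> carrier L" "b \<in> carrier L" "e \<in> carrier L" "a = b \<oplus> T 1 e"
    using assms unfolding tcong_def by blast
  have "a \<bullet> x = b \<bullet> x \<oplus>\<^bsub>R\<^esub> (t \<otimes> e) \<bullet> x" unfolding e(4) using e assms by (simp add: sm_l_distr)
  thus ?thesis using e assms sm_rad by simp
qed

lemma sm_finsum:
  assumes "finite A" "f \<in> A \<rightarrow> carrier R" "a \<in> carrier L"
  shows "a \<bullet> (\<Oplus>\<^bsub>R\<^esub>i\<in>A. f i) = (\<Oplus>\<^bsub>R\<^esub>i\<in>A. a \<bullet> f i)"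
  using assms(1,2)
proof (induction A rule: finite_induct)
  case empty thus ?case using assms(3) by (simp add: sm_r_zero)
next
  case (insert x A)
  have "f \<in> A \<rightarrow> carrier R" "f x \<in> carrier R" "(\<lambda>i. a \<bullet> f i) \<in> A \<rightarrow> carrier R" using insert assms(3) by auto
  thus ?case using insert assms(3) by (simp add: sm_r_distr)
qed

end

text \<open>A basis \<open>s\<close> of the algebra over the residue field, with coefficients taken in the ring; thus
  relations have coefficients divisible by \<open>t\<close> instead of zero.\<close>
locale residue_algebra = residue_action L t R sm for L :: "('a, 'm) ring_scheme" (structure) and t
    and R :: "('r, 'n) ring_scheme" and sm :: "'a \<Rightarrow> 'r \<Rightarrow> 'r" (infixr "\<bullet>" 75) +
  fixes s :: "nat \<Rightarrow> 'r" and d :: nat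
  assumes s_closed: "i < d \<Longrightarrow> s i \<in> carrier R"
    and s_span: "x \<in> carrier R \<Longrightarrow> \<exists>c\<in>F. x = (\<Oplus>\<^bsub>R\<^esub>i\<in>{..<d}. c i \<bullet> s i)"
    and s_indep: "\<lbrakk>c \<in> F; (\<Oplus>\<^bsub>R\<^esub>i\<in>{..<d}. c i \<bullet> s i) = \<zero>\<^bsub>R\<^esub>\<rbrakk> \<Longrightarrow> vcong d 1 c Z"
begin

definition lin :: "(nat \<Rightarrow> 'a) \<Rightarrow> 'r" where "lin c = (\<Oplus>\<^bsub>R\<^esub>i\<in>{..<d}. c i \<bullet> s i)"

lemma term_closed: "c \<in> F \<Longrightarrow> i < d \<Longrightarrow> c i \<bullet> s i \<in> carrier R"
  using s_closed by auto

lemma lin_closed [simp, intro]: "c \<in> F \<Longrightarrow> lin c \<in> carrier R"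
  unfolding lin_def by (rule R.finsum_closed) (auto intro: term_closed)

lemma lin_cong: assumes "c \<in> F" "c' \<in> F" "vcong d 1 c c'" shows "lin c = lin c'"
  unfolding lin_def using assms
  by (intro R.finsum_cong') (auto simp: vcong_def intro: term_closed sm_tcong s_closed)

lemma lin_add: assumes "c \<in> F" "c' \<in> F" shows "lin (\<lambda>i. c i \<oplus> c' i) = lin c \<oplus>\<^bsub>R\<^esub> lin c'"
proof -
  have "lin (\<lambda>i. c i \<oplus> c' i) = (\<Oplus>\<^bsub>R\<^esub>i\<in>{..<d}. c i \<bullet> s i \<oplus>\<^bsub>R\<^esub> c' i \<bullet> s i)"
    unfolding lin_def using assms
    by (intro R.finsum_cong') (auto intro: term_closed s_closed sm_l_distr)
  also have "\<dots> = lin c \<oplus>\<^bsub>R\<^esub> lin c'"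
    unfolding lin_def using assms by (intro R.finsum_addf) (auto intro: term_closed)
  finally show ?thesis .
qed

lemma lin_smult: assumes "c \<in> F" "a \<in> carrier L" shows "lin (\<lambda>i. a \<otimes> c i) = a \<bullet> lin c"
proof -
  have "a \<bullet> lin c = (\<Oplus>\<^bsub>R\<^esub>i\<in>{..<d}. a \<bullet> c i \<bullet> s i)"
    unfolding lin_def using assms by (intro sm_finsum) (auto intro: term_closed)
  also have "\<dots> = lin (\<lambda>i. a \<otimes> c i)"
    unfolding lin_def using assms
    by (intro R.finsum_cong') (auto intro: s_closed sm_assoc[symmetric])
  finally show ?thesis by simp
qed

lemma lin_zero: "lin Z = \<zero>\<^bsub>R\<^esub>"
  using lin_smult[of "\<lambda>i. \<zero>" \<zero>] by (simp add: sm_zero lin_closed Pi_def)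

lemma lin_unit: assumes "k < d" shows "lin (\<lambda>j. if j = k then \<one> else \<zero>) = s k"
proof -
  have "lin (\<lambda>j. if j = k then \<one> else \<zero>) = (\<Oplus>\<^bsub>R\<^esub>j\<in>{..<d}. if k = j then s j else \<zero>\<^bsub>R\<^esub>)"
    unfolding lin_def using s_closed by (intro R.finsum_cong') (auto simp: sm_one sm_zero)
  also have "\<dots> = s k" using assms s_closed by (intro R.finsum_singleton) auto
  finally show ?thesis .
qed

lemma lin_inj: assumes "c \<in> F" "c' \<in> F" "lin c = lin c'" shows "vcong d 1 c c'"
proof -
  have n: "(\<lambda>i. (\<ominus> \<one>) \<otimes> c' i) \<in> F" using assms by auto
  have "\<zero> \<bullet> lin c' = lin (\<lambda>i. c' i \<oplus> (\<ominus> \<one>) \<otimes> c' i)"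
    using assms by (subst lin_smult[symmetric]) (auto simp: l_minus r_neg Pi_def)
  also have "\<dots> = lin (\<lambda>i. c i \<oplus> (\<ominus> \<one>) \<otimes> c' i)" using assms n by (simp add: lin_add)
  finally have "lin (\<lambda>i. c i \<oplus> (\<ominus> \<one>) \<otimes> c' i) = \<zero>\<^bsub>R\<^esub>" using assms by (simp add: sm_zero)
  hence "vcong d 1 (\<lambda>i. c i \<oplus> (\<ominus> \<one>) \<otimes> c' i) Z"
    using assms n by (intro s_indep) (auto simp: lin_def Pi_def)
  hence "vcong d 1 (\<lambda>i. (c i \<oplus> (\<ominus> \<one>) \<otimes> c' i) \<oplus> c' i) (\<lambda>i. \<zero> \<oplus> c' i)"
    using assms by (intro vcong_add) auto
  thus ?thesis using assms by (simp add: l_minus a_assoc l_neg Pi_def)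
qed

lemma lin_surj: assumes "x \<in> carrier R" obtains c where "c \<in> F" "lin c = x"
  using s_span[OF assms] unfolding lin_def by metis

text \<open>Two more blocks than basis elements: one of the \<open>g_j\<close> has to be the unit of the algebra, and
  there have to be at least two blocks, also for the zero algebra, for the components of \<open>W\<close> to
  span \<open>V\<close>.\<close>
definition blocks :: nat where "blocks = d + 2"
definition rank :: nat where "rank = d * blocks"

text \<open>The j-th component of the residue vector in \<open>V = R^N\<close>, decoded from the j-th block of
  coordinates by means of the basis \<open>s\<close>.\<close>
definition \<rho> :: "nat \<Rightarrow> (nat \<Rightarrow> 'a) \<Rightarrow> 'r" where "\<rho> j p = lin (\<lambda>i. p (j * d + i))"

lemma shift_F: "p \<in> F \<Longrightarrow> (\<lambda>i. p (j * d + i)) \<in> F" by auto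

lemma index: "j < blocks \<Longrightarrow> i < d \<Longrightarrow> j * d + i < rank"
proof -
  assume "j < blocks" "i < d"
  hence "j * d + i < Suc j * d" by simp
  also have "\<dots> \<le> blocks * d" using \<open>j < blocks\<close> by (intro mult_le_mono1) simp
  finally show ?thesis by (simp add: rank_def mult.commute)
qed

lemma \<rho>_closed [simp, intro]: "p \<in> F \<Longrightarrow> \<rho> j p \<in> carrier R"
  unfolding \<rho>_def by (intro lin_closed shift_F)
lemma \<rho>_add: "p \<in> F \<Longrightarrow> q \<in> F \<Longrightarrow> \<rho> j (\<lambda>i. p i \<oplus> q i) = \<rho> j p \<oplus>\<^bsub>R\<^esub> \<rho> j q"
  unfolding \<rho>_def by (intro lin_add shift_F)
lemma \<rho>_smult: "p \<in> F \<Longrightarrow> a \<in> carrier L \<Longrightarrow> \<rho> j (\<lambda>i. a \<otimes> p i) = a \<bullet> \<rho> j p"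
  unfolding \<rho>_def by (rule lin_smult[OF shift_F])
lemma \<rho>_zero: "\<rho> j Z = \<zero>\<^bsub>R\<^esub>" unfolding \<rho>_def by (rule lin_zero)
lemma \<rho>_cong: "p \<in> F \<Longrightarrow> q \<in> F \<Longrightarrow> vcong rank 1 p q \<Longrightarrow> j < blocks \<Longrightarrow> \<rho> j p = \<rho> j q"
  unfolding \<rho>_def by (intro lin_cong shift_F) (auto simp: vcong_def index)

lemma \<rho>_inj: assumes "p \<in> F" "q \<in> F" "\<And>j. j < blocks \<Longrightarrow> \<rho> j p = \<rho> j q" shows "vcong rank 1 p q"
  unfolding vcong_def
proof (intro allI impI)
  fix l assume l: "l < rank"
  hence "d > 0" "l div d < blocks" by (auto simp: rank_def less_mult_imp_div_less mult.commute intro: gr0I)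
  have "vcong d 1 (\<lambda>i. p (l div d * d + i)) (\<lambda>i. q (l div d * d + i))"
    using assms(3)[OF \<open>l div d < blocks\<close>] unfolding \<rho>_def by (intro lin_inj shift_F assms(1,2))
  from this[unfolded vcong_def, rule_format, of "l mod d"]
  have "tcong 1 (p (l div d * d + l mod d)) (q (l div d * d + l mod d))"
    using \<open>d > 0\<close> by simp
  thus "tcong 1 (p l) (q l)" by simp
qed

lemma \<rho>_surj:
  assumes "\<And>j. v j \<in> carrier R" obtains p where "p \<in> F" "\<And>j. \<rho> j p = v j"
proof -
  have "\<forall>j. \<exists>c. c \<in> F \<and> lin c = v j" using assms lin_surj by metis
  then obtain c where c: "\<And>j. c j \<in> F" "\<And>j. lin (c j) = v j" by metis
  define p where "p l = c (l div d) (l mod d)" for l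
  have p: "p \<in> F" using funcset_mem[OF c(1)] by (auto simp: p_def)
  have "\<rho> j p = v j" for j
  proof -
    have "\<rho> j p = lin (c j)" unfolding \<rho>_def
      by (rule lin_cong[OF shift_F[OF p] c(1)]) (use c(1) in \<open>auto simp: vcong_def p_def Pi_def\<close>)
    thus ?thesis by (simp add: c(2))
  qed
  thus ?thesis using that p by blast
qed

definition gen :: "nat \<Rightarrow> 'r" where "gen j = (if j < d then s j else \<one>\<^bsub>R\<^esub>)"

lemma gen_closed [simp, intro]: "gen j \<in> carrier R" using s_closed by (simp add: gen_def)

text \<open>The vectors \<open>(x g_0, ..., x g_(N-1))\<close>: preserving them forces a diagonal map to commute with the
  right multiplications by all \<open>g_j\<close>.\<close>
definition graphU where "graphU = {p \<in> F. \<exists>x\<in>carrier R. \<forall>j<blocks. \<rho> j p = x \<otimes>\<^bsub>R\<^esub> gen j}"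

text \<open>The graph of the shift of \<open>R^(N-1)\<close> inside \<open>R^N\<close>. For \<open>R = k\<close> it is the preprojective
  Kronecker module of dimension vector \<open>(N-1, N)\<close>, whose only endomorphisms are scalars.\<close>
definition shiftW where "shiftW = {(p, q). p \<in> F \<and> q \<in> F \<and> \<rho> (blocks - 1) p = \<zero>\<^bsub>R\<^esub> \<and> \<rho> 0 q = \<zero>\<^bsub>R\<^esub> \<and>
  (\<forall>j<blocks - 1. \<rho> (Suc j) q = \<rho> j p)}"

lemma graphU_shiftW: "subspace_pair L t rank graphU shiftW"
proof
  have blocks: "blocks - 1 < blocks" "0 < blocks" "\<And>j. j < blocks - 1 \<Longrightarrow> Suc j < blocks \<and> j < blocks" by (auto simp: blocks_def)
  show "graphU \<subseteq> F" by (auto simp: graphU_def)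
  show "shiftW \<subseteq> F \<times> F" by (auto simp: shiftW_def)
  show "Z \<in> graphU" by (auto simp: graphU_def \<rho>_zero intro!: bexI[of _ "\<zero>\<^bsub>R\<^esub>"])
  show "(\<lambda>i. \<zero>, \<lambda>i. \<zero>) \<in> shiftW" by (auto simp: shiftW_def \<rho>_zero)
  fix p q p' q' :: "nat \<Rightarrow> 'a" and c
  show "(\<lambda>i. p i \<oplus> q i) \<in> graphU" if pq: "p \<in> graphU" "q \<in> graphU"
  proof -
    obtain x y where x: "x \<in> carrier R" "\<And>j. j < blocks \<Longrightarrow> \<rho> j p = x \<otimes>\<^bsub>R\<^esub> gen j"
      and y: "y \<in> carrier R" "\<And>j. j < blocks \<Longrightarrow> \<rho> j q = y \<otimes>\<^bsub>R\<^esub> gen j" using pq unfolding graphU_def by blast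
    have F: "p \<in> F" "q \<in> F" using pq by (auto simp: graphU_def)
    have "\<forall>j<blocks. \<rho> j (\<lambda>i. p i \<oplus> q i) = (x \<oplus>\<^bsub>R\<^esub> y) \<otimes>\<^bsub>R\<^esub> gen j" using x y F by (simp add: \<rho>_add R.l_distr)
    thus ?thesis unfolding graphU_def using F x(1) y(1) by auto
  qed
  show "(\<lambda>i. c \<otimes> p i) \<in> graphU" if pq: "p \<in> graphU" "c \<in> carrier L"
  proof -
    obtain x where x: "x \<in> carrier R" "\<And>j. j < blocks \<Longrightarrow> \<rho> j p = x \<otimes>\<^bsub>R\<^esub> gen j" using pq unfolding graphU_def by blast
    have F: "p \<in> F" using pq by (auto simp: graphU_def)
    have "\<forall>j<blocks. \<rho> j (\<lambda>i. c \<otimes> p i) = (c \<bullet> x) \<otimes>\<^bsub>R\<^esub> gen j" using x F pq by (simp add: \<rho>_smult sm_mult_l)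
    thus ?thesis unfolding graphU_def using F x(1) pq by auto
  qed
  show "p' \<in> graphU" if pq: "p \<in> graphU" "p' \<in> F" "vcong rank 1 p' p"
  proof -
    have "p \<in> F" using pq by (auto simp: graphU_def)
    hence "\<rho> j p' = \<rho> j p" if "j < blocks" for j using \<rho>_cong that pq by blast
    thus ?thesis using pq unfolding graphU_def by auto
  qed
  assume pq: "(p, q) \<in> shiftW"
  hence F: "p \<in> F" "q \<in> F" by (auto simp: shiftW_def)
  show "(\<lambda>i. p i \<oplus> p' i, \<lambda>i. q i \<oplus> q' i) \<in> shiftW" if pq': "(p', q') \<in> shiftW"
  proof -
    have "p' \<in> F" "q' \<in> F" using pq' by (auto simp: shiftW_def)
    moreover from this F have "(\<lambda>i. p i \<oplus> p' i) \<in> F" "(\<lambda>i. q i \<oplus> q' i) \<in> F" by auto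
    ultimately show ?thesis using F pq pq' by (simp add: shiftW_def \<rho>_add)
  qed
  show "(\<lambda>i. c \<otimes> p i, \<lambda>i. c \<otimes> q i) \<in> shiftW" if c: "c \<in> carrier L"
  proof -
    have "(\<lambda>i. c \<otimes> p i) \<in> F" "(\<lambda>i. c \<otimes> q i) \<in> F" using F c by auto
    thus ?thesis using F pq c by (simp add: shiftW_def \<rho>_smult sm_r_zero)
  qed
  show "(p', q') \<in> shiftW" if F': "p' \<in> F" "q' \<in> F" and v: "vcong rank 1 p' p" "vcong rank 1 q' q"
  proof -
    have "\<rho> j p' = \<rho> j p" "\<rho> j q' = \<rho> j q" if "j < blocks" for j using \<rho>_cong that F F' v by blast+
    thus ?thesis using pq F' blocks unfolding shiftW_def by simp
  qed
qed

lemma graphU_generated: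
  obtains B where "finite B" "B \<subseteq> graphU"
    "\<And>V. \<lbrakk>B \<subseteq> V; V \<subseteq> graphU; \<And>p q. p \<in> V \<Longrightarrow> q \<in> V \<Longrightarrow> (\<lambda>i. p i \<oplus> q i) \<in> V;
        \<And>p c. p \<in> V \<Longrightarrow> c \<in> carrier L \<Longrightarrow> (\<lambda>i. c \<otimes> p i) \<in> V;
        \<And>p q. p \<in> V \<Longrightarrow> q \<in> F \<Longrightarrow> vcong rank 1 q p \<Longrightarrow> q \<in> V; Z \<in> V\<rbrakk> \<Longrightarrow> graphU \<subseteq> V"
proof -
  have "\<exists>u. u \<in> F \<and> (\<forall>j. \<rho> j u = x \<otimes>\<^bsub>R\<^esub> gen j)" if "x \<in> carrier R" for x
    using \<rho>_surj[of "\<lambda>j. x \<otimes>\<^bsub>R\<^esub> gen j"] that by (metis R.m_closed gen_closed)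
  then obtain u where u: "\<And>x. x \<in> carrier R \<Longrightarrow> u x \<in> F \<and> (\<forall>j. \<rho> j (u x) = x \<otimes>\<^bsub>R\<^esub> gen j)" by metis
  let ?B = "(\<lambda>i. u (s i)) ` {..<d}"
  have "?B \<subseteq> graphU" using u s_closed by (auto simp: graphU_def)
  moreover have "graphU \<subseteq> V" if B: "?B \<subseteq> V" and V: "V \<subseteq> graphU" and Vadd: "\<And>p q. p \<in> V \<Longrightarrow> q \<in> V \<Longrightarrow> (\<lambda>i. p i \<oplus> q i) \<in> V"
        and sm: "\<And>p c. p \<in> V \<Longrightarrow> c \<in> carrier L \<Longrightarrow> (\<lambda>i. c \<otimes> p i) \<in> V"
        and Vcong: "\<And>p q. p \<in> V \<Longrightarrow> q \<in> F \<Longrightarrow> vcong rank 1 q p \<Longrightarrow> q \<in> V" and V0: "Z \<in> V" for V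
  proof -
    have VF: "p \<in> V \<Longrightarrow> p \<in> F" for p using V by (auto simp: graphU_def)
    have ex: "\<exists>p\<in>V. \<forall>j. j < blocks \<longrightarrow> \<rho> j p = lin c \<otimes>\<^bsub>R\<^esub> gen j" if "c \<in> F" for c
      using that
    proof (induction rule: coordinate_induct[where m = d])
      case zero show ?case by (rule bexI[OF _ V0]) (simp add: \<rho>_zero lin_zero)
    next
      case (add c c')
      then obtain p p' where p: "p \<in> V" "\<forall>j. j < blocks \<longrightarrow> \<rho> j p = lin c \<otimes>\<^bsub>R\<^esub> gen j"
        "p' \<in> V" "\<forall>j. j < blocks \<longrightarrow> \<rho> j p' = lin c' \<otimes>\<^bsub>R\<^esub> gen j" by blast
      show ?case
        by (rule bexI[OF _ Vadd[OF p(1,3)]]) (use p VF add in \<open>simp add: \<rho>_add lin_add R.l_distr\<close>)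
    next
      case (smult c a)
      then obtain p where p: "p \<in> V" "\<forall>j. j < blocks \<longrightarrow> \<rho> j p = lin c \<otimes>\<^bsub>R\<^esub> gen j" by blast
      show ?case
        by (rule bexI[OF _ sm[OF p(1) smult(2)]]) (use p VF smult in \<open>simp add: \<rho>_smult lin_smult sm_mult_l\<close>)
    next
      case (unit i)
      thus ?case using B u[OF s_closed[OF unit]] by (intro bexI[of _ "u (s i)"]) (auto simp: lin_unit)
    next
      case (cong p q)
      have "lin q = lin p" using cong by (intro lin_cong) (auto simp: vcong_def Pi_def)
      thus ?case using cong by simp
    qed
    show "graphU \<subseteq> V"
    proof
      fix q assume q: "q \<in> graphU"
      then obtain x where x: "x \<in> carrier R" "\<And>j. j < blocks \<Longrightarrow> \<rho> j q = x \<otimes>\<^bsub>R\<^esub> gen j" and qF: "q \<in> F"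
        unfolding graphU_def by blast
      obtain c where c: "c \<in> F" "lin c = x" by (rule lin_surj[OF x(1)])
      obtain p where p: "p \<in> V" "\<And>j. j < blocks \<Longrightarrow> \<rho> j p = x \<otimes>\<^bsub>R\<^esub> gen j" using ex[OF c(1)] c(2) by auto
      have "vcong rank 1 q p" using x p VF qF by (intro \<rho>_inj) auto
      thus "q \<in> V" by (rule Vcong[OF p(1) qF])
    qed
  qed
  ultimately show ?thesis by (intro that[of ?B]) auto
qed

end

context residue_action
begin

text \<open>A spanning set of least size is a basis modulo \<open>t\<close>: in a relation with a coefficient that is not
  divisible by \<open>t\<close>, this coefficient is a unit, and the corresponding element could be dropped.\<close>
lemma exists_basis:
  assumes S: "finite S" "S \<subseteq> carrier R"
    and gen: "\<And>X. \<lbrakk>S \<subseteq> X; X \<subseteq> carrier R; \<zero>\<^bsub>R\<^esub> \<in> X; \<And>x y. x \<in> X \<Longrightarrow> y \<in> X \<Longrightarrow> x \<oplus>\<^bsub>R\<^esub> y \<in> X;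
       \<And>a x. a \<in> carrier L \<Longrightarrow> x \<in> X \<Longrightarrow> a \<bullet> x \<in> X\<rbrakk> \<Longrightarrow> carrier R \<subseteq> X"
  shows "\<exists>s d. residue_algebra L t R sm s d"
proof -
  define comb where "comb T c = (\<Oplus>\<^bsub>R\<^esub>x\<in>T. c x \<bullet> x)" for T and c :: "'r \<Rightarrow> 'a"
  define spans where "spans T \<longleftrightarrow> finite T \<and> T \<subseteq> carrier R \<and>
    (\<forall>y\<in>carrier R. \<exists>c. c \<in> UNIV \<rightarrow> carrier L \<and> y = comb T c)" for T
  have tc: "(\<lambda>x. c x \<bullet> x) \<in> T \<rightarrow> carrier R" if "T \<subseteq> carrier R" "c \<in> UNIV \<rightarrow> carrier L" for T c
    using that by (auto simp: Pi_def subset_iff)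
  have comb_closed: "comb T c \<in> carrier R" if "T \<subseteq> carrier R" "c \<in> UNIV \<rightarrow> carrier L" for T c
    unfolding comb_def using tc[OF that] by (rule R.finsum_closed)
  have comb_add: "comb T (\<lambda>x. c x \<oplus> c' x) = comb T c \<oplus>\<^bsub>R\<^esub> comb T c'"
    if T: "T \<subseteq> carrier R" and c: "c \<in> UNIV \<rightarrow> carrier L" "c' \<in> UNIV \<rightarrow> carrier L" for T c c'
  proof -
    have "comb T (\<lambda>x. c x \<oplus> c' x) = (\<Oplus>\<^bsub>R\<^esub>x\<in>T. c x \<bullet> x \<oplus>\<^bsub>R\<^esub> c' x \<bullet> x)"
      unfolding comb_def using T c by (intro R.finsum_cong') (auto simp: sm_l_distr Pi_def subset_iff)
    also have "\<dots> = comb T c \<oplus>\<^bsub>R\<^esub> comb T c'"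
      unfolding comb_def by (intro R.finsum_addf tc T c)
    finally show ?thesis .
  qed
  have comb_smult: "comb T (\<lambda>x. a \<otimes> c x) = a \<bullet> comb T c"
    if T: "finite T" "T \<subseteq> carrier R" and c: "c \<in> UNIV \<rightarrow> carrier L" "a \<in> carrier L" for T c a
  proof -
    have "a \<bullet> comb T c = (\<Oplus>\<^bsub>R\<^esub>x\<in>T. a \<bullet> c x \<bullet> x)"
      unfolding comb_def by (intro sm_finsum tc T c)
    also have "\<dots> = comb T (\<lambda>x. a \<otimes> c x)"
      unfolding comb_def using T c by (intro R.finsum_cong') (auto simp: sm_assoc Pi_def subset_iff)
    finally show ?thesis by simp
  qed
  have "carrier R \<subseteq> {comb S c | c. c \<in> UNIV \<rightarrow> carrier L}" (is "_ \<subseteq> ?X")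
  proof (rule gen)
    show "S \<subseteq> ?X"
    proof
      fix x assume x: "x \<in> S"
      let ?c = "\<lambda>y. if y = x then \<one> else \<zero>"
      have "comb S ?c = (\<Oplus>\<^bsub>R\<^esub>y\<in>S. if x = y then y else \<zero>\<^bsub>R\<^esub>)"
        unfolding comb_def using S by (intro R.finsum_cong') (auto simp: sm_one sm_zero subset_iff)
      also have "\<dots> = x" using S x by (intro R.finsum_singleton) (auto simp: subset_iff)
      finally have "x = comb S ?c" by simp
      thus "x \<in> ?X" by (intro CollectI exI[of _ ?c]) auto
    qed
    show "?X \<subseteq> carrier R" using comb_closed[OF S(2)] by blast
    show "\<zero>\<^bsub>R\<^esub> \<in> ?X"
    proof -
      have "comb S (\<lambda>x. \<zero>) = \<zero>\<^bsub>R\<^esub>"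
        unfolding comb_def using S by (intro R.add.finprod_one_eqI) (auto simp: sm_zero)
      thus ?thesis by (intro CollectI exI[of _ "\<lambda>x. \<zero>"]) auto
    qed
    fix x assume "x \<in> ?X"
    then obtain c where c: "c \<in> UNIV \<rightarrow> carrier L" "x = comb S c" by blast
    show "a \<bullet> x \<in> ?X" if a: "a \<in> carrier L" for a
      unfolding c(2) comb_smult[OF S c(1) a, symmetric]
      using c(1) a by (intro CollectI exI[of _ "\<lambda>x. a \<otimes> c x"]) auto
    fix y assume "y \<in> ?X"
    then obtain c' where c': "c' \<in> UNIV \<rightarrow> carrier L" "y = comb S c'" by blast
    show "x \<oplus>\<^bsub>R\<^esub> y \<in> ?X"
      unfolding c(2) c'(2) comb_add[OF S(2) c(1) c'(1), symmetric]
      using c(1) c'(1) by (intro CollectI exI[of _ "\<lambda>x. c x \<oplus> c' x"]) auto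
  qed
  hence "spans S" unfolding spans_def using S by blast
  then obtain B where B: "spans B" and min: "\<And>T. spans T \<Longrightarrow> card B \<le> card T"
    using ex_has_least_nat[of spans S card] by blast
  have Bf: "finite B" "B \<subseteq> carrier R" using B by (auto simp: spans_def)
  have indep: "\<exists>e\<in>carrier L. c b = t \<otimes> e"
    if c: "c \<in> UNIV \<rightarrow> carrier L" and z: "comb B c = \<zero>\<^bsub>R\<^esub>" and b: "b \<in> B" for c b
  proof (rule ccontr)
    assume n: "\<not> ?thesis"
    have "c b \<in> Units L" using n c by (intro unitI) auto
    hence i: "inv (c b) \<in> carrier L" "inv (c b) \<otimes> c b = \<one>" by auto
    have bR: "b \<in> carrier R" using b Bf by auto
    have "spans (B - {b})" unfolding spans_def
    proof (intro conjI ballI)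
      fix y assume y: "y \<in> carrier R"
      then obtain a where a: "a \<in> UNIV \<rightarrow> carrier L" "y = comb B a" using B unfolding spans_def by blast
      have ab: "a b \<in> carrier L" "c b \<in> carrier L" using a c by auto
      \<comment> \<open>subtract the multiple of the relation that removes \<open>b\<close>\<close>
      let ?k = "\<ominus> (a b \<otimes> inv (c b))"
      have k: "?k \<in> carrier L" using ab i by simp
      define a' where "a' x = a x \<oplus> ?k \<otimes> c x" for x
      have a': "a' \<in> UNIV \<rightarrow> carrier L" using a c k by (auto simp: a'_def Pi_def)
      have kc: "(\<lambda>x. ?k \<otimes> c x) \<in> UNIV \<rightarrow> carrier L" using c k by auto
      have "comb B a' = y"
        unfolding a'_def comb_add[OF Bf(2) a(1) kc] comb_smult[OF Bf c k] z
        using k y a by (simp add: sm_r_zero)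
      moreover have "a' b = \<zero>"
        unfolding a'_def using ab i by (simp add: l_minus m_assoc r_neg)
      moreover have "comb B a' = a' b \<bullet> b \<oplus>\<^bsub>R\<^esub> comb (B - {b}) a'"
      proof -
        have "comb (insert b (B - {b})) a' = a' b \<bullet> b \<oplus>\<^bsub>R\<^esub> comb (B - {b}) a'"
          unfolding comb_def using Bf bR a' by (intro R.finsum_insert tc) auto
        thus ?thesis using insert_Diff[OF b] by simp
      qed
      moreover have "comb (B - {b}) a' \<in> carrier R" using Bf a' by (intro comb_closed) auto
      ultimately have "y = comb (B - {b}) a'" using bR by (simp add: sm_zero)
      thus "\<exists>c. c \<in> UNIV \<rightarrow> carrier L \<and> y = comb (B - {b}) c" using a' by blast
    qed (use Bf in auto)
    from min[OF this] show False using b Bf by (metis card_Diff1_less linorder_not_less)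
  qed
  obtain h where h: "bij_betw h {..<card B} B"
    using ex_bij_betw_nat_finite[OF Bf(1)] by (auto simp: atLeast0LessThan)
  have hB: "h ` {..<card B} = B" "inj_on h {..<card B}" using h by (auto simp: bij_betw_def)
  have reindex: "comb B c = (\<Oplus>\<^bsub>R\<^esub>i\<in>{..<card B}. c (h i) \<bullet> h i)" if "c \<in> UNIV \<rightarrow> carrier L" for c
    unfolding comb_def using R.finsum_reindex[OF _ hB(2), of "\<lambda>x. c x \<bullet> x"] tc[OF Bf(2) that] by (simp add: hB(1))
  have "residue_algebra L t R sm h (card B)"
  proof
    show hc: "h i \<in> carrier R" if "i < card B" for i using that hB Bf by auto
    show "\<exists>c\<in>F. x = (\<Oplus>\<^bsub>R\<^esub>i\<in>{..<card B}. c i \<bullet> h i)" if "x \<in> carrier R" for x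
    proof -
      obtain c where c: "c \<in> UNIV \<rightarrow> carrier L" "x = comb B c" using B \<open>x \<in> carrier R\<close> unfolding spans_def by blast
      show ?thesis using reindex[OF c(1)] c by (intro bexI[of _ "\<lambda>i. c (h i)"]) auto
    qed
    show "vcong (card B) 1 c Z"
      if c: "c \<in> F" and z: "(\<Oplus>\<^bsub>R\<^esub>i\<in>{..<card B}. c i \<bullet> h i) = \<zero>\<^bsub>R\<^esub>" for c
      unfolding vcong_def
    proof (intro allI impI)
      fix i assume i: "i < card B"
      define c' where "c' x = c (inv_into {..<card B} h x)" for x
      have c': "c' \<in> UNIV \<rightarrow> carrier L" using c by (auto simp: c'_def)
      have eq: "c' (h j) = c j" if "j < card B" for j
        using inv_into_f_f[OF hB(2)] that by (simp add: c'_def)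
      have "comb B c' = (\<Oplus>\<^bsub>R\<^esub>i\<in>{..<card B}. c i \<bullet> h i)"
        unfolding reindex[OF c'] using c hc by (intro R.finsum_cong') (auto simp: eq)
      hence "\<exists>e\<in>carrier L. c' (h i) = t \<otimes> e" using z hB i by (intro indep c') auto
      thus "tcong 1 (c i) \<zero>" using eq[OF i] c unfolding tcong_def by auto
    qed
  qed
  thus ?thesis by blast
qed

end

section \<open>Linear maps preserving the two subspaces\<close>

context residue_algebra
begin

lemma unit_vector:
  assumes "x \<in> carrier R"
  shows "\<exists>p. p \<in> F \<and> (\<forall>i. \<rho> i p = (if i = j then x else \<zero>\<^bsub>R\<^esub>))"
proof -
  obtain p where "p \<in> F" "\<And>i. \<rho> i p = (if i = j then x else \<zero>\<^bsub>R\<^esub>)"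
    by (rule \<rho>_surj[of "\<lambda>i. if i = j then x else \<zero>\<^bsub>R\<^esub>"]) (use assms in auto)
  thus ?thesis by blast
qed

definition \<sigma> :: "nat \<Rightarrow> 'r \<Rightarrow> nat \<Rightarrow> 'a" where
  "\<sigma> j x = (SOME p. p \<in> F \<and> (\<forall>i. \<rho> i p = (if i = j then x else \<zero>\<^bsub>R\<^esub>)))"

lemma \<sigma>: assumes "x \<in> carrier R" shows "\<sigma> j x \<in> F" "\<rho> i (\<sigma> j x) = (if i = j then x else \<zero>\<^bsub>R\<^esub>)"
  using someI_ex[OF unit_vector[OF assms, of j]] unfolding \<sigma>_def by auto

lemma \<sigma>_shiftW: assumes "x \<in> carrier R" "j < blocks - 1" shows "(\<sigma> j x, \<sigma> (Suc j) x) \<in> shiftW"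
  using assms by (simp add: shiftW_def \<sigma>)

lemma support_induct [consumes 1, case_names zero step]:
  assumes p: "p \<in> F"
    and zero: "\<And>p. p \<in> F \<Longrightarrow> (\<And>j. j < blocks \<Longrightarrow> \<rho> j p = \<zero>\<^bsub>R\<^esub>) \<Longrightarrow> P p"
    and step: "\<And>p q j x. \<lbrakk>p \<in> F; q \<in> F; P p; j < blocks; x \<in> carrier R;
       \<And>i. i < blocks \<Longrightarrow> \<rho> i q = \<rho> i p \<oplus>\<^bsub>R\<^esub> (if i = j then x else \<zero>\<^bsub>R\<^esub>)\<rbrakk> \<Longrightarrow> P q"
  shows "P p"
proof -
  have "p \<in> F \<Longrightarrow> (\<And>j. l \<le> j \<Longrightarrow> j < blocks \<Longrightarrow> \<rho> j p = \<zero>\<^bsub>R\<^esub>) \<Longrightarrow> l \<le> blocks \<Longrightarrow> P p" for l p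
  proof (induction l arbitrary: p)
    case 0 thus ?case by (intro zero) auto
  next
    case (Suc l)
    obtain q where q: "q \<in> F" "\<And>j. \<rho> j q = (if j < l then \<rho> j p else \<zero>\<^bsub>R\<^esub>)"
      by (rule \<rho>_surj[of "\<lambda>j. if j < l then \<rho> j p else \<zero>\<^bsub>R\<^esub>"]) (use Suc(2) in auto)
    have "P q" using Suc(4) q by (intro Suc.IH) auto
    moreover have "\<rho> i p = \<rho> i q \<oplus>\<^bsub>R\<^esub> (if i = l then \<rho> l p else \<zero>\<^bsub>R\<^esub>)" if "i < blocks" for i
      using Suc(2) Suc(3)[of i] that q(2)[of i] by (cases i l rule: linorder_cases) auto
    ultimately show ?case using q Suc by (intro step[of q p l "\<rho> l p"]) auto
  qed
  from this[of p blocks] p show ?thesis by auto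
qed

text \<open>The matrix \<open>\<phi> i j\<close> of the map induced by \<open>A\<close> is constant along diagonals, its first row
  vanishes off the first column and its last row off the last column, all because of the shift. An
  entry off the main diagonal can be moved along its diagonal to the first or to the last row, so it
  vanishes. The remaining map \<open>\<psi>\<close> commutes with right multiplication by the \<open>g_j\<close> because of
  \<open>U\<close>, and one of them is the unit.\<close>
lemma rigidity:
  fixes A :: "(nat \<Rightarrow> 'a) \<Rightarrow> (nat \<Rightarrow> 'a) \<Rightarrow> bool"
  assumes A_F: "\<And>p a. A p a \<Longrightarrow> a \<in> F"
    and A_ex: "\<And>p. p \<in> F \<Longrightarrow> \<exists>a. A p a"
    and A_add: "\<And>p q a b. A p a \<Longrightarrow> A q b \<Longrightarrow> A (\<lambda>i. p i \<oplus> q i) (\<lambda>i. a i \<oplus> b i)"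
    and A_smult: "\<And>p a c. A p a \<Longrightarrow> c \<in> carrier L \<Longrightarrow> A (\<lambda>i. c \<otimes> p i) (\<lambda>i. c \<otimes> a i)"
    and A_unique: "\<And>p a q b. A p a \<Longrightarrow> A q b \<Longrightarrow> vcong rank 1 p q \<Longrightarrow> vcong rank 1 a b"
    and A_U: "\<And>p a. p \<in> graphU \<Longrightarrow> A p a \<Longrightarrow> a \<in> graphU"
    and A_W: "\<And>p q a b. (p, q) \<in> shiftW \<Longrightarrow> A p a \<Longrightarrow> A q b \<Longrightarrow> (a, b) \<in> shiftW"
  shows "\<exists>r\<in>carrier R. \<forall>p a j. p \<in> F \<longrightarrow> A p a \<longrightarrow> j < blocks \<longrightarrow> \<rho> j a = r \<otimes>\<^bsub>R\<^esub> \<rho> j p"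
proof -
  obtain \<alpha> where \<alpha>: "\<And>p. p \<in> F \<Longrightarrow> A p (\<alpha> p)" using A_ex by metis
  have \<alpha>F: "p \<in> F \<Longrightarrow> \<alpha> p \<in> F" for p using \<alpha> A_F by blast
  have uniq: "\<rho> j a = \<rho> j b" if "A p a" "A q b" "\<And>i. i < blocks \<Longrightarrow> \<rho> i p = \<rho> i q" "p \<in> F" "q \<in> F" "j < blocks" for p q a b j
    using that A_unique[OF that(1,2) \<rho>_inj] A_F by (intro \<rho>_cong) auto
  have add: "\<rho> j (\<alpha> r) = \<rho> j (\<alpha> p) \<oplus>\<^bsub>R\<^esub> \<rho> j (\<alpha> q)"
    if F: "p \<in> F" "q \<in> F" "r \<in> F" and e: "\<And>i. i < blocks \<Longrightarrow> \<rho> i r = \<rho> i p \<oplus>\<^bsub>R\<^esub> \<rho> i q" and j: "j < blocks" for p q r j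
  proof -
    have s: "(\<lambda>i. p i \<oplus> q i) \<in> F" using F by auto
    have "\<rho> j (\<alpha> r) = \<rho> j (\<lambda>i. \<alpha> p i \<oplus> \<alpha> q i)"
      by (rule uniq[OF \<alpha>[OF F(3)] A_add[OF \<alpha>[OF F(1)] \<alpha>[OF F(2)]] _ F(3) s j]) (simp add: e \<rho>_add F)
    thus ?thesis using F by (simp add: \<rho>_add \<alpha>F)
  qed
  define \<phi> where "\<phi> i j x = \<rho> i (\<alpha> (\<sigma> j x))" for i j x
  have \<phi>c: "\<phi> i j x \<in> carrier R" if "x \<in> carrier R" for i j x
    using that unfolding \<phi>_def by (intro \<rho>_closed \<alpha>F \<sigma>)
  have W: "(\<alpha> (\<sigma> j x), \<alpha> (\<sigma> (Suc j) x)) \<in> shiftW" if "x \<in> carrier R" "j < blocks - 1" for j x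
    by (rule A_W[OF \<sigma>_shiftW[OF that] \<alpha> \<alpha>]) (rule \<sigma>(1)[OF that(1)])+
  have shift1: "\<phi> (Suc i) (Suc j) x = \<phi> i j x" if "x \<in> carrier R" "Suc i < blocks" "Suc j < blocks" for i j x
    using W[OF that(1), of j] that unfolding shiftW_def \<phi>_def by auto
  have shift: "\<phi> (i + k) (j + k) x = \<phi> i j x" if "x \<in> carrier R" "i + k < blocks" "j + k < blocks" for i j k x
    using that by (induction k) (auto simp: shift1)
  have top: "\<phi> 0 (Suc j) x = \<zero>\<^bsub>R\<^esub>" if "x \<in> carrier R" "Suc j < blocks" for j x
    using W[OF that(1), of j] that unfolding shiftW_def \<phi>_def by auto
  have bot: "\<phi> (blocks - 1) j x = \<zero>\<^bsub>R\<^esub>" if "x \<in> carrier R" "j < blocks - 1" for j x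
    using W[OF that(1), of j] that unfolding shiftW_def \<phi>_def by auto
  have diag: "\<phi> i j x = (if i = j then \<phi> 0 0 x else \<zero>\<^bsub>R\<^esub>)" if x: "x \<in> carrier R" and i: "i < blocks" and j: "j < blocks" for i j x
  proof (cases i j rule: linorder_cases)
    case less
    then obtain k where "j = Suc k + i" by (metis less_iff_Suc_add add.commute add_Suc)
    hence "\<phi> i j x = \<phi> 0 (Suc k) x" using shift[OF x, of 0 i "Suc k"] i j by simp
    thus ?thesis using top[OF x, of k] less i j \<open>j = Suc k + i\<close> by auto
  next
    case equal thus ?thesis using shift[OF x, of 0 i 0] i by simp
  next
    case greater
    \<comment> \<open>moving down the diagonal by \<open>k\<close> steps reaches the last row\<close>
    define k where "k = blocks - 1 - i"
    have "i + k = blocks - 1" "j + k < blocks - 1" using greater i by (auto simp: k_def)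
    hence "\<phi> i j x = \<zero>\<^bsub>R\<^esub>" using shift[OF x, of i k j] bot[OF x, of "j + k"] by auto
    thus ?thesis using greater by simp
  qed
  define \<psi> where "\<psi> x = \<phi> 0 0 x" for x
  have blocks_pos: "0 < blocks" "d < blocks" by (auto simp: blocks_def)
  have vanish0: "\<rho> j (\<alpha> p) = \<zero>\<^bsub>R\<^esub>" if "p \<in> F" "\<And>j. j < blocks \<Longrightarrow> \<rho> j p = \<zero>\<^bsub>R\<^esub>" "j < blocks" for p j
  proof -
    have "\<rho> j (\<alpha> p) = \<rho> j (\<alpha> p) \<oplus>\<^bsub>R\<^esub> \<rho> j (\<alpha> p)" using that by (intro add) auto
    thus ?thesis using \<rho>_closed[OF \<alpha>F[OF that(1)], of j] R.add.l_cancel_one' by metis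
  qed
  have \<psi>0: "\<psi> \<zero>\<^bsub>R\<^esub> = \<zero>\<^bsub>R\<^esub>" unfolding \<psi>_def \<phi>_def using blocks_pos by (intro vanish0 \<sigma>) (auto simp: \<sigma>)
  have \<psi>c: "x \<in> carrier R \<Longrightarrow> \<psi> x \<in> carrier R" for x unfolding \<psi>_def by (rule \<phi>c)
  have \<psi>add: "\<psi> (x \<oplus>\<^bsub>R\<^esub> y) = \<psi> x \<oplus>\<^bsub>R\<^esub> \<psi> y" if "x \<in> carrier R" "y \<in> carrier R" for x y
    unfolding \<psi>_def \<phi>_def using that blocks_pos by (intro add) (auto simp: \<sigma>)
  have main: "\<forall>j<blocks. \<rho> j (\<alpha> p) = \<psi> (\<rho> j p)" if "p \<in> F" for p
    using that
  proof (induction rule: support_induct)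
    case (zero p) thus ?case using vanish0 \<psi>0 by simp
  next
    case (step p q l x)
    show ?case
    proof (intro allI impI)
      fix j assume j: "j < blocks"
      have "\<rho> j (\<alpha> q) = \<rho> j (\<alpha> p) \<oplus>\<^bsub>R\<^esub> \<rho> j (\<alpha> (\<sigma> l x))"
        using step j by (intro add) (auto simp: \<sigma>)
      also have "\<rho> j (\<alpha> (\<sigma> l x)) = \<psi> (if j = l then x else \<zero>\<^bsub>R\<^esub>)"
        using diag[of x j l] step j \<psi>0 unfolding \<psi>_def \<phi>_def by auto
      also have "\<rho> j (\<alpha> p) = \<psi> (\<rho> j p)" using step j by simp
      also have "\<psi> (\<rho> j p) \<oplus>\<^bsub>R\<^esub> \<psi> (if j = l then x else \<zero>\<^bsub>R\<^esub>) = \<psi> (\<rho> j p \<oplus>\<^bsub>R\<^esub> (if j = l then x else \<zero>\<^bsub>R\<^esub>))"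
        using step by (intro \<psi>add[symmetric]) auto
      finally show "\<rho> j (\<alpha> q) = \<psi> (\<rho> j q)" using step j by simp
    qed
  qed
  have \<psi>sm: "\<psi> (c \<bullet> x) = c \<bullet> \<psi> x" if c: "c \<in> carrier L" and x: "x \<in> carrier R" for c x
  proof -
    have F: "(\<lambda>i. c \<otimes> \<sigma> 0 x i) \<in> F" using c \<sigma>(1)[OF x, of 0] by auto
    have "\<psi> (c \<bullet> x) = \<rho> 0 (\<lambda>i. c \<otimes> \<alpha> (\<sigma> 0 x) i)"
      unfolding \<psi>_def \<phi>_def
      by (rule uniq[OF \<alpha> A_smult[OF \<alpha> c]]) (use c x F blocks_pos in \<open>auto simp: \<sigma> \<rho>_smult sm_r_zero\<close>)
    thus ?thesis using c x by (simp add: \<rho>_smult \<alpha>F \<sigma> \<psi>_def \<phi>_def)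
  qed
  have \<psi>g: "\<psi> (gen j) = \<psi> \<one>\<^bsub>R\<^esub> \<otimes>\<^bsub>R\<^esub> gen j" if j: "j < blocks" for j
  proof -
    obtain p where p: "p \<in> F" "\<And>j. \<rho> j p = \<one>\<^bsub>R\<^esub> \<otimes>\<^bsub>R\<^esub> gen j" by (rule \<rho>_surj[of "\<lambda>j. \<one>\<^bsub>R\<^esub> \<otimes>\<^bsub>R\<^esub> gen j"]) auto
    hence "p \<in> graphU" unfolding graphU_def by (auto intro!: bexI[of _ "\<one>\<^bsub>R\<^esub>"])
    hence "\<alpha> p \<in> graphU" using A_U \<alpha> p by blast
    then obtain y where y: "y \<in> carrier R" "\<And>j. j < blocks \<Longrightarrow> \<rho> j (\<alpha> p) = y \<otimes>\<^bsub>R\<^esub> gen j" unfolding graphU_def by blast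
    have e: "\<psi> (gen j) = y \<otimes>\<^bsub>R\<^esub> gen j" if "j < blocks" for j using main p y that by simp
    have "\<psi> \<one>\<^bsub>R\<^esub> = y" using e[OF blocks_pos(2)] y by (simp add: gen_def)
    thus ?thesis using e j by simp
  qed
  have \<psi>lin: "\<psi> (lin c) = \<psi> \<one>\<^bsub>R\<^esub> \<otimes>\<^bsub>R\<^esub> lin c" if "c \<in> F" for c
    using that
  proof (induction rule: coordinate_induct[where m = d])
    case zero show ?case by (simp add: lin_zero \<psi>0 \<psi>c)
  next
    case (add p q) thus ?case by (simp add: lin_add \<psi>add R.r_distr \<psi>c)
  next
    case (smult p c) thus ?case by (simp add: lin_smult \<psi>sm sm_mult_r \<psi>c)
  next
    case (unit i) thus ?case using \<psi>g[of i] by (simp add: lin_unit gen_def blocks_def)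
  next
    case (cong p q)
    have "lin q = lin p" using cong by (intro lin_cong) (auto simp: vcong_def Pi_def)
    thus ?case using cong by simp
  qed
  have \<psi>: "\<psi> x = \<psi> \<one>\<^bsub>R\<^esub> \<otimes>\<^bsub>R\<^esub> x" if x: "x \<in> carrier R" for x
  proof -
    obtain c where "c \<in> F" "lin c = x" by (rule lin_surj[OF x])
    thus ?thesis using \<psi>lin by blast
  qed
  have "\<rho> j a = \<psi> \<one>\<^bsub>R\<^esub> \<otimes>\<^bsub>R\<^esub> \<rho> j p" if "p \<in> F" "A p a" "j < blocks" for p a j
  proof -
    have "\<rho> j a = \<rho> j (\<alpha> p)" by (rule uniq[OF that(2) \<alpha>[OF that(1)] _ that(1,1,3)]) simp
    also have "\<dots> = \<psi> (\<rho> j p)" using main that by blast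
    also have "\<dots> = \<psi> \<one>\<^bsub>R\<^esub> \<otimes>\<^bsub>R\<^esub> \<rho> j p" by (rule \<psi>) (use that in auto)
    finally show ?thesis .
  qed
  thus ?thesis using \<psi>c by auto
qed

text \<open>Every unit vector \<open>\<sigma> j x\<close> is a component of an element of \<open>W\<close>: the first component for
  \<open>j < N - 1\<close>, the second for the last block.\<close>
lemma maps_to_I_vanish:
  fixes A :: "(nat \<Rightarrow> 'a) \<Rightarrow> (nat \<Rightarrow> 'a) \<Rightarrow> bool" and m' :: nat
  assumes A_ex: "\<And>p. p \<in> F \<Longrightarrow> \<exists>a. A p a"
    and A_add: "\<And>p q a b. A p a \<Longrightarrow> A q b \<Longrightarrow> A (\<lambda>i. p i \<oplus> q i) (\<lambda>i. a i \<oplus> b i)"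
    and A_smult: "\<And>p a c. A p a \<Longrightarrow> c \<in> carrier L \<Longrightarrow> A (\<lambda>i. c \<otimes> p i) (\<lambda>i. c \<otimes> a i)"
    and A_unique: "\<And>p a q b. A p a \<Longrightarrow> A q b \<Longrightarrow> vcong rank 1 p q \<Longrightarrow> vcong m' 1 a b"
    and A_W: "\<And>p q a b. (p, q) \<in> shiftW \<Longrightarrow> A p a \<Longrightarrow> A q b \<Longrightarrow> vcong m' 1 a Z \<and> vcong m' 1 b Z"
    and A_F: "\<And>p a. A p a \<Longrightarrow> a \<in> F"
    and p: "p \<in> F" and a: "A p a"
  shows "vcong m' 1 a Z"
proof -
  have \<sigma>v: "vcong m' 1 a Z" if x: "x \<in> carrier R" and j: "j < blocks" and a: "A (\<sigma> j x) a" for j x a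
  proof (cases "j < blocks - 1")
    case True
    obtain b where "A (\<sigma> (Suc j) x) b" using A_ex \<sigma>(1)[OF x] by blast
    thus ?thesis using A_W[OF \<sigma>_shiftW[OF x True] a] by blast
  next
    case False
    hence "j = Suc (blocks - 2)" "blocks - 2 < blocks - 1" using j by (auto simp: blocks_def)
    moreover obtain b where "A (\<sigma> (blocks - 2) x) b" using A_ex \<sigma>(1)[OF x] by blast
    ultimately show ?thesis using A_W[OF \<sigma>_shiftW[OF x, of "blocks - 2"]] a by blast
  qed
  have "\<forall>a. A p a \<longrightarrow> vcong m' 1 a Z" using p
  proof (induction rule: support_induct)
    case (zero p)
    show ?case
    proof (intro allI impI)
      fix a assume a: "A p a"
      have "vcong rank 1 p (\<lambda>i. \<zero> \<otimes> p i)" using zero by (intro \<rho>_inj) (auto simp: \<rho>_smult sm_r_zero)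
      hence "vcong m' 1 a (\<lambda>i. \<zero> \<otimes> a i)" by (intro A_unique[OF a A_smult[OF a]]) auto
      thus "vcong m' 1 a Z" using A_F[OF a] by (simp add: Pi_def)
    qed
  next
    case (step p q l x)
    show ?case
    proof (intro allI impI)
      fix a assume a: "A q a"
      obtain b c where b: "A p b" "A (\<sigma> l x) c" using A_ex step(1) \<sigma>(1)[OF step(4)] by metis
      have "vcong rank 1 q (\<lambda>i. p i \<oplus> \<sigma> l x i)"
        using step \<sigma>(1)[OF step(4), of l] by (intro \<rho>_inj) (auto simp: \<rho>_add \<sigma> Pi_def)
      hence "vcong m' 1 a (\<lambda>i. b i \<oplus> c i)" by (intro A_unique[OF a A_add[OF b]])
      also have "vcong m' 1 (\<lambda>i. b i \<oplus> c i) (\<lambda>i. \<zero> \<oplus> \<zero>)"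
        using step b \<sigma>v by (intro vcong_add) auto
      finally show "vcong m' 1 a Z" by simp
    qed
  qed
  thus ?thesis using a by blast
qed

lemma tcong_finsum:
  assumes "finite S" "\<And>i. i \<in> S \<Longrightarrow> tcong k (u i) (v i)"
  shows "tcong k (\<Oplus>i\<in>S. u i) (\<Oplus>i\<in>S. v i)"
  using assms
proof (induction S rule: finite_induct)
  case empty show ?case by simp
next
  case (insert x S)
  have c: "u i \<in> carrier L \<and> v i \<in> carrier L" if "i \<in> insert x S" for i
    using tcong_closed[OF insert(4)[OF that]] by simp
  have "u \<in> S \<rightarrow> carrier L" "v \<in> S \<rightarrow> carrier L" "u x \<in> carrier L" "v x \<in> carrier L"
    using c by auto
  moreover have "tcong k (\<Oplus>i\<in>S. u i) (\<Oplus>i\<in>S. v i)" using insert by auto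
  ultimately show ?case using insert by (simp add: tcong_add)
qed

text \<open>Left multiplication by \<open>r\<close> has a matrix with respect to the basis; any lift of its entries to the
  ring, repeated in each block, serves. Exact linearity, and not only linearity modulo \<open>t\<close>, is
  needed to obtain a morphism of modules.\<close>
lemma lift_mult:
  assumes r: "r \<in> carrier R"
  obtains \<Theta> where
    "\<And>p. p \<in> F \<Longrightarrow> \<Theta> p \<in> F"
    "\<And>p q. p \<in> F \<Longrightarrow> q \<in> F \<Longrightarrow> \<Theta> (\<lambda>i. p i \<oplus> q i) = (\<lambda>i. \<Theta> p i \<oplus> \<Theta> q i)"
    "\<And>p c. p \<in> F \<Longrightarrow> c \<in> carrier L \<Longrightarrow> \<Theta> (\<lambda>i. c \<otimes> p i) = (\<lambda>i. c \<otimes> \<Theta> p i)"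
    "\<And>k p q. p \<in> F \<Longrightarrow> q \<in> F \<Longrightarrow> vcong rank k p q \<Longrightarrow> vcong rank k (\<Theta> p) (\<Theta> q)"
    "\<And>p j. p \<in> F \<Longrightarrow> \<rho> j (\<Theta> p) = r \<otimes>\<^bsub>R\<^esub> \<rho> j p"
proof -
  have "\<exists>c. c \<in> F \<and> (i < d \<longrightarrow> lin c = r \<otimes>\<^bsub>R\<^esub> s i)" for i
  proof (cases "i < d")
    case True
    obtain c where "c \<in> F" "lin c = r \<otimes>\<^bsub>R\<^esub> s i" by (rule lin_surj[of "r \<otimes>\<^bsub>R\<^esub> s i"]) (use r s_closed[OF True] in auto)
    thus ?thesis by blast
  qed (auto intro: exI[of _ "\<lambda>i. \<zero>"])
  then obtain C where C: "\<And>i. C i \<in> F" "\<And>i. i < d \<Longrightarrow> lin (C i) = r \<otimes>\<^bsub>R\<^esub> s i" by metis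
  have Cc [simp]: "C i a \<in> carrier L" for i a using C(1)[of i] by auto
  define M where "M c = (\<lambda>a. \<Oplus>i\<in>{..<d}. C i a \<otimes> c i)" for c :: "nat \<Rightarrow> 'a"
  have MF: "c \<in> F \<Longrightarrow> M c \<in> F" for c unfolding M_def by (auto simp: Pi_def intro!: finsum_closed m_closed)
  have Madd: "M (\<lambda>i. c i \<oplus> c' i) = (\<lambda>a. M c a \<oplus> M c' a)" if "c \<in> F" "c' \<in> F" for c c'
  proof
    fix a
    have "M (\<lambda>i. c i \<oplus> c' i) a = (\<Oplus>i\<in>{..<d}. C i a \<otimes> c i \<oplus> C i a \<otimes> c' i)"
      unfolding M_def using that by (intro finsum_cong') (auto simp: r_distr Pi_def)
    also have "\<dots> = M c a \<oplus> M c' a" unfolding M_def using that by (intro finsum_addf) (auto simp: Pi_def)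
    finally show "M (\<lambda>i. c i \<oplus> c' i) a = M c a \<oplus> M c' a" .
  qed
  have Msm: "M (\<lambda>i. k \<otimes> c i) = (\<lambda>a. k \<otimes> M c a)" if "c \<in> F" "k \<in> carrier L" for c k
  proof
    fix a
    have "M (\<lambda>i. k \<otimes> c i) a = (\<Oplus>i\<in>{..<d}. k \<otimes> (C i a \<otimes> c i))"
      unfolding M_def using that by (intro finsum_cong') (auto simp: m_lcomm Pi_def)
    also have "\<dots> = k \<otimes> M c a" unfolding M_def using that by (intro finsum_rdistr[symmetric]) (auto simp: Pi_def)
    finally show "M (\<lambda>i. k \<otimes> c i) a = k \<otimes> M c a" .
  qed
  have Mvc: "tcong k (M c a) (M c' a)" if "c \<in> F" "c' \<in> F" "vcong d k c c'" for k c c' a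
    unfolding M_def using that by (intro tcong_finsum tcong_mult) (auto simp: vcong_def)
  have Mlin: "lin (M c) = r \<otimes>\<^bsub>R\<^esub> lin c" if "c \<in> F" for c
    using that
  proof (induction rule: coordinate_induct[where m = d])
    case zero
    have "M Z = (\<lambda>a. \<zero>)" unfolding M_def by (auto intro!: add.finprod_one_eqI)
    thus ?case using r by (simp add: lin_zero)
  next
    case (add p q) thus ?case using r by (simp add: Madd lin_add MF R.r_distr)
  next
    case (smult p c) thus ?case using r by (simp add: Msm lin_smult MF sm_mult_r)
  next
    case (unit k)
    have "M (\<lambda>j. if j = k then \<one> else \<zero>) = C k"
    proof
      fix a
      have "M (\<lambda>j. if j = k then \<one> else \<zero>) a = (\<Oplus>i\<in>{..<d}. if k = i then C i a else \<zero>)"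
        unfolding M_def by (intro finsum_cong') auto
      also have "\<dots> = C k a" using unit by (intro finsum_singleton) auto
      finally show "M (\<lambda>j. if j = k then \<one> else \<zero>) a = C k a" .
    qed
    thus ?case using C(2)[OF unit] lin_unit[OF unit] by simp
  next
    case (cong p q)
    have v: "vcong d 1 q p" using cong by (auto simp: vcong_def Pi_def)
    have "lin q = lin p" using cong v by (intro lin_cong)
    moreover have "lin (M q) = lin (M p)"
      using Mvc[OF cong(2,1) v] MF cong by (intro lin_cong) (auto simp: vcong_def)
    ultimately show ?case using cong by simp
  qed
  define \<Theta> where "\<Theta> p = (\<lambda>l. M (\<lambda>i. p (l div d * d + i)) (l mod d))" for p :: "nat \<Rightarrow> 'a"
  have \<Theta>F: "\<Theta> p \<in> F" if "p \<in> F" for p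
    unfolding \<Theta>_def using funcset_mem[OF MF[OF shift_F[OF that]]] by auto
  have \<Theta>vcong: "vcong rank k (\<Theta> p) (\<Theta> q)" if F: "p \<in> F" "q \<in> F" and v: "vcong rank k p q" for k p q
    unfolding vcong_def
  proof (intro allI impI)
    fix l assume l: "l < rank"
    hence "l div d < blocks" by (auto simp: rank_def less_mult_imp_div_less mult.commute)
    hence "vcong d k (\<lambda>i. p (l div d * d + i)) (\<lambda>i. q (l div d * d + i))"
      using v index unfolding vcong_def by blast
    thus "tcong k (\<Theta> p l) (\<Theta> q l)" unfolding \<Theta>_def using F by (intro Mvc shift_F)
  qed
  have \<Theta>\<rho>: "\<rho> j (\<Theta> p) = r \<otimes>\<^bsub>R\<^esub> \<rho> j p" if p: "p \<in> F" for p j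
  proof -
    have "lin (\<lambda>i. \<Theta> p (j * d + i)) = lin (M (\<lambda>i. p (j * d + i)))"
    proof (rule lin_cong)
      show "vcong d 1 (\<lambda>i. \<Theta> p (j * d + i)) (M (\<lambda>i. p (j * d + i)))"
        unfolding vcong_def
      proof (intro allI impI)
        fix i assume "i < d"
        hence "\<Theta> p (j * d + i) = M (\<lambda>i. p (j * d + i)) i" by (simp add: \<Theta>_def)
        moreover have "M (\<lambda>i. p (j * d + i)) i \<in> carrier L" using MF[OF shift_F[OF p, of j]] by auto
        ultimately show "tcong 1 (\<Theta> p (j * d + i)) (M (\<lambda>i. p (j * d + i)) i)" by simp
      qed
    qed (use shift_F[OF \<Theta>F[OF p]] MF[OF shift_F[OF p]] in auto)
    thus ?thesis unfolding \<rho>_def using Mlin[OF shift_F[OF p]] by simp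
  qed
  show ?thesis
  proof (rule that[of \<Theta>])
    show "\<Theta> (\<lambda>i. p i \<oplus> q i) = (\<lambda>i. \<Theta> p i \<oplus> \<Theta> q i)" if "p \<in> F" "q \<in> F" for p q
      unfolding \<Theta>_def using Madd[OF shift_F[OF that(1)] shift_F[OF that(2)]] by simp
    show "\<Theta> (\<lambda>i. c \<otimes> p i) = (\<lambda>i. c \<otimes> \<Theta> p i)" if "p \<in> F" "c \<in> carrier L" for p c
      unfolding \<Theta>_def using Msm[OF shift_F[OF that(1)] that(2)] by simp
  qed (use \<Theta>F \<Theta>vcong \<Theta>\<rho> in auto)
qed

end

section \<open>Realization of the algebra\<close>

lemma S_hom_compose:
  assumes "module L (fst M)" and f: "f \<in> S_hom L M K" and g: "g \<in> S_hom L K N" and s: "snd M \<subseteq> carrier (fst M)"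
  shows "compose (carrier (fst M)) g f \<in> S_hom L M N"
proof -
  interpret module L "fst M" by (rule assms)
  show ?thesis using f g s unfolding S_hom_def
    by (auto simp: compose_def subset_iff image_subset_iff PiE_iff)
qed

lemma framed_homI:
  "framed L t M \<kappa> m U W \<Longrightarrow> framed L t M' \<kappa>' m' U' W' \<Longrightarrow> f \<in> S_hom L M M' \<Longrightarrow>
    framed_hom L t M \<kappa> m U W M' \<kappa>' m' U' W' f"
  by (simp add: framed_hom_def framed_hom_axioms_def framed_def subspace_pair_def)

context residue_algebra
begin

abbreviation Robj where "Robj \<equiv> object_of rank graphU shiftW"
abbreviation Iobj where "Iobj \<equiv> I_obj L t"
abbreviation C where "C \<equiv> cosetv rank"

lemma Robj_framed: "framed L t Robj C rank graphU shiftW" by (rule object_of_framed[OF graphU_shiftW])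

lemma Robj_obj: "S_obj L Robj"
proof -
  interpret framed L t Robj C rank graphU shiftW by (rule Robj_framed)
  obtain B where B: "finite B" "B \<subseteq> graphU"
    "\<And>V. \<lbrakk>B \<subseteq> V; V \<subseteq> graphU; \<And>p q. p \<in> V \<Longrightarrow> q \<in> V \<Longrightarrow> (\<lambda>i. p i \<oplus> q i) \<in> V;
        \<And>p c. p \<in> V \<Longrightarrow> c \<in> carrier L \<Longrightarrow> (\<lambda>i. c \<otimes> p i) \<in> V;
        \<And>p q. p \<in> V \<Longrightarrow> q \<in> F \<Longrightarrow> vcong rank 1 q p \<Longrightarrow> q \<in> V; Z \<in> V\<rbrakk> \<Longrightarrow> graphU \<subseteq> V"
    by (rule graphU_generated) blast
  have "finitely_generated L (fst Robj)" by (rule finitely_generated[OF B])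
  thus ?thesis using is_module is_submodule unfolding S_obj_def by blast
qed

abbreviation acts1 where "acts1 \<equiv> acts C C"

lemma endo: "f \<in> S_hom L Robj Robj \<Longrightarrow> framed_hom L t Robj C rank graphU shiftW Robj C rank graphU shiftW f"
  by (rule framed_homI[OF Robj_framed Robj_framed])

lemma endo_scalar:
  assumes f: "f \<in> S_hom L Robj Robj"
  shows "\<exists>r\<in>carrier R. \<forall>p a j. p \<in> F \<longrightarrow> acts1 f p a \<longrightarrow> j < blocks \<longrightarrow> \<rho> j a = r \<otimes>\<^bsub>R\<^esub> \<rho> j p"
proof -
  interpret framed_hom L t Robj C rank graphU shiftW Robj C rank graphU shiftW f by (rule endo[OF f])
  show ?thesis
  proof (rule rigidity[where A = "acts1 f"])
    show "\<exists>a. acts1 f p a" if "p \<in> F" for p by (rule X_ex[OF that]) blast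
  qed (rule acts_F(2) acts_add acts_smult acts_unique acts_U acts_W; assumption)+
qed

text \<open>The element of the algebra by which the map induced by \<open>f\<close> multiplies from the left.\<close>
definition \<Phi> where "\<Phi> f = (SOME r. r \<in> carrier R \<and> (\<forall>p a j. p \<in> F \<longrightarrow> acts1 f p a \<longrightarrow> j < blocks \<longrightarrow> \<rho> j a = r \<otimes>\<^bsub>R\<^esub> \<rho> j p))"

lemma \<Phi>:
  assumes f: "f \<in> S_hom L Robj Robj"
  shows "\<Phi> f \<in> carrier R" "\<And>p a j. acts1 f p a \<Longrightarrow> j < blocks \<Longrightarrow> \<rho> j a = \<Phi> f \<otimes>\<^bsub>R\<^esub> \<rho> j p"
proof -
  interpret framed_hom L t Robj C rank graphU shiftW Robj C rank graphU shiftW f by (rule endo[OF f])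
  have *: "\<Phi> f \<in> carrier R \<and> (\<forall>p a j. p \<in> F \<longrightarrow> acts1 f p a \<longrightarrow> j < blocks \<longrightarrow> \<rho> j a = \<Phi> f \<otimes>\<^bsub>R\<^esub> \<rho> j p)"
    unfolding \<Phi>_def by (rule someI_ex) (use endo_scalar[OF f] in blast)
  thus "\<Phi> f \<in> carrier R" by blast
  show "\<rho> j a = \<Phi> f \<otimes>\<^bsub>R\<^esub> \<rho> j p" if "acts1 f p a" "j < blocks" for p a j
    using * that acts_F by blast
qed

lemma blocks_pos: "0 < blocks" by (simp add: blocks_def)

lemma \<Phi>_eq:
  assumes f: "f \<in> S_hom L Robj Robj" and a: "acts1 f (\<sigma> 0 \<one>\<^bsub>R\<^esub>) a"
  shows "\<Phi> f = \<rho> 0 a"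
  using \<Phi>(2)[OF f a blocks_pos] \<Phi>(1)[OF f] by (simp add: \<sigma>)

lemma acts_exists:
  assumes f: "f \<in> S_hom L Robj Robj" and p: "p \<in> F" obtains a where "acts1 f p a"
proof -
  interpret framed_hom L t Robj C rank graphU shiftW Robj C rank graphU shiftW f by (rule endo[OF f])
  show ?thesis using X_ex[OF p] that by blast
qed

lemma acts1_F: "acts1 f p a \<Longrightarrow> p \<in> F" "acts1 f p a \<Longrightarrow> a \<in> F" by (auto simp: acts_def)

lemma \<Phi>_hom: "\<Phi> \<in> ring_hom (S_End L Robj) R"
proof (rule ring_hom_memI)
  interpret E: ring "S_End L Robj" by (rule S_End_ring[OF Robj_obj])
  interpret M: framed L t Robj C rank graphU shiftW by (rule Robj_framed)
  have car: "carrier (S_End L Robj) = S_hom L Robj Robj" by (simp add: S_End_def)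
  have one: "\<sigma> 0 \<one>\<^bsub>R\<^esub> \<in> F" by (simp add: \<sigma>)
  have inC: "C (\<lambda>i. T 1 (p i)) Z Z \<in> carrier (fst Robj)" if "p \<in> F" for p
    using M.U_T[OF that, of 1] by (intro M.carrierI) auto
  show "\<Phi> f \<in> carrier R" if "f \<in> carrier (S_End L Robj)" for f using that \<Phi>(1) car by simp
  fix f g assume fg: "f \<in> carrier (S_End L Robj)" "g \<in> carrier (S_End L Robj)"
  hence fg': "f \<in> S_hom L Robj Robj" "g \<in> S_hom L Robj Robj" using car by auto
  show "\<Phi> (f \<otimes>\<^bsub>S_End L Robj\<^esub> g) = \<Phi> f \<otimes>\<^bsub>R\<^esub> \<Phi> g"
  proof -
    have mult: "f \<otimes>\<^bsub>S_End L Robj\<^esub> g = compose (carrier (fst Robj)) f g" by (simp add: S_End_def)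
    have h: "compose (carrier (fst Robj)) f g \<in> S_hom L Robj Robj"
      using E.m_closed[OF fg] by (simp add: car mult)
    obtain a where a: "acts1 g (\<sigma> 0 \<one>\<^bsub>R\<^esub>) a" by (rule acts_exists[OF fg'(2) one])
    obtain b where b: "acts1 f a b" by (rule acts_exists[OF fg'(1) acts1_F(2)[OF a]])
    obtain c where c: "acts1 (compose (carrier (fst Robj)) f g) (\<sigma> 0 \<one>\<^bsub>R\<^esub>) c" "vcong rank 1 c b"
      using acts_comp[OF endo[OF fg'(2)] endo[OF fg'(1)] a b] by blast
    have "\<Phi> (compose (carrier (fst Robj)) f g) = \<rho> 0 c" by (rule \<Phi>_eq[OF h c(1)])
    also have "\<dots> = \<rho> 0 b" using c(2) acts1_F(2)[OF c(1)] acts1_F(2)[OF b] blocks_pos by (intro \<rho>_cong)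
    also have "\<dots> = \<Phi> f \<otimes>\<^bsub>R\<^esub> \<rho> 0 a" by (rule \<Phi>(2)[OF fg'(1) b blocks_pos])
    also have "\<rho> 0 a = \<Phi> g" by (rule \<Phi>_eq[OF fg'(2) a, symmetric])
    finally show ?thesis by (simp add: mult)
  qed
  show "\<Phi> (f \<oplus>\<^bsub>S_End L Robj\<^esub> g) = \<Phi> f \<oplus>\<^bsub>R\<^esub> \<Phi> g"
  proof -
    let ?h = "f \<oplus>\<^bsub>S_End L Robj\<^esub> g"
    have h: "?h \<in> S_hom L Robj Robj" using E.a_closed[OF fg] by (simp add: car)
    obtain a where a: "acts1 f (\<sigma> 0 \<one>\<^bsub>R\<^esub>) a" by (rule acts_exists[OF fg'(1) one])
    obtain b where b: "acts1 g (\<sigma> 0 \<one>\<^bsub>R\<^esub>) b" by (rule acts_exists[OF fg'(2) one])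
    obtain u v where uv: "u \<in> F" "v \<in> F"
      "f (C (\<lambda>i. T 1 (\<sigma> 0 \<one>\<^bsub>R\<^esub> i)) Z Z) = C (\<lambda>i. T 1 (a i)) u v" using a unfolding acts_def by blast
    obtain u' v' where uv': "u' \<in> F" "v' \<in> F"
      "g (C (\<lambda>i. T 1 (\<sigma> 0 \<one>\<^bsub>R\<^esub> i)) Z Z) = C (\<lambda>i. T 1 (b i)) u' v'" using b unfolding acts_def by blast
    note F = acts1_F[OF a] acts1_F[OF b]
    have tF: "(\<lambda>i. T 1 (a i)) \<in> F" "(\<lambda>i. T 1 (b i)) \<in> F" using F by auto
    have "?h (C (\<lambda>i. T 1 (\<sigma> 0 \<one>\<^bsub>R\<^esub> i)) Z Z) = C (\<lambda>i. T 1 (a i)) u v \<oplus>\<^bsub>fst Robj\<^esub> C (\<lambda>i. T 1 (b i)) u' v'"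
      using inC[OF one] uv(3) uv'(3) by (simp add: S_End_def)
    also have "\<dots> = C (\<lambda>i. T 1 (a i) \<oplus> T 1 (b i)) (\<lambda>i. u i \<oplus> u' i) (\<lambda>i. v i \<oplus> v' i)"
      using tF uv uv' by (intro M.\<kappa>_add)
    also have "(\<lambda>i. T 1 (a i) \<oplus> T 1 (b i)) = (\<lambda>i. T 1 (a i \<oplus> b i))" using F by (auto simp: r_distr Pi_def)
    finally have "acts1 ?h (\<sigma> 0 \<one>\<^bsub>R\<^esub>) (\<lambda>i. a i \<oplus> b i)"
      unfolding acts_def using F uv uv' by (intro conjI bexI[of _ "\<lambda>i. u i \<oplus> u' i"] bexI[of _ "\<lambda>i. v i \<oplus> v' i"]) auto
    hence "\<Phi> ?h = \<rho> 0 (\<lambda>i. a i \<oplus> b i)" by (rule \<Phi>_eq[OF h])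
    also have "\<dots> = \<Phi> f \<oplus>\<^bsub>R\<^esub> \<Phi> g" using F \<Phi>_eq[OF fg'(1) a] \<Phi>_eq[OF fg'(2) b] by (simp add: \<rho>_add)
    finally show ?thesis .
  qed
next
  interpret E: ring "S_End L Robj" by (rule S_End_ring[OF Robj_obj])
  interpret M: framed L t Robj C rank graphU shiftW by (rule Robj_framed)
  have one: "\<sigma> 0 \<one>\<^bsub>R\<^esub> \<in> F" by (simp add: \<sigma>)
  have h: "\<one>\<^bsub>S_End L Robj\<^esub> \<in> S_hom L Robj Robj" using E.one_closed by (simp add: S_End_def)
  have c: "C (\<lambda>i. T 1 (\<sigma> 0 \<one>\<^bsub>R\<^esub> i)) Z Z \<in> carrier (fst Robj)"
    using M.U_T[OF one, of 1] by (intro M.carrierI) auto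
  have "acts1 \<one>\<^bsub>S_End L Robj\<^esub> (\<sigma> 0 \<one>\<^bsub>R\<^esub>) (\<sigma> 0 \<one>\<^bsub>R\<^esub>)"
    unfolding acts_def using one c by (intro conjI bexI[of _ "\<lambda>i. \<zero>"]) (auto simp: S_End_def)
  thus "\<Phi> \<one>\<^bsub>S_End L Robj\<^esub> = \<one>\<^bsub>R\<^esub>" using \<Phi>_eq[OF h] by (simp add: \<sigma>)
qed

lemma \<Phi>_surj: "\<Phi> ` carrier (S_End L Robj) = carrier R"
proof
  show "\<Phi> ` carrier (S_End L Robj) \<subseteq> carrier R" using \<Phi>_hom by (auto simp: ring_hom_def)
  show "carrier R \<subseteq> \<Phi> ` carrier (S_End L Robj)"
  proof
    fix r assume r: "r \<in> carrier R"
    obtain \<Theta> where \<Theta>: "\<And>p. p \<in> F \<Longrightarrow> \<Theta> p \<in> F"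
      "\<And>p q. p \<in> F \<Longrightarrow> q \<in> F \<Longrightarrow> \<Theta> (\<lambda>i. p i \<oplus> q i) = (\<lambda>i. \<Theta> p i \<oplus> \<Theta> q i)"
      "\<And>p c. p \<in> F \<Longrightarrow> c \<in> carrier L \<Longrightarrow> \<Theta> (\<lambda>i. c \<otimes> p i) = (\<lambda>i. c \<otimes> \<Theta> p i)"
      "\<And>k p q. p \<in> F \<Longrightarrow> q \<in> F \<Longrightarrow> vcong rank k p q \<Longrightarrow> vcong rank k (\<Theta> p) (\<Theta> q)"
      "\<And>p j. p \<in> F \<Longrightarrow> \<rho> j (\<Theta> p) = r \<otimes>\<^bsub>R\<^esub> \<rho> j p" by (rule lift_mult[OF r]) blast
    have U: "\<Theta> p \<in> graphU" if p: "p \<in> graphU" for p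
    proof -
      obtain x where x: "p \<in> F" "x \<in> carrier R" "\<And>j. j < blocks \<Longrightarrow> \<rho> j p = x \<otimes>\<^bsub>R\<^esub> gen j" using p unfolding graphU_def by blast
      have "\<forall>j<blocks. \<rho> j (\<Theta> p) = (r \<otimes>\<^bsub>R\<^esub> x) \<otimes>\<^bsub>R\<^esub> gen j" using x r by (simp add: \<Theta>(5) R.m_assoc)
      thus ?thesis unfolding graphU_def using \<Theta>(1)[OF x(1)] x r by auto
    qed
    have W: "(\<Theta> p, \<Theta> q) \<in> shiftW" if "(p, q) \<in> shiftW" for p q
      using that r \<Theta>(1,5) unfolding shiftW_def by simp
    obtain f where f: "f \<in> S_hom L Robj Robj"
      "\<And>p q r. p \<in> graphU \<Longrightarrow> q \<in> F \<Longrightarrow> r \<in> F \<Longrightarrow> f (C p q r) = C (\<Theta> p) (\<Theta> q) (\<Theta> r)"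
      by (rule framed_lift[where \<Theta> = \<Theta>, OF Robj_framed Robj_framed \<Theta>(1-4) U W]) blast+
    interpret M: framed L t Robj C rank graphU shiftW by (rule Robj_framed)
    let ?p = "\<sigma> 0 \<one>\<^bsub>R\<^esub>"
    have one: "?p \<in> F" by (simp add: \<sigma>)
    have TU: "(\<lambda>i. T 1 (?p i)) \<in> graphU" using M.U_T[OF one, of 1] by simp
    have zF: "Z \<in> F" by auto
    have "f (C (\<lambda>i. T 1 (?p i)) Z Z) = C (\<Theta> (\<lambda>i. T 1 (?p i))) (\<Theta> Z) (\<Theta> Z)"
      by (rule f(2)[OF TU zF zF])
    also have "\<Theta> (\<lambda>i. T 1 (?p i)) = (\<lambda>i. T 1 (\<Theta> ?p i))" by (rule \<Theta>(3)[OF one]) simp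
    finally have "acts1 f ?p (\<Theta> ?p)"
      unfolding acts_def using one \<Theta>(1)[OF one] \<Theta>(1)[OF zF] by blast
    hence "\<Phi> f = \<rho> 0 (\<Theta> ?p)" by (rule \<Phi>_eq[OF f(1)])
    also have "\<dots> = r" using r by (simp add: \<Theta>(5)[OF one] \<sigma>)
    finally show "r \<in> \<Phi> ` carrier (S_End L Robj)" using f(1) by (auto simp: S_End_def)
  qed
qed

text \<open>The map induced by the first factor vanishes, hence so does the map induced by the composite.\<close>
lemma through_vanish:
  assumes f: "f \<in> S_End_through L Robj Iobj" shows "\<Phi> f = \<zero>\<^bsub>R\<^esub>"
proof -
  obtain k u v where fh: "f \<in> S_hom L Robj Robj" and u: "u \<in> S_hom L Robj (S_power Iobj k)"
    and v: "v \<in> S_hom L (S_power Iobj k) Robj" and coords: "f = compose (carrier (fst Robj)) v u"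
    using f unfolding S_End_through_def by blast
  interpret u: framed_hom L t Robj C rank graphU shiftW "S_power Iobj k" "powel k" k "tF k" "tF k \<times> tF k" u
    by (rule framed_homI[OF Robj_framed I_power_framed u])
  interpret v: framed_hom L t "S_power Iobj k" "powel k" k "tF k" "tF k \<times> tF k" Robj C rank graphU shiftW v
    by (rule framed_homI[OF I_power_framed Robj_framed v])
  have one: "\<sigma> 0 \<one>\<^bsub>R\<^esub> \<in> F" by (simp add: \<sigma>)
  obtain a where a: "u.A (\<sigma> 0 \<one>\<^bsub>R\<^esub>) a" by (rule u.X_ex[OF one])
  have a0: "vcong k 1 a Z"
  proof (rule maps_to_I_vanish[where A = "u.A" and m' = k, OF _ _ _ _ _ _ one a])
    show "\<exists>a. u.A p a" if "p \<in> F" for p using u.X_ex[OF that] by blast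
    show "vcong k 1 a Z \<and> vcong k 1 b Z" if "(p, q) \<in> shiftW" "u.A p a" "u.A q b" for p q a b
      using u.acts_W[OF that] by (simp add: tF_def)
  qed (rule u.acts_add u.acts_smult u.acts_unique u.acts_F(2); assumption)+
  obtain b where b: "v.A a b" by (rule v.X_ex[OF u.acts_F(2)[OF a]])
  have "vcong rank 1 b (\<lambda>i. \<zero> \<otimes> b i)"
    by (rule v.acts_unique[OF b v.acts_smult[OF b]]) (use a0 u.acts_F(2)[OF a] in \<open>auto simp: Pi_def\<close>)
  hence b0: "vcong rank 1 b Z" using v.acts_F(2)[OF b] by (simp add: Pi_def)
  obtain c where c: "acts1 f (\<sigma> 0 \<one>\<^bsub>R\<^esub>) c" "vcong rank 1 c b"
    using acts_comp[OF u.framed_hom_axioms v.framed_hom_axioms a b] unfolding coords by blast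
  have "\<Phi> f = \<rho> 0 c" by (rule \<Phi>_eq[OF fh c(1)])
  also have "\<dots> = \<rho> 0 Z"
    using acts1_F(2)[OF c(1)] vcong_trans[OF c(2) b0] blocks_pos by (intro \<rho>_cong) auto
  finally show ?thesis by (simp add: \<rho>_zero)
qed

text \<open>The image lies in the object \<open>?K\<close> with zero subspaces inside the same ambient module, which is
  isomorphic to a power of \<open>I\<close> by the identity on coordinates.\<close>
lemma vanish_through:
  assumes f: "f \<in> S_hom L Robj Robj" and z: "\<Phi> f = \<zero>\<^bsub>R\<^esub>" shows "f \<in> S_End_through L Robj Iobj"
proof -
  interpret f: framed_hom L t Robj C rank graphU shiftW Robj C rank graphU shiftW f by (rule endo[OF f])
  let ?K = "object_of rank (tF rank) (tF rank \<times> tF rank)"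
  have K: "framed L t ?K C rank (tF rank) (tF rank \<times> tF rank)" by (rule object_of_framed[OF tF_subspace_pair])
  interpret K: framed L t ?K C rank "tF rank" "tF rank \<times> tF rank" by (rule K)
  have nil: "vcong rank 1 a Z" if a: "f.A p a" for p a
  proof -
    have "\<rho> j a = \<zero>\<^bsub>R\<^esub>" if "j < blocks" for j
      using \<Phi>(2)[OF f a that] f.acts_F[OF a] z by simp
    thus ?thesis using f.acts_F[OF a] by (intro \<rho>_inj) (auto simp: \<rho>_zero)
  qed
  have fc: "f x \<in> carrier (fst ?K)" if x: "x \<in> carrier (fst Robj)" for x
  proof -
    obtain u b c where "u \<in> F" "vcong rank 1 u Z" "b \<in> F" "c \<in> F" "f x = C u b c"
      by (rule f.nil_carrier[OF nil x]) auto
    moreover from this have "u \<in> tF rank" by (simp add: tF_def)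
    ultimately show ?thesis by (simp add: K.carrierI)
  qed
  have fs: "f x \<in> snd ?K" if x: "x \<in> snd Robj" for x
  proof -
    obtain P Q where PQ: "P \<in> F" "Q \<in> F" "vcong rank 1 P Z" "vcong rank 1 Q Z"
      "f x = J1_at C P Q"
      by (rule f.nil_sub[OF nil x]) auto
    hence "(P, Q) \<in> tF rank \<times> tF rank" by (simp add: tF_def)
    thus ?thesis unfolding PQ(5) by (rule K.subI)
  qed
  have ops: "(\<oplus>\<^bsub>fst ?K\<^esub>) = (\<oplus>\<^bsub>fst Robj\<^esub>)" "(\<odot>\<^bsub>fst ?K\<^esub>) = (\<odot>\<^bsub>fst Robj\<^esub>)" by (simp_all add: object_of_def)
  have fK: "f \<in> S_hom L Robj ?K"
    using f fc fs unfolding S_hom_def ops by (auto simp: PiE_iff)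
  have sub: "p \<in> graphU" if "p \<in> tF rank" for p
    using that by (intro f.src.U_cong[OF f.src.U_zero]) (auto simp: tF_def)
  have subW: "(p, q) \<in> shiftW" if "(p, q) \<in> tF rank \<times> tF rank" for p q
    using that by (intro f.src.W_cong[OF f.src.W_zero]) (auto simp: tF_def)
  obtain \<iota> where \<iota>: "\<iota> \<in> S_hom L ?K (S_power Iobj rank)"
    "\<And>p q r. p \<in> tF rank \<Longrightarrow> q \<in> F \<Longrightarrow> r \<in> F \<Longrightarrow> \<iota> (C p q r) = powel rank p q r"
    by (rule framed_lift[OF K I_power_framed, of "\<lambda>p. p"]) auto
  obtain \<eta> where \<eta>: "\<eta> \<in> S_hom L (S_power Iobj rank) Robj"
    "\<And>p q r. p \<in> tF rank \<Longrightarrow> q \<in> F \<Longrightarrow> r \<in> F \<Longrightarrow> \<eta> (powel rank p q r) = C p q r"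
    by (rule framed_lift[OF I_power_framed Robj_framed, of "\<lambda>p. p"]) (use sub subW in auto)
  let ?u = "compose (carrier (fst Robj)) \<iota> f"
  have u: "?u \<in> S_hom L Robj (S_power Iobj rank)"
    by (rule S_hom_compose[OF f.src.is_module fK \<iota>(1) f.src.sub_carrier])
  have "f = compose (carrier (fst Robj)) \<eta> ?u"
  proof
    fix x show "f x = compose (carrier (fst Robj)) \<eta> ?u x"
    proof (cases "x \<in> carrier (fst Robj)")
      case True
      obtain p q r where "p \<in> tF rank" "q \<in> F" "r \<in> F" "f x = C p q r"
        using fc[OF True] by (elim K.carrierE) blast
      thus ?thesis using True by (simp add: compose_def \<iota>(2) \<eta>(2))
    next
      case False
      thus ?thesis using f by (auto simp: compose_def S_hom_def PiE_iff extensional_def)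
    qed
  qed
  thus ?thesis unfolding S_End_through_def using f u \<eta>(1) by blast
qed

theorem endomorphism_quotient: "S_End L Robj Quot S_End_through L Robj Iobj \<simeq> R"
proof -
  interpret ring_hom_ring "S_End L Robj" R \<Phi>
    by (rule ring_hom_ringI2[OF S_End_ring[OF Robj_obj] R.ring_axioms \<Phi>_hom])
  have "a_kernel (S_End L Robj) R \<Phi> = S_End_through L Robj Iobj"
    unfolding a_kernel_def'
  proof (intro equalityI subsetI)
    fix f assume "f \<in> {r \<in> carrier (S_End L Robj). \<Phi> r = \<zero>\<^bsub>R\<^esub>}"
    thus "f \<in> S_End_through L Robj Iobj" by (intro vanish_through) (auto simp: S_End_def)
  next
    fix f assume f: "f \<in> S_End_through L Robj Iobj"
    hence "f \<in> S_hom L Robj Robj" unfolding S_End_through_def by blast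
    thus "f \<in> {r \<in> carrier (S_End L Robj). \<Phi> r = \<zero>\<^bsub>R\<^esub>}" using through_vanish[OF f] by (simp add: S_End_def)
  qed
  thus ?thesis using FactRing_iso[OF \<Phi>_surj] by simp
qed

end

lemma (in uniserial7) residue_actionI:
  fixes R :: "('a set, 'r) module"
  assumes rad: "ring_rad L = PIdl t" and alg: "assoc_algebra (L Quot ring_rad L) R"
  shows "residue_action L t R (\<lambda>a x. (ring_rad L +> a) \<odot>\<^bsub>R\<^esub> x)"
proof -
  let ?I = "ring_rad L" and ?K = "L Quot ring_rad L"
  have I: "ideal ?I L" unfolding rad by (rule cgenideal_ideal) simp
  interpret I: ideal ?I L by (rule I)
  interpret M: module ?K R using alg by (simp add: assoc_algebra_def)
  interpret R: ring R using alg by (simp add: assoc_algebra_def)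
  have kc: "?I +> a \<in> carrier ?K" if "a \<in> carrier L" for a
    using that by (auto simp: FactRing_def A_RCOSETS_def RCOSETS_def a_r_coset_def)
  have kadd: "?I +> (a \<oplus> b) = (?I +> a) \<oplus>\<^bsub>?K\<^esub> (?I +> b)" if "a \<in> carrier L" "b \<in> carrier L" for a b
    using I.a_rcos_sum[OF that] by (simp add: FactRing_def)
  have kmult: "?I +> (a \<otimes> b) = (?I +> a) \<otimes>\<^bsub>?K\<^esub> (?I +> b)" if "a \<in> carrier L" "b \<in> carrier L" for a b
    using I.rcoset_mult_add[OF that] by (simp add: FactRing_def)
  have kone: "?I +> \<one> = \<one>\<^bsub>?K\<^esub>" by (simp add: FactRing_def)
  have kt: "?I +> (t \<otimes> a) = \<zero>\<^bsub>?K\<^esub>" if "a \<in> carrier L" for a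
  proof -
    have "t \<otimes> a \<in> ?I" unfolding rad cgenideal_def using that m_comm by auto
    thus ?thesis by (simp add: FactRing_def I.a_rcos_const)
  qed
  show ?thesis
  proof
    fix a b x y assume ab: "a \<in> carrier L" and x: "x \<in> carrier R"
    show "(?I +> a) \<odot>\<^bsub>R\<^esub> x \<in> carrier R" using kc ab x by auto
    show "(?I +> (t \<otimes> a)) \<odot>\<^bsub>R\<^esub> x = \<zero>\<^bsub>R\<^esub>" using x by (simp add: kt[OF ab])
    { assume b: "b \<in> carrier L"
      show "(?I +> (a \<oplus> b)) \<odot>\<^bsub>R\<^esub> x = (?I +> a) \<odot>\<^bsub>R\<^esub> x \<oplus>\<^bsub>R\<^esub> (?I +> b) \<odot>\<^bsub>R\<^esub> x"
        unfolding kadd[OF ab b] using kc ab b x by (intro M.smult_l_distr) auto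
      show "(?I +> (a \<otimes> b)) \<odot>\<^bsub>R\<^esub> x = (?I +> a) \<odot>\<^bsub>R\<^esub> ((?I +> b) \<odot>\<^bsub>R\<^esub> x)"
        unfolding kmult[OF ab b] using kc ab b x by (intro M.smult_assoc1) auto }
    { assume y: "y \<in> carrier R"
      show "(?I +> a) \<odot>\<^bsub>R\<^esub> (x \<oplus>\<^bsub>R\<^esub> y) = (?I +> a) \<odot>\<^bsub>R\<^esub> x \<oplus>\<^bsub>R\<^esub> (?I +> a) \<odot>\<^bsub>R\<^esub> y"
        using kc ab x y by (intro M.smult_r_distr) auto
      show "((?I +> a) \<odot>\<^bsub>R\<^esub> x) \<otimes>\<^bsub>R\<^esub> y = (?I +> a) \<odot>\<^bsub>R\<^esub> (x \<otimes>\<^bsub>R\<^esub> y)"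
        "x \<otimes>\<^bsub>R\<^esub> ((?I +> a) \<odot>\<^bsub>R\<^esub> y) = (?I +> a) \<odot>\<^bsub>R\<^esub> (x \<otimes>\<^bsub>R\<^esub> y)"
        using alg kc[OF ab] x y unfolding assoc_algebra_def by blast+ }
  next
    show "(?I +> \<one>) \<odot>\<^bsub>R\<^esub> x = x" if "x \<in> carrier R" for x using that by (simp add: kone)
  qed
qed

theorem mainTheorem2:
  fixes \<Lambda> :: "('a, 'm) ring_scheme"
    and n :: nat
    and t :: 'a
    and R :: "('a set, 'r) module"
  assumes "cring \<Lambda>" and "local_ring \<Lambda>" and "uniserial_ring \<Lambda>"
    and "ring_has_length \<Lambda> n" and "n \<ge> 7"
    and "t \<in> carrier \<Lambda>" and "ring_rad \<Lambda> = PIdl\<^bsub>\<Lambda>\<^esub> t"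
    and "fin_dim_algebra (\<Lambda> Quot ring_rad \<Lambda>) R"
  shows "\<exists>M :: ('a, (nat \<Rightarrow> 'a) set) sub_pair.
    S_obj \<Lambda> M \<and> (S_End \<Lambda> M Quot S_End_through \<Lambda> M (I_obj \<Lambda> t)) \<simeq> R"
proof -
  let ?K = "\<Lambda> Quot ring_rad \<Lambda>"
  let ?sm = "\<lambda>a x. (ring_rad \<Lambda> +>\<^bsub>\<Lambda>\<^esub> a) \<odot>\<^bsub>R\<^esub> x"
  interpret uniserial7 \<Lambda> t
    by (rule cring.uniserial7_of_length[OF assms(1,3,2,4-7)])
  have alg: "assoc_algebra ?K R" "finitely_generated ?K R" using assms(8) by (auto simp: fin_dim_algebra_def)
  interpret A: residue_action \<Lambda> t R ?sm by (rule residue_actionI[OF assms(7) alg(1)])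
  interpret M: module ?K R using alg by (simp add: assoc_algebra_def)
  obtain S where S: "finite S" "S \<subseteq> carrier R" "module_span ?K R S = carrier R"
    using alg(2) unfolding finitely_generated_def by blast
  have "\<exists>s d. residue_algebra \<Lambda> t R ?sm s d"
  proof (rule A.exists_basis[OF S(1,2)])
    fix X assume X: "S \<subseteq> X" "X \<subseteq> carrier R" "\<zero>\<^bsub>R\<^esub> \<in> X" "\<And>x y. x \<in> X \<Longrightarrow> y \<in> X \<Longrightarrow> x \<oplus>\<^bsub>R\<^esub> y \<in> X"
      "\<And>a x. a \<in> carrier \<Lambda> \<Longrightarrow> x \<in> X \<Longrightarrow> ?sm a x \<in> X"
    have sm: "a \<odot>\<^bsub>R\<^esub> x \<in> X" if a: "a \<in> carrier ?K" and x: "x \<in> X" for a x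
    proof -
      obtain b where "b \<in> carrier \<Lambda>" "a = ring_rad \<Lambda> +>\<^bsub>\<Lambda>\<^esub> b"
        using a by (auto simp: FactRing_def A_RCOSETS_def RCOSETS_def a_r_coset_def)
      thus ?thesis using X(5) x by simp
    qed
    have "submodule X ?K R"
    proof (rule M.submoduleI[OF X(2,3) _ X(4) sm])
      fix x assume x: "x \<in> X"
      have "\<ominus>\<^bsub>R\<^esub> x = (\<ominus>\<^bsub>?K\<^esub> \<one>\<^bsub>?K\<^esub>) \<odot>\<^bsub>R\<^esub> x" using x X(2) by (auto simp: M.smult_l_minus)
      thus "\<ominus>\<^bsub>R\<^esub> x \<in> X" using sm[OF _ x] by simp
    qed
    hence "module_span ?K R S \<subseteq> X" using X(1) unfolding module_span_def by blast
    thus "carrier R \<subseteq> X" using S(3) by simp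
  qed
  then obtain s d where "residue_algebra \<Lambda> t R ?sm s d" by blast
  then interpret B: residue_algebra \<Lambda> t R ?sm s d .
  show ?thesis by (intro exI[of _ B.Robj] conjI B.Robj_obj B.endomorphism_quotient)
qed

end
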